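(* Let $A$ be a densely defined strongly positive operator in a Banach space $X$ with spectral characteristics $\rho_0,\varphi$. Let $\alpha>0$ and let the function $f$ with values in $X$ be such that $f(t)\in D(A^{\alpha})$ for $t\in[0,\infty)$, and such that $f$ can be analytically extended into the sector $\Sigma_f=\{\rho e^{i\theta_1}:\rho\in[0,\infty],\ |\theta_1|<\varphi\}$, where the estimate $$\|A^{\alpha}f(w)\|\le c_\alpha e^{-\delta_\alpha|\mathrm{Re}\,w|},\qquad w\in\Sigma_f,$$ holds with some constants $c_\alpha>0$ and $\delta_\alpha\in(0,\sqrt2\rho_0]$. Fix $j\in\{1,\dots,m\}$ and let $$u_{2,ih,j}(t)=\int_0^{t_j}B^{-1}e^{-A(t+t_j-\tau)}f(\tau)\,d\tau,\qquad t\ge0 .$$ Let $h=c_0/\sqrt N$ with a fixed constant $c_0>0$, and let $$u_{2,j,N}(t)=\frac{h}{2\pi i}\sum_{k=-N}^{N}e^{-z(kh)t}z'(kh)B^{-1}(z(kh))\left[(z(kh)I-A)^{-1}-\frac1{z(kh)}I\right]h\sum_{p=-N}^{N}\mu_{k,p,j}f(\omega_{p,j}),$$ where $B$, $B^{-1}(z)$, $z(\xi)$, $\mu_{k,p,j}$, $\omega_{p,j}$ are as defined in the context. Then $u_{2,j,N}(t)$ converges to $u_{2,ih,j}(t)$ uniformly with respect to $t\ge 0$, and moreover $$\|u_{2,ih,j}(t)-u_{2,j,N}(t)\|\le c\,e^{-c_1\sqrt N}$$ with positive constants $c,c_1$ which depend on $\alpha,\varphi,\rho_0$ and are independent of $N$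 and $t$.
   Context: Strongly positive operator: $A$ is a densely defined closed operator in the Banach space $X$ for which there are $\rho_0>0$, $\varphi\in(0,\pi/2)$ (the spectral characteristics of $A$) and $M>0$ such that the spectrum of $A$ lies in the sector $\Sigma=\{\rho_0+re^{i\theta}: r\in[0,\infty),\ |\theta|<\varphi\}$, and outside $\Sigma$ and on its boundary $\|(zI-A)^{-1}\|\le \dfrac{M}{1+|z|}$. $e^{-At}$ is the semigroup generated by $-A$; $A^\alpha$ is the fractional power. Nonlocal data (coming from the problem $u'+Au=f$, $u(0)+\sum_{k=1}^m\alpha_ku(t_k)=u_0$): $m\ge1$, $0<t_1<t_2<\dots<t_m\le T$, $\alpha_1,\dots,\alpha_m\in\mathbb R$, satisfying the existence and uniqueness condition $\sum_{i=1}^m|\alpha_i|<1$ or $\sum_{i=1}^m|\alpha_i|e^{-\rho_0t_i}<1$. Put $B=I+\sum_{i=1}^m\alpha_ie^{-At_i}$, which is then boundedly invertible, and for complex $z$ put $B^{-1}(z)=\left(1+\sum_{i=1}^m\alpha_ie^{-zt_i}\right)^{-1}$. Parameters of the integration hyperbola: fix $\rho_1$ with $0<\rho_1<\rho_0$ and $\sum_{i=1}^m|\alpha_i|e^{-\rho_1t_i}<1$. Put $b_0=\rho_0\tan\varphi$, $$d_1=\arccos\left(\frac{\rho_1}{\sqrt{\rho_0^2+b_0^2}}\right)-\varphi,\quad a_I=\sqrt{\rho_0^2+b_0^2}\,\cos\left(\tfrac{d_1}{2}+\varphi\right),\quad b_I=\sqrt{\rho_0^2+b_0^2}\,\sin\left(\tfrac{d_1}{2}+\varphi\right),$$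 $$z(\xi)=a_I\cosh\xi-ib_I\sinh\xi,\qquad z'(\xi)=a_I\sinh\xi-ib_I\cosh\xi,\quad \xi\in\mathbb R.$$ Inner quadrature weights and nodes: $$\mu_{k,p,j}=\frac{t_j}{2}\,\frac{\exp\left\{-\frac{t_j}{2}z(kh)[1-\tanh(ph)]\right\}}{\cosh^2(ph)},\qquad \omega_{p,j}=\frac{t_j}{2}[1+\tanh(ph)].$$ *)

theory Defs
  imports "HOL-Analysis.Analysis"
begin

section \<open>Complex Banach spaces\<close>

class complex_banach = banach +
  fixes scaleC :: "complex \<Rightarrow> 'a \<Rightarrow> 'a"  (infixr "*\<^sub>C" 75)
  assumes scaleC_add_right: "c *\<^sub>C (x + y) = c *\<^sub>C x + c *\<^sub>C y"
    and scaleC_add_left: "(c + d) *\<^sub>C x = c *\<^sub>C x + d *\<^sub>C x"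
    and scaleC_scaleC: "c *\<^sub>C (d *\<^sub>C x) = (c * d) *\<^sub>C x"
    and scaleC_of_real: "complex_of_real r *\<^sub>C x = r *\<^sub>R x"
    and norm_scaleC: "norm (c *\<^sub>C x) = cmod c * norm x"

instantiation complex :: complex_banach
begin

definition scaleC_complex :: "complex \<Rightarrow> complex \<Rightarrow> complex" where
  "scaleC_complex c x = c * x"

instance
  by standard (simp_all add: scaleC_complex_def algebra_simps scaleR_conv_of_real norm_mult)

end

definition bounded_clinear :: "('a::complex_banach \<Rightarrow> 'a) \<Rightarrow> bool" where
  "bounded_clinear S \<longleftrightarrow> bounded_linear S \<and> (\<forall>c x. S (c *\<^sub>C x) = c *\<^sub>C S x)"

definition holomorphic_vec_on :: "(complex \<Rightarrow> 'a::complex_banach) \<Rightarrow> complex set \<Rightarrow> bool"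
    (infixl "(holomorphic'_vec'_on)" 50) where
  "F holomorphic_vec_on S \<longleftrightarrow>
     (\<forall>w\<in>S. \<exists>F'. ((\<lambda>v. inverse (v - w) *\<^sub>C (F v - F w)) \<longlongrightarrow> F') (at w within S))"


section \<open>Unbounded operators\<close>

text \<open>An unbounded operator is a pair \<open>D, A\<close> of a domain and a function; the values of \<open>A\<close>
  outside \<open>D\<close> are irrelevant.\<close>

definition densely_defined_closed :: "'a::complex_banach set \<Rightarrow> ('a \<Rightarrow> 'a) \<Rightarrow> bool" where
  "densely_defined_closed D A \<longleftrightarrow>
     0 \<in> D \<and> (\<forall>x\<in>D. \<forall>y\<in>D. x + y \<in> D \<and> A (x + y) = A x + A y) \<and>
     (\<forall>c. \<forall>x\<in>D. c *\<^sub>C x \<in> D \<and> A (c *\<^sub>C x) = c *\<^sub>C A x) \<and>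
     closure D = UNIV \<and> closed ((\<lambda>x. (x, A x)) ` D)"

definition resolvent :: "'a::complex_banach set \<Rightarrow> ('a \<Rightarrow> 'a) \<Rightarrow> complex \<Rightarrow> 'a \<Rightarrow> 'a" where
  "resolvent D A z = inv_into D (\<lambda>x. z *\<^sub>C x - A x)"

definition resolvent_set :: "'a::complex_banach set \<Rightarrow> ('a \<Rightarrow> 'a) \<Rightarrow> complex set" where
  "resolvent_set D A =
     {z. bij_betw (\<lambda>x. z *\<^sub>C x - A x) D UNIV \<and> bounded_clinear (resolvent D A z)}"

definition spectrum :: "'a::complex_banach set \<Rightarrow> ('a \<Rightarrow> 'a) \<Rightarrow> complex set" where
  "spectrum D A = - resolvent_set D A"

definition sector :: "real \<Rightarrow> real \<Rightarrow> complex set" where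
  "sector v \<phi> = {of_real v + of_real r * exp (\<i> * of_real \<theta>) | r \<theta>. 0 \<le> r \<and> \<bar>\<theta>\<bar> < \<phi>}"

definition strongly_positive ::
    "'a::complex_banach set \<Rightarrow> ('a \<Rightarrow> 'a) \<Rightarrow> real \<Rightarrow> real \<Rightarrow> bool" where
  "strongly_positive D A \<rho>\<^sub>0 \<phi> \<longleftrightarrow>
     densely_defined_closed D A \<and> 0 < \<rho>\<^sub>0 \<and> 0 < \<phi> \<and> \<phi> < pi / 2 \<and>
     spectrum D A \<subseteq> sector \<rho>\<^sub>0 \<phi> \<and>
     (\<exists>M>0. \<forall>z \<in> - sector \<rho>\<^sub>0 \<phi> \<union> frontier (sector \<rho>\<^sub>0 \<phi>).
        z \<in> resolvent_set D A \<and> onorm (resolvent D A z) \<le> M / (1 + cmod z))"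


section \<open>Semigroups and fractional powers\<close>

text \<open>Semigroups are indexed by \<^typ>\<open>real\<close>; only the values at \<open>t \<ge> 0\<close> matter.\<close>

definition C0_semigroup :: "(real \<Rightarrow> 'a::complex_banach \<Rightarrow> 'a) \<Rightarrow> bool" where
  "C0_semigroup S \<longleftrightarrow>
     (\<forall>t\<ge>0. bounded_clinear (S t)) \<and> S 0 = id \<and>
     (\<forall>s\<ge>0. \<forall>t\<ge>0. S (s + t) = S s \<circ> S t) \<and>
     (\<forall>x. ((\<lambda>t. S t x) \<longlongrightarrow> x) (at_right 0))"

definition generates ::
    "'a::complex_banach set \<Rightarrow> ('a \<Rightarrow> 'a) \<Rightarrow> (real \<Rightarrow> 'a \<Rightarrow> 'a) \<Rightarrow> bool" where
  "generates D G S \<longleftrightarrow> C0_semigroup S \<and>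
     (\<forall>x y. x \<in> D \<and> G x = y \<longleftrightarrow> ((\<lambda>t. (S t x - x) /\<^sub>R t) \<longlongrightarrow> y) (at_right 0))"

text \<open>The semigroup generated by \<open>-A\<close>, written $e^{-At}$; its values at \<open>t \<ge> 0\<close> are determined
  by the generator, so the choice made by \<open>SOME\<close> is immaterial.\<close>

definition semigroup_neg ::
    "'a::complex_banach set \<Rightarrow> ('a \<Rightarrow> 'a) \<Rightarrow> real \<Rightarrow> 'a \<Rightarrow> 'a" where
  "semigroup_neg D A = (SOME S. generates D (\<lambda>x. - A x) S)"

text \<open>For \<open>\<alpha> > 0\<close>, the operator $A^{-\alpha} = \Gamma(\alpha)^{-1}\int_0^\infty t^{\alpha-1}e^{-At}\,dt$
  is bounded and injective, and $A^\alpha$ is its inverse, with domain the range of $A^{-\alpha}$.\<close>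

definition frac_power_neg ::
    "'a::complex_banach set \<Rightarrow> ('a \<Rightarrow> 'a) \<Rightarrow> real \<Rightarrow> 'a \<Rightarrow> 'a" where
  "frac_power_neg D A \<alpha> x =
     integral {0..} (\<lambda>t. t powr (\<alpha> - 1) *\<^sub>R semigroup_neg D A t x) /\<^sub>R Gamma \<alpha>"

definition frac_power_dom ::
    "'a::complex_banach set \<Rightarrow> ('a \<Rightarrow> 'a) \<Rightarrow> real \<Rightarrow> 'a set" where
  "frac_power_dom D A \<alpha> = range (frac_power_neg D A \<alpha>)"

definition frac_power ::
    "'a::complex_banach set \<Rightarrow> ('a \<Rightarrow> 'a) \<Rightarrow> real \<Rightarrow> 'a \<Rightarrow> 'a" where
  "frac_power D A \<alpha> = inv (frac_power_neg D A \<alpha>)"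


section \<open>The nonlocal operator\<close>

text \<open>The data $\alpha_1,\dots,\alpha_m$ and $t_1,\dots,t_m$ of the nonlocal condition are
  \<open>a 1, \<dots>, a m\<close> and \<open>\<tau> 1, \<dots>, \<tau> m\<close>.\<close>

definition nonlocal_op ::
    "'a::complex_banach set \<Rightarrow> ('a \<Rightarrow> 'a) \<Rightarrow> nat \<Rightarrow> (nat \<Rightarrow> real) \<Rightarrow> (nat \<Rightarrow> real) \<Rightarrow> 'a \<Rightarrow> 'a" where
  "nonlocal_op D A m a \<tau> x = x + (\<Sum>i=1..m. a i *\<^sub>R semigroup_neg D A (\<tau> i) x)"

definition nonlocal_sym_inv ::
    "nat \<Rightarrow> (nat \<Rightarrow> real) \<Rightarrow> (nat \<Rightarrow> real) \<Rightarrow> complex \<Rightarrow> complex" where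
  "nonlocal_sym_inv m a \<tau> z =
     inverse (1 + (\<Sum>i=1..m. of_real (a i) * exp (- z * of_real (\<tau> i))))"

definition u2_ih ::
    "'a::complex_banach set \<Rightarrow> ('a \<Rightarrow> 'a) \<Rightarrow> nat \<Rightarrow> (nat \<Rightarrow> real) \<Rightarrow> (nat \<Rightarrow> real) \<Rightarrow>
     (real \<Rightarrow> 'a) \<Rightarrow> nat \<Rightarrow> real \<Rightarrow> 'a" where
  "u2_ih D A m a \<tau> f j t =
     integral {0..\<tau> j}
       (\<lambda>s. inv (nonlocal_op D A m a \<tau>) (semigroup_neg D A (t + \<tau> j - s) (f s)))"


section \<open>Integration hyperbola and quadrature\<close>

definition hyp_b0 :: "real \<Rightarrow> real \<Rightarrow> real" where
  "hyp_b0 \<rho>\<^sub>0 \<phi> = \<rho>\<^sub>0 * tan \<phi>"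

definition hyp_d1 :: "real \<Rightarrow> real \<Rightarrow> real \<Rightarrow> real" where
  "hyp_d1 \<rho>\<^sub>0 \<phi> \<rho>\<^sub>1 = arccos (\<rho>\<^sub>1 / sqrt (\<rho>\<^sub>0\<^sup>2 + (hyp_b0 \<rho>\<^sub>0 \<phi>)\<^sup>2)) - \<phi>"

definition hyp_aI :: "real \<Rightarrow> real \<Rightarrow> real \<Rightarrow> real" where
  "hyp_aI \<rho>\<^sub>0 \<phi> \<rho>\<^sub>1 = sqrt (\<rho>\<^sub>0\<^sup>2 + (hyp_b0 \<rho>\<^sub>0 \<phi>)\<^sup>2) * cos (hyp_d1 \<rho>\<^sub>0 \<phi> \<rho>\<^sub>1 / 2 + \<phi>)"

definition hyp_bI :: "real \<Rightarrow> real \<Rightarrow> real \<Rightarrow> real" where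
  "hyp_bI \<rho>\<^sub>0 \<phi> \<rho>\<^sub>1 = sqrt (\<rho>\<^sub>0\<^sup>2 + (hyp_b0 \<rho>\<^sub>0 \<phi>)\<^sup>2) * sin (hyp_d1 \<rho>\<^sub>0 \<phi> \<rho>\<^sub>1 / 2 + \<phi>)"

definition hyp_z :: "real \<Rightarrow> real \<Rightarrow> real \<Rightarrow> real \<Rightarrow> complex" where
  "hyp_z \<rho>\<^sub>0 \<phi> \<rho>\<^sub>1 \<xi> =
     of_real (hyp_aI \<rho>\<^sub>0 \<phi> \<rho>\<^sub>1 * cosh \<xi>) - \<i> * of_real (hyp_bI \<rho>\<^sub>0 \<phi> \<rho>\<^sub>1 * sinh \<xi>)"

definition hyp_z' :: "real \<Rightarrow> real \<Rightarrow> real \<Rightarrow> real \<Rightarrow> complex" where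
  "hyp_z' \<rho>\<^sub>0 \<phi> \<rho>\<^sub>1 \<xi> =
     of_real (hyp_aI \<rho>\<^sub>0 \<phi> \<rho>\<^sub>1 * sinh \<xi>) - \<i> * of_real (hyp_bI \<rho>\<^sub>0 \<phi> \<rho>\<^sub>1 * cosh \<xi>)"

text \<open>Inner weight and node, for \<open>t\<^sub>j = tj\<close> and step size \<open>h\<close>.\<close>

definition quad_weight ::
    "real \<Rightarrow> real \<Rightarrow> real \<Rightarrow> real \<Rightarrow> real \<Rightarrow> int \<Rightarrow> int \<Rightarrow> complex" where
  "quad_weight \<rho>\<^sub>0 \<phi> \<rho>\<^sub>1 tj h k p =
     of_real (tj / 2) *
     exp (- of_real (tj / 2) * hyp_z \<rho>\<^sub>0 \<phi> \<rho>\<^sub>1 (of_int k * h) * of_real (1 - tanh (of_int p * h)))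
     / of_real ((cosh (of_int p * h))\<^sup>2)"

definition quad_node :: "real \<Rightarrow> real \<Rightarrow> int \<Rightarrow> real" where
  "quad_node tj h p = tj / 2 * (1 + tanh (of_int p * h))"

definition u2_approx ::
    "'a::complex_banach set \<Rightarrow> ('a \<Rightarrow> 'a) \<Rightarrow> real \<Rightarrow> real \<Rightarrow> real \<Rightarrow>
     nat \<Rightarrow> (nat \<Rightarrow> real) \<Rightarrow> (nat \<Rightarrow> real) \<Rightarrow> (real \<Rightarrow> 'a) \<Rightarrow> nat \<Rightarrow> real \<Rightarrow> nat \<Rightarrow> real \<Rightarrow> 'a" where
  "u2_approx D A \<rho>\<^sub>0 \<phi> \<rho>\<^sub>1 m a \<tau> f j c\<^sub>0 N t =
     (let h = c\<^sub>0 / sqrt (real N);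
          z = (\<lambda>k::int. hyp_z \<rho>\<^sub>0 \<phi> \<rho>\<^sub>1 (of_int k * h));
          z' = (\<lambda>k::int. hyp_z' \<rho>\<^sub>0 \<phi> \<rho>\<^sub>1 (of_int k * h));
          y = (\<lambda>k::int. h *\<^sub>R (\<Sum>p = - int N..int N.
                 quad_weight \<rho>\<^sub>0 \<phi> \<rho>\<^sub>1 (\<tau> j) h k p *\<^sub>C f (quad_node (\<tau> j) h p)))
      in (of_real h / (2 * of_real pi * \<i>)) *\<^sub>C
         (\<Sum>k = - int N..int N.
            (exp (- z k * of_real t) * z' k * nonlocal_sym_inv m a \<tau> (z k)) *\<^sub>C
              (resolvent D A (z k) (y k) - inverse (z k) *\<^sub>C y k)))"

end

theory Submission
  imports Defs "HOL-Complex_Analysis.Complex_Analysis"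
begin

text \<open>
Fix a functional \<open>l\<close> of norm at most one and put \<open>T = \<tau> j\<close>.  Under \<open>l\<close> the solution and its approximation become,
up to the common factor \<open>2 \<pi> \<i>\<close>, the double integral over the plane and the double trapezoidal sum with step \<open>h\<close> of
one and the same scalar function \<open>Psi l t \<xi> \<eta>\<close>: the variable \<open>\<xi>\<close> runs through the integration hyperbola, and
\<open>\<eta>\<close> is the variable of the substitution \<open>s = T / (1 + exp (- 2 \<eta>))\<close>.  This function is holomorphic in each variable in a
strip around the real axis, and it is bounded by \<open>C exp (- (\<bar>\<xi>\<bar> + \<bar>\<eta>\<bar>) / 2)\<close> with a constant that depends neither on \<open>l\<close> nor on
\<open>t\<close>.  The trapezoidal rule truncated at \<open>N\<close> therefore has an error of order
\<open>exp (- 2 \<pi> d / h) + exp (- N h / 2)\<close> (\<open>trapezoidal_error_double\<close>), which for \<open>h = c0 / sqrt N\<close> is \<open>exp (- c1 sqrt N)\<close>.  Taking the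
supremum over \<open>l\<close>, which is legitimate by the Hahn--Banach theorem (\<open>norm_le_functionals\<close>), gives the estimate in norm.

The decay in \<open>\<xi>\<close> comes from the inner integral: \<open>z R(z) - I\<close> is bounded, so \<open>z'(\<xi>) (R(z) - 1/z)\<close> is bounded along the hyperbola, and
the factor \<open>exp (- z (T - s))\<close> is at most \<open>(Re z (T - s))\<close> to the power \<open>- 1/2\<close>, whose growth at \<open>s = T\<close> is compensated by the factor
\<open>1 / cosh\<^sup>2 \<eta>\<close> of the substitution.  The bound on \<open>A\<^sup>\<alpha> F\<close> enters as a bound on \<open>F\<close> itself, the inverse power
being a bounded operator.

For the exact solution one needs, for \<open>r > 0\<close>, the representation of \<open>B\<^sup>-\<^sup>1 exp (- A r) x\<close> as \<open>1 / (2 \<pi> \<i>)\<close> times the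
integral of \<open>exp (- z r) B\<^sup>-\<^sup>1(z) R(z) x\<close> over the hyperbola; subtracting \<open>x / z\<close> from \<open>R(z) x\<close> changes nothing because that part of the contour
can be closed to the right.  So the semigroup generated by \<open>- A\<close> is constructed as a contour integral.  Its boundedness and strong
continuity at \<open>0\<close> follow by deforming the contour to a hyperbola of size \<open>1/t\<close> around the origin, and everything else follows
from the uniqueness of the solution of \<open>v' = - A v\<close> (\<open>cauchy_problem_unique\<close>): the semigroup law, the identification with the semigroup that \<open>- A\<close>
generates (\<open>generates_unique\<close>), and the fact that the semigroup shifts the parameter of every contour integral
(\<open>sg_contour_op\<close>).  The latter shows that the contour integral with the symbol \<open>B\<^sup>-\<^sup>1(z)\<close> is mapped by \<open>B\<close> to the semigroup, and
\<open>B\<close> is injective by a Neumann series argument.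
\<close>

section \<open>Scalar multiplication and norming functionals\<close>

lemma bounded_bilinear_scaleC: "bounded_bilinear (scaleC :: complex \<Rightarrow> 'a::complex_banach \<Rightarrow> 'a)"
proof
  fix a a' :: complex and b b' :: 'a and r :: real
  show "(a + a') *\<^sub>C b = a *\<^sub>C b + a' *\<^sub>C b" "a *\<^sub>C (b + b') = a *\<^sub>C b + a *\<^sub>C b'"
    by (simp_all add: scaleC_add_left scaleC_add_right)
  show "(r *\<^sub>R a) *\<^sub>C b = r *\<^sub>R (a *\<^sub>C b)"
    by (metis scaleC_of_real scaleC_scaleC scaleR_conv_of_real)
  show "a *\<^sub>C (r *\<^sub>R b) = r *\<^sub>R (a *\<^sub>C b)"
    by (metis scaleC_of_real scaleC_scaleC mult.commute)
  show "\<exists>K. \<forall>a (b::'a). norm (a *\<^sub>C b) \<le> norm a * norm b * K"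
    by (rule exI[of _ 1]) (simp add: norm_scaleC)
qed

interpretation scaleC: bounded_bilinear "scaleC :: complex \<Rightarrow> 'a::complex_banach \<Rightarrow> 'a"
  by (rule bounded_bilinear_scaleC)

lemmas scaleC_continuous_on [continuous_intros] = scaleC.continuous_on
lemmas scaleC_tendsto [tendsto_intros] = scaleC.tendsto

declare scaleC.zero_left [simp] scaleC.zero_right [simp]

lemma scaleC_one [simp]: "1 *\<^sub>C x = (x::'a::complex_banach)"
  using scaleC_of_real[of 1 x] by simp

lemma scaleC_inverse_cancel: "c \<noteq> 0 \<Longrightarrow> inverse c *\<^sub>C (c *\<^sub>C x) = (x::'a::complex_banach)"
  by (simp add: scaleC_scaleC)

text \<open>Hahn--Banach is obtained from the pointwise minimal sublinear functionals.  Replacing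
  \<open>p\<close> by \<open>directional_inf p z\<close> can only lower a sublinear functional; a minimal one
  is unchanged, which forces it to be additive in the direction \<open>z\<close>.\<close>

definition sublinear :: "('a::real_vector \<Rightarrow> real) \<Rightarrow> bool" where
  "sublinear p \<longleftrightarrow> (\<forall>x y. p (x + y) \<le> p x + p y) \<and> (\<forall>r>0. \<forall>x. p (r *\<^sub>R x) \<le> r * p x)"

definition directional_inf :: "('a::real_vector \<Rightarrow> real) \<Rightarrow> 'a \<Rightarrow> 'a \<Rightarrow> real" where
  "directional_inf p z x = (INF t\<in>{0..}. p (x + t *\<^sub>R z) - t * p z)"

lemma sublinearD:
  assumes "sublinear p"
  shows "p (x + y) \<le> p x + p y" "r > 0 \<Longrightarrow> p (r *\<^sub>R x) = r * p x" "p 0 = 0"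
    "- p (- x) \<le> p x"
proof -
  have add: "p (x + y) \<le> p x + p y" and hom: "r > 0 \<Longrightarrow> p (r *\<^sub>R x) \<le> r * p x" for x y r
    using assms by (auto simp: sublinear_def)
  show "p (x + y) \<le> p x + p y" by (rule add)
  show "p (r *\<^sub>R x) = r * p x" if "r > 0"
  proof (rule antisym[OF hom[OF that]])
    have "p x \<le> (1/r) * p (r *\<^sub>R x)"
      using hom[of "1/r" "r *\<^sub>R x"] that by simp
    then show "r * p x \<le> p (r *\<^sub>R x)" using that by (simp add: field_simps)
  qed
  show z: "p 0 = 0" using hom[of "1/2" 0] add[of 0 0] by simp
  show "- p (- x) \<le> p x" using add[of x "- x"] z by simp
qed

lemma directional_inf_props:
  assumes p: "sublinear p"
  shows "sublinear (directional_inf p z)" "directional_inf p z x \<le> p x"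
    "t \<ge> 0 \<Longrightarrow> directional_inf p z x \<le> p (x + t *\<^sub>R z) - t * p z"
proof -
  let ?q = "directional_inf p z"
  have lower: "- p (- x) \<le> p (x + t *\<^sub>R z) - t * p z" if "t \<ge> 0" for x t
  proof (cases "t = 0")
    case True then show ?thesis using sublinearD(4)[OF p] by simp
  next
    case False
    then have "t * p z = p (t *\<^sub>R z)" using that sublinearD(2)[OF p] by simp
    also have "\<dots> \<le> p (x + t *\<^sub>R z) + p (- x)"
      using sublinearD(1)[OF p, of "x + t *\<^sub>R z" "- x"] by simp
    finally show ?thesis by simp
  qed
  have bdd: "bdd_below ((\<lambda>t. p (x + t *\<^sub>R z) - t * p z) ` {0..})" for x
    using lower by (intro bdd_belowI2[of _ "- p (- x)"]) auto
  have le: "?q x \<le> p (x + t *\<^sub>R z) - t * p z" if "t \<ge> 0" for x t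
    unfolding directional_inf_def by (rule cINF_lower[OF bdd]) (use that in auto)
  have ge: "c \<le> ?q x" if "\<And>t. t \<ge> 0 \<Longrightarrow> c \<le> p (x + t *\<^sub>R z) - t * p z" for x c
    unfolding directional_inf_def by (rule cINF_greatest) (use that in auto)
  show "t \<ge> 0 \<Longrightarrow> ?q x \<le> p (x + t *\<^sub>R z) - t * p z" by (rule le)
  show "?q x \<le> p x" using le[of 0 x] by simp
  show "sublinear ?q"
    unfolding sublinear_def
  proof (intro conjI allI impI)
    fix x y
    have "?q (x + y) - (p (y + t *\<^sub>R z) - t * p z) \<le> ?q x" if t: "t \<ge> 0" for t
    proof (rule ge)
      fix s :: real assume s: "s \<ge> 0"
      have "?q (x + y) \<le> p ((x + y) + (s + t) *\<^sub>R z) - (s + t) * p z"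
        using le s t by simp
      also have "p ((x + y) + (s + t) *\<^sub>R z) \<le> p (x + s *\<^sub>R z) + p (y + t *\<^sub>R z)"
        using sublinearD(1)[OF p, of "x + s *\<^sub>R z" "y + t *\<^sub>R z"] by (simp add: algebra_simps)
      finally show "?q (x + y) - (p (y + t *\<^sub>R z) - t * p z) \<le> p (x + s *\<^sub>R z) - s * p z"
        by (simp add: algebra_simps)
    qed
    then have "?q (x + y) - ?q x \<le> ?q y" by (intro ge) (simp add: algebra_simps)
    then show "?q (x + y) \<le> ?q x + ?q y" by simp
  next
    fix r :: real and x :: 'a assume r: "r > 0"
    have "?q (r *\<^sub>R x) / r \<le> ?q x"
    proof (rule ge)
      fix t :: real assume t: "t \<ge> 0"
      have "?q (r *\<^sub>R x) \<le> p (r *\<^sub>R x + (r * t) *\<^sub>R z) - (r * t) * p z"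
        using le[of "r * t"] r t by simp
      also have "p (r *\<^sub>R x + (r * t) *\<^sub>R z) = r * p (x + t *\<^sub>R z)"
        using sublinearD(2)[OF p r, of "x + t *\<^sub>R z"] by (simp add: algebra_simps)
      finally have "?q (r *\<^sub>R x) \<le> r * (p (x + t *\<^sub>R z) - t * p z)" by (simp add: algebra_simps)
      then show "?q (r *\<^sub>R x) / r \<le> p (x + t *\<^sub>R z) - t * p z"
        using r by (simp add: field_simps)
    qed
    then show "?q (r *\<^sub>R x) \<le> r * ?q x" using r by (simp add: field_simps)
  qed
qed

text \<open>Any two members of a chain are comparable, so the pointwise infimum of a chain of sublinear functionals is again sublinear.\<close>

lemma minimal_sublinear_below:
  assumes P: "sublinear P"
  obtains p where "sublinear p" "p \<le> P" "\<And>q. sublinear q \<Longrightarrow> q \<le> p \<Longrightarrow> q = p"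
proof -
  define S where "S = {p. sublinear p \<and> p \<le> P}"
  have ord: "partial_order_on S (relation_of (\<lambda>p q. q \<le> p) S)"
    by (rule partial_order_on_relation_ofI) auto
  have "\<exists>m\<in>S. \<forall>q\<in>S. q \<le> m \<longrightarrow> q = m"
  proof (rule predicate_Zorn[OF ord])
    fix C assume C: "C \<in> Chains (relation_of (\<lambda>p q. q \<le> p) S)"
    show "\<exists>u\<in>S. \<forall>a\<in>C. u \<le> a"
    proof (cases "C = {}")
      case True then show ?thesis using P by (auto simp: S_def)
    next
      case False
      have CS: "sublinear p" "p \<le> P" if "p \<in> C" for p
        using C that by (auto simp: Chains_def relation_of_def S_def)
      have comp: "p \<le> q \<or> q \<le> p" if "p \<in> C" "q \<in> C" for p q
        using C that by (auto simp: Chains_def relation_of_def)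
      define u where "u x = (INF p\<in>C. p x)" for x
      have low: "- P (- x) \<le> p x" if "p \<in> C" for p x
        using sublinearD(4)[OF CS(1)[OF that], of x] CS(2)[OF that] by (meson le_funD neg_le_iff_le order_trans)
      have bdd: "bdd_below ((\<lambda>p. p x) ` C)" for x
        using low by (intro bdd_belowI2[of _ "- P (- x)"]) auto
      have le: "u x \<le> p x" if "p \<in> C" for p x
        unfolding u_def by (rule cINF_lower[OF bdd that])
      have ge: "c \<le> u x" if "\<And>p. p \<in> C \<Longrightarrow> c \<le> p x" for x c
        unfolding u_def by (rule cINF_greatest) (use that False in auto)
      have "sublinear u"
        unfolding sublinear_def
      proof (intro conjI allI impI)
        fix x y
        have "u (x + y) - q y \<le> p x" if pq: "p \<in> C" "q \<in> C" for p q
        proof -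
          obtain r where r: "r \<in> C" "r \<le> p" "r \<le> q" using comp[OF pq] pq order_refl by metis
          have "u (x + y) \<le> r (x + y)" using le r by blast
          also have "\<dots> \<le> r x + r y" using sublinearD(1) CS r by blast
          also have "\<dots> \<le> p x + q y" using r by (simp add: add_mono le_funD)
          finally show ?thesis by simp
        qed
        then have "u (x + y) - q y \<le> u x" if "q \<in> C" for q using that by (intro ge) auto
        then have "u (x + y) - u x \<le> u y" by (intro ge) (simp add: algebra_simps)
        then show "u (x + y) \<le> u x + u y" by simp
      next
        fix r :: real and x assume r: "r > 0"
        have "u (r *\<^sub>R x) / r \<le> u x"
        proof (rule ge)
          fix p assume p: "p \<in> C"
          have "u (r *\<^sub>R x) \<le> r * p x" using le[OF p, of "r *\<^sub>R x"] sublinearD(2)[OF CS(1)[OF p] r] by simp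
          then show "u (r *\<^sub>R x) / r \<le> p x" using r by (simp add: field_simps)
        qed
        then show "u (r *\<^sub>R x) \<le> r * u x" using r by (simp add: field_simps)
      qed
      moreover have "u \<le> P"
        using False le CS(2) by (meson equals0I le_funD le_funI order_trans)
      ultimately show ?thesis using le by (auto simp: S_def le_fun_def)
    qed
  qed
  then obtain p where "p \<in> S" "\<forall>q\<in>S. q \<le> p \<longrightarrow> q = p" by auto
  then show thesis by (intro that[of p]) (auto simp: S_def intro: order_trans)
qed

lemma minimal_sublinear_linear:
  assumes p: "sublinear p" and min: "\<And>q. sublinear q \<Longrightarrow> q \<le> p \<Longrightarrow> q = p"
  shows "linear p"
proof -
  have "directional_inf p z = p" for z
    using directional_inf_props[OF p] by (intro min) (auto simp: le_fun_def)
  then have "p x \<le> p (x + z) - p z" for x z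
    using directional_inf_props(3)[OF p, of 1 z x] by simp
  then have add: "p (x + z) = p x + p z" for x z
    using sublinearD(1)[OF p, of x z] by (intro antisym) (auto simp: algebra_simps)
  have neg: "p (- x) = - p x" for x using add[of x "- x"] sublinearD(3)[OF p] by simp
  show ?thesis
  proof (rule linearI[OF add])
    fix r :: real and x
    consider "r > 0" | "r = 0" | "r < 0" by linarith
    then show "p (r *\<^sub>R x) = r *\<^sub>R p x"
    proof cases
      case 3
      then have "p ((- r) *\<^sub>R x) = - r * p x" by (intro sublinearD(2)[OF p]) simp
      then show ?thesis using neg[of "r *\<^sub>R x"] by simp
    qed (auto simp: sublinearD[OF p])
  qed
qed

lemma sublinear_norm: "sublinear (norm :: 'a::real_normed_vector \<Rightarrow> real)"
  by (simp add: sublinear_def norm_triangle_ineq)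

definition contractive_functional :: "('a::complex_banach \<Rightarrow> complex) \<Rightarrow> bool" where
  "contractive_functional l \<longleftrightarrow> (\<forall>x y. l (x + y) = l x + l y) \<and> (\<forall>c x. l (c *\<^sub>C x) = c * l x) \<and>
     (\<forall>x. cmod (l x) \<le> norm x)"

lemma contractive_functionalD:
  assumes "contractive_functional l"
  shows "l (x + y) = l x + l y" "l (c *\<^sub>C x) = c * l x" "cmod (l x) \<le> norm x"
    "bounded_linear l" "l (x - y) = l x - l y" "l 0 = 0" "l (r *\<^sub>R x) = of_real r * l x"
proof -
  show add: "l (x + y) = l x + l y" and hom: "l (c *\<^sub>C x) = c * l x" and bd: "cmod (l x) \<le> norm x" for x y c
    using assms by (auto simp: contractive_functional_def)
  show *: "l (r *\<^sub>R x) = of_real r * l x" for r x using hom[of "of_real r" x] by (simp add: scaleC_of_real)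
  show bl: "bounded_linear l"
    by (rule bounded_linear_intro[where K=1]) (auto simp: add * bd scaleR_conv_of_real)
  show "l (x - y) = l x - l y" "l 0 = 0"
    using linear_diff[OF bounded_linear.linear[OF bl]] linear_0[OF bounded_linear.linear[OF bl]] by auto
qed

text \<open>The real functional of Hahn--Banach is found below \<open>directional_inf norm x\<close>, whose value at
  \<open>-x\<close> is at most \<open>- norm x\<close>.\<close>

lemma norming_functional:
  fixes x :: "'a::complex_banach"
  obtains l where "contractive_functional l" "cmod (l x) = norm x"
proof -
  note q = directional_inf_props[OF sublinear_norm, where z=x]
  obtain u where u: "sublinear u" "u \<le> directional_inf norm x"
      "\<And>q. sublinear q \<Longrightarrow> q \<le> u \<Longrightarrow> q = u"
    using minimal_sublinear_below[OF q(1)] by blast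
  have lin: "linear u" by (rule minimal_sublinear_linear[OF u(1,3)])
  have un: "u y \<le> norm y" for y by (rule order_trans[OF le_funD[OF u(2)] q(2)])
  have "u (- x) \<le> norm (- x + 1 *\<^sub>R x) - 1 * norm x"
    by (rule order_trans[OF le_funD[OF u(2)] q(3)]) simp
  then have ux: "norm x \<le> u x" using linear_neg[OF lin] by simp
  define l where "l y = Complex (u y) (- u (\<i> *\<^sub>C y))" for y
  have ladd: "l (y + y') = l y + l y'" for y y'
    by (simp add: l_def scaleC_add_right linear_add[OF lin] complex_eq_iff)
  have lhom: "l (c *\<^sub>C y) = c * l y" for c y
  proof -
    have c: "c = of_real (Re c) + \<i> * of_real (Im c)" by (simp add: complex_eq_iff)
    have c': "\<i> * c = \<i> * of_real (Re c) + of_real (- Im c)" by (simp add: complex_eq_iff)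
    have 1: "c *\<^sub>C y = Re c *\<^sub>R y + Im c *\<^sub>R (\<i> *\<^sub>C y)"
      by (subst c) (simp only: scaleC_add_left scaleC_of_real[symmetric] scaleC_scaleC mult.commute)
    have 2: "\<i> *\<^sub>C (c *\<^sub>C y) = Re c *\<^sub>R (\<i> *\<^sub>C y) + (- Im c) *\<^sub>R y"
      unfolding scaleC_scaleC
      by (subst c') (simp only: scaleC_add_left scaleC_of_real[symmetric] scaleC_scaleC mult.commute)
    show ?thesis
      unfolding l_def 2 unfolding 1
      by (simp add: linear_add[OF lin] linear_scale[OF lin] linear_diff[OF lin] complex_eq_iff)
  qed
  have lbd: "cmod (l y) \<le> norm y" for y
  proof -
    obtain c where c: "cmod c = 1" "c * l y = of_real (cmod (l y))"
    proof (cases "l y = 0")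
      case False
      show thesis
      proof (rule that[of "cnj (l y) / of_real (cmod (l y))"])
        show "cmod (cnj (l y) / of_real (cmod (l y))) = 1" using False by (simp add: norm_divide)
        have "cnj (l y) / of_real (cmod (l y)) * l y = (l y * cnj (l y)) / of_real (cmod (l y))" by simp
        also have "\<dots> = of_real (cmod (l y))"
          using False by (simp add: complex_norm_square[symmetric] power2_eq_square)
        finally show "cnj (l y) / of_real (cmod (l y)) * l y = of_real (cmod (l y))" .
      qed
    qed (rule that[of 1], auto)
    have "cmod (l y) = Re (l (c *\<^sub>C y))" using c by (simp add: lhom)
    also have "\<dots> = u (c *\<^sub>C y)" by (simp add: l_def)
    also have "\<dots> \<le> norm y" using un[of "c *\<^sub>C y"] c by (simp add: norm_scaleC)
    finally show ?thesis .
  qed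
  have "norm x \<le> cmod (l x)" using ux complex_Re_le_cmod[of "l x"] by (simp add: l_def)
  then show thesis using that[of l] ladd lhom lbd antisym[OF lbd] by (auto simp: contractive_functional_def)
qed

text \<open>All vector identities and estimates below that involve Cauchy's theorem or residues are reduced in this way to scalar ones.\<close>

lemma norm_le_functionals:
  assumes "\<And>l. contractive_functional l \<Longrightarrow> cmod (l x) \<le> b"
  shows "norm (x::'a::complex_banach) \<le> b"
  using assms norming_functional[of x] by metis

lemma eq_functionals:
  assumes "\<And>l. contractive_functional l \<Longrightarrow> l x = l y"
  shows "x = (y::'a::complex_banach)"
proof -
  have "norm (x - y) \<le> 0" by (rule norm_le_functionals) (simp add: assms contractive_functionalD)
  then show ?thesis by simp
qed

section \<open>Integrals over the real line\<close>

lemma has_integral_exp_abs: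
  fixes b :: real assumes "b > 0"
  shows "((\<lambda>x. exp (- b * \<bar>x\<bar>)) has_integral 2 / b) UNIV"
proof -
  have 1: "((\<lambda>x. exp (- b * x)) has_integral 1 / b) {0..}"
    using has_integral_exp_minus_to_infinity[OF assms, of 0] by simp
  have 2: "((\<lambda>x. exp (- b * \<bar>x\<bar>)) has_integral 1 / b) {0..}"
    by (rule has_integral_eq[OF _ 1]) auto
  have 3: "((\<lambda>x. exp (- b * \<bar>x\<bar>)) has_integral 1 / b) {..0}"
  proof -
    have "(\<lambda>x. exp (- b * \<bar>x\<bar>)) absolutely_integrable_on {0..}"
      using 2 by (intro nonnegative_absolutely_integrable_1) auto
    then show ?thesis
      using 2 has_absolute_integral_reflect_real[of "{..0}" "{0..}" "\<lambda>x. exp (- b * \<bar>x\<bar>)" "1 / b"]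
      by (simp add: has_integral_iff absolutely_integrable_on_def)
  qed
  have 4: "((\<lambda>x. exp (- b * \<bar>x\<bar>)) has_integral (1 / b + 1 / b)) ({..0} \<union> {0..})"
    by (rule has_integral_Un[OF 3 2]) (auto intro: negligible_subset[of "{0}"])
  moreover have "{..0} \<union> {0..} = (UNIV :: real set)" by auto
  ultimately show ?thesis by simp
qed

text \<open>The values lie in an arbitrary Banach space, in which a continuous dominated function is integrable in the sense of Henstock and
Kurzweil; this integral is used throughout.\<close>

lemma integrable_UNIV_exp_bound:
  fixes f :: "real \<Rightarrow> 'a::banach"
  assumes c: "continuous_on UNIV f" and b: "b > 0" "\<And>x. norm (f x) \<le> K * exp (- b * \<bar>x\<bar>)"
  shows "f integrable_on UNIV" "norm (integral UNIV f) \<le> K * (2 / b)"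
proof -
  have g: "((\<lambda>x. K * exp (- b * \<bar>x\<bar>)) has_integral K * (2 / b)) UNIV"
    by (rule has_integral_mult_right[OF has_integral_exp_abs[OF b(1)]])
  show f: "f integrable_on UNIV"
  proof (rule integrable_on_all_intervals_integrable_bound)
    show "(\<lambda>x. if x \<in> UNIV then f x else 0) integrable_on cbox a b" for a b
      using integrable_continuous[OF continuous_on_subset[OF c]] by simp
    show "(\<lambda>x. K * exp (- b * \<bar>x\<bar>)) integrable_on UNIV" using g by blast
  qed (use b in auto)
  show "norm (integral UNIV f) \<le> K * (2 / b)"
    using Henstock_Kurzweil_Integration.integral_norm_bound_integral[OF f has_integral_integrable[OF g]] b(2) integral_unique[OF g] by auto
qed

lemma integral_UNIV_limit:
  fixes f :: "real \<Rightarrow> 'a::banach"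
  assumes "f integrable_on UNIV"
  shows "((\<lambda>n. integral {-n..n} f) \<longlongrightarrow> integral UNIV f) at_top"
proof (rule tendstoI)
  fix e :: real assume e: "e > 0"
  have "(f has_integral integral UNIV f) UNIV" using assms by (rule integrable_integral)
  then have "\<exists>B>0. \<forall>a b. ball 0 B \<subseteq> cbox a b \<longrightarrow>
      norm (integral (cbox a b) (\<lambda>x. if x \<in> UNIV then f x else 0) - integral UNIV f) < e"
    unfolding has_integral_alt'[of f "integral UNIV f"] using e by blast
  then obtain B where B: "\<And>a b. ball 0 B \<subseteq> cbox a b \<Longrightarrow>
       norm (integral (cbox a b) f - integral UNIV f) < e"
    by auto
  have "norm (integral {-n..n} f - integral UNIV f) < e" if "n \<ge> B" for n
    
  proof -
    have "ball 0 B \<subseteq> cbox (- n) n" using that by (auto simp: dist_norm)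
    from B[OF this] show ?thesis by simp
  qed
  then show "\<forall>\<^sub>F n in at_top. dist (integral {-n..n} f) (integral UNIV f) < e"
    unfolding dist_norm by (rule eventually_at_top_linorderI)
qed

lemma integral_UNIV_eqI:
  fixes f :: "real \<Rightarrow> 'a::banach"
  assumes "f integrable_on UNIV" "((\<lambda>n. integral {-n..n} f) \<longlongrightarrow> I) at_top"
  shows "integral UNIV f = I"
  using tendsto_unique[OF _ integral_UNIV_limit[OF assms(1)] assms(2)] by simp

text \<open>Powers of \<open>cosh\<close> are absorbed by \<open>exp (- c * cosh x)\<close>: this is the decay of every
  integrand on a hyperbola.\<close>

lemma cosh_power_exp_bound:
  fixes c :: real assumes "c > 0"
  obtains K where "K \<ge> 0" "\<And>x. cosh x ^ p * exp (- c * cosh x) \<le> K * exp (- \<bar>x\<bar>)"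
proof
  let ?K = "2 * (real (Suc p) / c) ^ Suc p"
  show "?K \<ge> 0" using assms by simp
  fix x :: real
  have u: "cosh x > 0" by (rule cosh_real_pos)
  have "(c * cosh x / real (Suc p)) ^ Suc p \<le> (1 + c * cosh x / real (Suc p)) ^ Suc p"
    using assms u by (intro power_mono) auto
  also have "\<dots> \<le> exp (c * cosh x)"
    using assms u by (intro exp_ge_one_plus_x_over_n_power_n) (auto intro: order_trans[of _ 0])
  finally have 1: "(c * cosh x / real (Suc p)) ^ Suc p \<le> exp (c * cosh x)" .
  have 2: "1 / cosh x \<le> 2 * exp (- \<bar>x\<bar>)"
  proof -
    have "exp \<bar>x\<bar> \<le> 2 * cosh x" by (cases "x \<ge> 0") (auto simp: cosh_def)
    then show ?thesis using u by (simp add: exp_minus field_simps)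
  qed
  have "(c / real (Suc p)) ^ Suc p * (cosh x ^ Suc p * exp (- c * cosh x)) \<le> 1"
  proof -
    have "(c / real (Suc p)) ^ Suc p * (cosh x ^ Suc p * exp (- c * cosh x)) =
        (c * cosh x / real (Suc p)) ^ Suc p / exp (c * cosh x)"
      by (simp only: exp_minus mult_minus_left power_mult_distrib power_divide) (simp add: divide_inverse)
    also have "\<dots> \<le> 1" using 1 by (simp only: divide_le_eq_1_pos exp_gt_zero)
    finally show ?thesis .
  qed
  then have "(real (Suc p) / c) ^ Suc p * ((c / real (Suc p)) ^ Suc p * (cosh x ^ Suc p * exp (- c * cosh x)))
      \<le> (real (Suc p) / c) ^ Suc p * 1"
    using assms by (intro mult_left_mono) auto
  moreover have "(real (Suc p) / c) ^ Suc p * (c / real (Suc p)) ^ Suc p = 1"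
    using assms by (subst power_mult_distrib[symmetric]) simp
  ultimately have "cosh x ^ Suc p * exp (- c * cosh x) \<le> (real (Suc p) / c) ^ Suc p"
    by (simp only: mult.assoc[symmetric] mult_1_left mult_1_right)
  then have "cosh x ^ p * exp (- c * cosh x) * cosh x \<le> (real (Suc p) / c) ^ Suc p"
    by (simp only: power_Suc mult_ac)
  then have "cosh x ^ p * exp (- c * cosh x) \<le> (real (Suc p) / c) ^ Suc p * (1 / cosh x)"
    by (simp only: times_divide_eq_right mult_1_right pos_le_divide_eq[OF u])
  also have "\<dots> \<le> (real (Suc p) / c) ^ Suc p * (2 * exp (- \<bar>x\<bar>))"
    using 2 assms by (intro mult_left_mono) auto
  finally show "cosh x ^ p * exp (- c * cosh x) \<le> ?K * exp (- \<bar>x\<bar>)"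
    by (simp only: mult_ac)
qed

section \<open>Uniform boundedness\<close>

text \<open>If the family is not uniformly bounded, then no closed ball carries a common bound, so each ball
  contains a smaller one on which some member exceeds a prescribed bound; a point in all balls of such
  a nested sequence has an unbounded orbit.\<close>

lemma uniform_boundedness:
  fixes F :: "('a::banach \<Rightarrow> 'b::real_normed_vector) set"
  assumes lin: "\<And>T. T \<in> F \<Longrightarrow> bounded_linear T"
    and pw: "\<And>x. \<exists>b. \<forall>T\<in>F. norm (T x) \<le> b"
  shows "\<exists>K. \<forall>T\<in>F. \<forall>x. norm (T x) \<le> K * norm x"
proof (rule ccontr)
  assume unb: "\<nexists>K. \<forall>T\<in>F. \<forall>x. norm (T x) \<le> K * norm x"
  have step: "\<exists>T\<in>F. \<exists>x' r'. 0 < r' \<and> r' \<le> r / 2 \<and> cball x' r' \<subseteq> cball x r \<and>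
      (\<forall>y\<in>cball x' r'. norm (T y) > k)" if r: "r > 0" for x :: 'a and r k :: real
  proof -
    \<comment> \<open>a bound \<open>k\<close> on the ball would give the bound \<open>4 k / r\<close> on the norms of all members\<close>
    have "\<exists>T\<in>F. \<exists>y\<in>ball x r. norm (T y) > k"
    proof (rule ccontr)
      assume "\<not> ?thesis"
      then have b: "norm (T y) \<le> k" if "T \<in> F" "y \<in> ball x r" for T y using that by force
      have "norm (T y) \<le> (4 * k / r) * norm y" if T: "T \<in> F" for T y
      proof (cases "y = 0")
        case True
        then show ?thesis using linear_0[OF bounded_linear.linear[OF lin[OF T]]] by simp
      next
        case False
        interpret T: bounded_linear T by (rule lin[OF T])
        let ?s = "r / (2 * norm y)"
        have "norm (?s *\<^sub>R y) < r" using False r by simp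
        then have "norm (T (x + ?s *\<^sub>R y)) \<le> k" "norm (T x) \<le> k"
          using b[OF T, of "x + ?s *\<^sub>R y"] b[OF T, of x] r by (auto simp: dist_norm)
        then have "norm (T (x + ?s *\<^sub>R y) - T x) \<le> 2 * k"
          using norm_triangle_ineq4[of "T (x + ?s *\<^sub>R y)" "T x"] by linarith
        then have "norm (?s *\<^sub>R T y) \<le> 2 * k" by (simp only: T.add T.scaleR add_diff_cancel_left')
        then have "?s * norm (T y) \<le> 2 * k" using r by simp
        then show ?thesis using r False by (simp add: field_simps)
      qed
      then show False using unb by blast
    qed
    then obtain T y where T: "T \<in> F" "y \<in> ball x r" "norm (T y) > k" by blast
    have "open {y. norm (T y) > k}"
      using linear_continuous_on[OF lin[OF T(1)], of UNIV]
      by (intro open_Collect_less) (auto intro!: continuous_intros)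
    then have "open ({y. norm (T y) > k} \<inter> ball x r)" by auto
    then obtain e where e: "e > 0" "cball y e \<subseteq> {y. norm (T y) > k} \<inter> ball x r"
      using T(2,3) unfolding open_contains_cball by blast
    have "cball y (min e (r / 2)) \<subseteq> cball y e" by (rule subset_cball) simp
    then show ?thesis using e r T(1)
      by (intro bexI[of _ T] exI[of _ y] exI[of _ "min e (r / 2)"]) (auto simp: subset_iff)
  qed
  have "\<exists>f :: nat \<Rightarrow> 'a \<times> real. \<forall>n. snd (f n) > 0 \<and>
     (snd (f (Suc n)) \<le> snd (f n) / 2 \<and> cball (fst (f (Suc n))) (snd (f (Suc n))) \<subseteq> cball (fst (f n)) (snd (f n)) \<and>
      (\<exists>T\<in>F. \<forall>y\<in>cball (fst (f (Suc n))) (snd (f (Suc n))). norm (T y) > real n))"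
  proof (rule dependent_nat_choice)
    show "\<exists>x :: 'a \<times> real. snd x > 0" by (rule exI[of _ "(0, 1)"]) simp
    fix x :: "'a \<times> real" and n :: nat assume "snd x > 0"
    then obtain T x' r' where "T \<in> F" "0 < r'" "r' \<le> snd x / 2" "cball x' r' \<subseteq> cball (fst x) (snd x)"
      "\<forall>y\<in>cball x' r'. norm (T y) > real n" using step[of "snd x" "fst x" "real n"] by blast
    then show "\<exists>y. snd y > 0 \<and> snd y \<le> snd x / 2 \<and> cball (fst y) (snd y) \<subseteq> cball (fst x) (snd x) \<and>
      (\<exists>T\<in>F. \<forall>z\<in>cball (fst y) (snd y). norm (T z) > real n)"
      by (intro exI[of _ "(x', r')"]) auto
  qed
  then obtain f :: "nat \<Rightarrow> 'a \<times> real" where f: "\<And>n. snd (f n) > 0"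
     "\<And>n. snd (f (Suc n)) \<le> snd (f n) / 2"
     "\<And>n. cball (fst (f (Suc n))) (snd (f (Suc n))) \<subseteq> cball (fst (f n)) (snd (f n))"
     "\<And>n. \<exists>T\<in>F. \<forall>y\<in>cball (fst (f (Suc n))) (snd (f (Suc n))). norm (T y) > real n"
    by blast
  have r: "snd (f n) \<le> snd (f 0) * (1/2) ^ n" for n
  proof (induction n)
    case (Suc n) then show ?case using f(2)[of n] by simp
  qed simp
  have "\<exists>a. \<forall>n. a \<in> cball (fst (f n)) (snd (f n))"
  proof (rule decreasing_closed_nest)
    show "cball (fst (f n)) (snd (f n)) \<noteq> {}" for n using f(1)[of n] by simp
    show "cball (fst (f n)) (snd (f n)) \<subseteq> cball (fst (f m)) (snd (f m))" if "m \<le> n" for m n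
      by (rule lift_Suc_antimono_le[of "\<lambda>n. cball (fst (f n)) (snd (f n))", OF f(3) that])
    fix e :: real assume e: "e > 0"
    obtain n where "(1/2::real) ^ n < e / (4 * snd (f 0))"
      using real_arch_pow_inv[of "e / (4 * snd (f 0))" "1/2"] e f(1)[of 0] by auto
    then have "snd (f 0) * (1/2) ^ n < snd (f 0) * (e / (4 * snd (f 0)))"
      using f(1)[of 0] by (rule mult_strict_left_mono)
    then have "2 * snd (f n) < e" using r[of n] e f(1)[of 0] by simp
    then have "dist x y < e" if "x \<in> cball (fst (f n)) (snd (f n))" "y \<in> cball (fst (f n)) (snd (f n))" for x y
      using that dist_triangle2[of x y "fst (f n)"] by (auto simp: dist_commute)
    then show "\<exists>n. \<forall>x\<in>cball (fst (f n)) (snd (f n)). \<forall>y\<in>cball (fst (f n)) (snd (f n)). dist x y < e"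
      by blast
  qed auto
  then obtain a where a: "\<And>n. a \<in> cball (fst (f n)) (snd (f n))" by blast
  obtain b where b: "\<And>T. T \<in> F \<Longrightarrow> norm (T a) \<le> b" using pw by blast
  obtain n where "b \<le> real n" using real_arch_simple by blast
  then show False using f(4)[of n] a[of "Suc n"] b by force
qed

section \<open>Resolvents outside a sector\<close>

text \<open>Off the closed sector the resolvent is holomorphic with the decay \<open>M / (1 + cmod z)\<close>.  The
  complement \<open>\<Omega>\<close> of the closed sector is described by an inequality that shows it to be the union
  of two open half planes, starlike about each real point left of \<open>\<rho>\<^sub>0\<close>.\<close>

locale sectorial_operator =
  fixes D :: "'a::complex_banach set" and A :: "'a \<Rightarrow> 'a" and \<rho>\<^sub>0 \<phi> M :: real
  assumes positive: "strongly_positive D A \<rho>\<^sub>0 \<phi>"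
    and M_pos: "M > 0"
    and resolvent_estimate: "\<And>z. z \<in> - sector \<rho>\<^sub>0 \<phi> \<Longrightarrow>
        z \<in> resolvent_set D A \<and> onorm (resolvent D A z) \<le> M / (1 + cmod z)"
begin

definition \<Omega> :: "complex set" where
  "\<Omega> = {z. \<bar>Im z\<bar> > tan \<phi> * (Re z - \<rho>\<^sub>0)}"

abbreviation R :: "complex \<Rightarrow> 'a \<Rightarrow> 'a" where "R \<equiv> resolvent D A"

lemma angle: "0 < \<phi>" "\<phi> < pi / 2" "0 < \<rho>\<^sub>0" "0 < tan \<phi>" "0 < cos \<phi>" "0 < sin \<phi>"
proof -
  show "0 < \<phi>" "\<phi> < pi / 2" "0 < \<rho>\<^sub>0" using positive by (auto simp: strongly_positive_def)
  then show "0 < tan \<phi>" "0 < cos \<phi>" "0 < sin \<phi>"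
    by (auto simp: tan_gt_zero intro!: cos_gt_zero_pi sin_gt_zero)
qed

lemma domain_linear:
  "0 \<in> D" "x \<in> D \<Longrightarrow> y \<in> D \<Longrightarrow> x + y \<in> D" "x \<in> D \<Longrightarrow> c *\<^sub>C x \<in> D"
  "x \<in> D \<Longrightarrow> y \<in> D \<Longrightarrow> A (x + y) = A x + A y" "x \<in> D \<Longrightarrow> A (c *\<^sub>C x) = c *\<^sub>C A x"
  "closure D = UNIV"
  using positive by (auto simp: strongly_positive_def densely_defined_closed_def)

lemma \<Omega>_sector: "z \<in> \<Omega> \<Longrightarrow> z \<in> - sector \<rho>\<^sub>0 \<phi>"
proof
  assume z: "z \<in> \<Omega>" and "z \<in> sector \<rho>\<^sub>0 \<phi>"
  then obtain r \<theta> where r: "z = of_real \<rho>\<^sub>0 + of_real r * exp (\<i> * of_real \<theta>)" "0 \<le> r" "\<bar>\<theta>\<bar> < \<phi>"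
    by (auto simp: sector_def)
  have e: "exp (\<i> * of_real \<theta>) = Complex (cos \<theta>) (sin \<theta>)"
    by (metis cis_conv_exp cis.ctr)
  have "\<bar>sin \<theta>\<bar> * cos \<phi> \<le> sin \<phi> * cos \<theta>"
  proof -
    have "0 \<le> sin (\<phi> - \<bar>\<theta>\<bar>)" using r(3) angle by (intro sin_ge_zero) auto
    moreover have "\<bar>sin \<theta>\<bar> = sin \<bar>\<theta>\<bar>"
    proof -
      have "0 \<le> sin \<bar>\<theta>\<bar>" using r(3) angle by (intro sin_ge_zero) auto
      then show ?thesis by (cases "\<theta> \<ge> 0") auto
    qed
    ultimately show ?thesis by (simp add: sin_diff mult.commute)
  qed
  then have "\<bar>sin \<theta>\<bar> \<le> tan \<phi> * cos \<theta>" using angle by (simp add: tan_def field_simps)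
  then have "r * \<bar>sin \<theta>\<bar> \<le> r * (tan \<phi> * cos \<theta>)" using r(2) by (rule mult_left_mono)
  then show False using z r(2) by (simp add: r(1) \<Omega>_def e abs_mult algebra_simps)
qed

lemma open_\<Omega>: "open \<Omega>"
  unfolding \<Omega>_def by (intro open_Collect_less continuous_intros)

lemma starlike_\<Omega>: "starlike \<Omega>"
  unfolding starlike_def
proof (intro bexI ballI)
  show "0 \<in> \<Omega>" using angle by (simp add: \<Omega>_def)
  fix z assume z: "z \<in> \<Omega>"
  show "closed_segment 0 z \<subseteq> \<Omega>"
  proof
    fix w assume "w \<in> closed_segment 0 z"
    then obtain u where u: "0 \<le> u" "u \<le> 1" "w = u *\<^sub>R z" by (auto simp: closed_segment_def)
    show "w \<in> \<Omega>"
    proof (cases "u = 0")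
      case True then show ?thesis using u angle by (simp add: \<Omega>_def)
    next
      case False
      have "tan \<phi> * (u * Re z - \<rho>\<^sub>0) \<le> u * (tan \<phi> * (Re z - \<rho>\<^sub>0))"
        using angle u mult_left_mono[of "u * \<rho>\<^sub>0" "\<rho>\<^sub>0" "tan \<phi>"] by (simp add: algebra_simps mult_left_le_one_le)
      also have "\<dots> < u * \<bar>Im z\<bar>" using z False u by (intro mult_strict_left_mono) (auto simp: \<Omega>_def)
      finally show ?thesis using u by (simp add: \<Omega>_def abs_mult)
    qed
  qed
qed

lemma zero_in_\<Omega>: "0 \<in> \<Omega>" using angle by (simp add: \<Omega>_def)

lemma
  assumes "z \<in> \<Omega>"
  shows R_linear: "bounded_linear (R z)"
    and R_scaleC: "R z (c *\<^sub>C x) = c *\<^sub>C R z x"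
    and R_in_D: "R z x \<in> D" and A_R: "A (R z x) = z *\<^sub>C R z x - x"
    and R_A: "x \<in> D \<Longrightarrow> R z (A x) = z *\<^sub>C R z x - x"
    and R_bound: "norm (R z x) \<le> M / (1 + cmod z) * norm x"
proof -
  have rs: "bij_betw (\<lambda>x. z *\<^sub>C x - A x) D UNIV" "onorm (R z) \<le> M / (1 + cmod z)"
    and cl: "bounded_clinear (R z)"
    using resolvent_estimate[OF \<Omega>_sector[OF assms]] by (auto simp: resolvent_set_def)
  show "bounded_linear (R z)" "R z (c *\<^sub>C x) = c *\<^sub>C R z x" for c x
    using cl by (auto simp: bounded_clinear_def)
  then interpret R: bounded_linear "R z" by simp
  show "R z x \<in> D" for x
    unfolding resolvent_def by (rule inv_into_into) (use bij_betw_imp_surj_on[OF rs(1)] in auto)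
  have "z *\<^sub>C R z x - A (R z x) = x" for x
    unfolding resolvent_def using f_inv_into_f[of x "\<lambda>x. z *\<^sub>C x - A x" D] bij_betw_imp_surj_on[OF rs(1)] by auto
  then show "A (R z x) = z *\<^sub>C R z x - x" for x by (simp add: algebra_simps)
  have "R z (z *\<^sub>C x - A x) = x" if "x \<in> D" for x
    unfolding resolvent_def using inv_into_f_f[OF bij_betw_imp_inj_on[OF rs(1)] that] .
  then show "R z (A x) = z *\<^sub>C R z x - x" if "x \<in> D" for x
    using that R.diff[of "z *\<^sub>C x" "A x"] cl by (simp add: bounded_clinear_def algebra_simps)
  show "norm (R z x) \<le> M / (1 + cmod z) * norm x" for x
    using onorm[OF R.bounded_linear, of x] rs(2) by (meson mult_right_mono norm_ge_zero order_trans)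
qed

lemma R_bound':
  assumes "z \<in> \<Omega>" shows "norm (R z x) \<le> M * norm x"
proof -
  have "M / (1 + cmod z) \<le> M" using M_pos by (simp add: divide_le_eq add_pos_nonneg distrib_left)
  then show ?thesis using R_bound[OF assms, of x] by (meson mult_right_mono norm_ge_zero order_trans)
qed

lemma resolvent_identity:
  assumes "z \<in> \<Omega>" "w \<in> \<Omega>"
  shows "R z x - R w x = (w - z) *\<^sub>C R z (R w x)"
proof -
  have "z *\<^sub>C R z (R w x) - R w x = R z (A (R w x))" using R_A[OF assms(1) R_in_D[OF assms(2)]] by simp
  also have "\<dots> = R z (w *\<^sub>C R w x - x)" using A_R[OF assms(2)] by simp
  also have "\<dots> = w *\<^sub>C R z (R w x) - R z x"
    using linear_diff[OF bounded_linear.linear[OF R_linear[OF assms(1)]]] R_scaleC[OF assms(1)] by simp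
  finally show ?thesis by (simp add: scaleC.diff_left algebra_simps)
qed

lemma R_commute:
  assumes "z \<in> \<Omega>" "w \<in> \<Omega>" shows "R z (R w x) = R w (R z x)"
proof (cases "z = w")
  case False
  have "(w - z) *\<^sub>C R w (R z x) = - ((z - w) *\<^sub>C R w (R z x))" by (simp add: scaleC.diff_left)
  also have "\<dots> = (w - z) *\<^sub>C R z (R w x)"
    unfolding resolvent_identity[OF assms, symmetric] resolvent_identity[OF assms(2,1), symmetric] by simp
  finally have "inverse (w - z) *\<^sub>C ((w - z) *\<^sub>C R w (R z x)) = inverse (w - z) *\<^sub>C ((w - z) *\<^sub>C R z (R w x))"
    by simp
  then show ?thesis using False by (simp add: scaleC_scaleC)
qed simp

lemma R_continuous: "continuous_on \<Omega> (\<lambda>z. R z x)"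
proof (rule continuous_on_eq_continuous_within[THEN iffD2], rule ballI)
  fix w assume w: "w \<in> \<Omega>"
  have "((\<lambda>z. R z x - R w x) \<longlongrightarrow> 0) (at w within \<Omega>)"
  proof (rule Lim_null_comparison)
    show "\<forall>\<^sub>F z in at w within \<Omega>. norm (R z x - R w x) \<le> cmod (w - z) * (M * norm (R w x))"
      unfolding eventually_at_filter
      by (rule always_eventually) (auto simp: resolvent_identity[OF _ w] norm_scaleC intro!: mult_left_mono R_bound')
    show "((\<lambda>z. cmod (w - z) * (M * norm (R w x))) \<longlongrightarrow> 0) (at w within \<Omega>)"
      by (auto intro!: tendsto_eq_intros)
  qed
  then show "continuous (at w within \<Omega>) (\<lambda>z. R z x)"
    unfolding continuous_within by (rule Lim_null[THEN iffD2])
qed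

lemma R_holomorphic:
  assumes l: "contractive_functional l"
  shows "(\<lambda>z. l (R z x)) holomorphic_on \<Omega>"
  unfolding holomorphic_on_def field_differentiable_def
proof (intro ballI exI)
  fix w assume w: "w \<in> \<Omega>"
  interpret l: bounded_linear l using l by (rule contractive_functionalD)
  have "((\<lambda>z. - l (R z (R w x))) \<longlongrightarrow> - l (R w (R w x))) (at w within \<Omega>)"
    using R_continuous[of "R w x"] w by (intro tendsto_intros l.tendsto) (auto simp: continuous_on_def)
  then have "((\<lambda>z. (l (R z x) - l (R w x)) / (z - w)) \<longlongrightarrow> - l (R w (R w x))) (at w within \<Omega>)"
  proof (rule Lim_transform_eventually)
    show "\<forall>\<^sub>F z in at w within \<Omega>. - l (R z (R w x)) = (l (R z x) - l (R w x)) / (z - w)"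
      unfolding eventually_at_filter
    proof (rule always_eventually, intro allI impI)
      fix z assume "z \<noteq> w" "z \<in> \<Omega>"
      then show "- l (R z (R w x)) = (l (R z x) - l (R w x)) / (z - w)"
        using resolvent_identity[OF _ w, of z x] contractive_functionalD[OF l]
        by (simp add: l.diff[symmetric] field_simps)
    qed
  qed
  then show "((\<lambda>z. l (R z x)) has_field_derivative - l (R w (R w x))) (at w within \<Omega>)"
    by (simp add: has_field_derivative_iff)
qed

end

section \<open>Integrals along hyperbolas\<close>

lemma cos_complex: "cos (of_real a + \<i> * of_real b) = Complex (cos a * cosh b) (- (sin a * sinh b))"
  by (simp add: complex_eq_iff Re_cos Im_cos cosh_def sinh_def field_simps)

lemma sin_complex: "sin (of_real a + \<i> * of_real b) = Complex (sin a * cosh b) (cos a * sinh b)"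
  by (simp add: complex_eq_iff Re_sin Im_sin cosh_def sinh_def field_simps)

lemma cmod_sin_complex: "(cmod (sin (of_real a + \<i> * of_real b)))\<^sup>2 = (sin a)\<^sup>2 + (sinh b)\<^sup>2"
proof -
  have "(cmod (sin (of_real a + \<i> * of_real b)))\<^sup>2 = (sin a)\<^sup>2 * (1 + (sinh b)\<^sup>2) + (1 - (sin a)\<^sup>2) * (sinh b)\<^sup>2"
    unfolding sin_complex cmod_power2
    by (simp only: complex.sel power_mult_distrib cosh_square_eq cos_squared_eq add.commute)
  then show ?thesis by (simp add: algebra_simps)
qed

lemma cmod_sin_le_cosh: "cmod (sin (of_real a + \<i> * of_real b)) \<le> cosh b"
proof -
  have "(sin a)\<^sup>2 \<le> 1" by (simp add: abs_square_le_1)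
  then have "(cmod (sin (of_real a + \<i> * of_real b)))\<^sup>2 \<le> (cosh b)\<^sup>2"
    unfolding cmod_sin_complex by (simp add: cosh_square_eq)
  then show ?thesis by (rule power2_le_imp_le) simp
qed

lemma cmod_cos_le_cosh: "cmod (cos (of_real a + \<i> * of_real b)) \<le> cosh b"
proof -
  have "(cmod (cos (of_real a + \<i> * of_real b)))\<^sup>2 = (cos a)\<^sup>2 * (1 + (sinh b)\<^sup>2) + (1 - (cos a)\<^sup>2) * (sinh b)\<^sup>2"
    unfolding cos_complex cmod_power2
    by (simp only: complex.sel power2_minus power_mult_distrib cosh_square_eq sin_squared_eq add.commute)
  also have "\<dots> = (cos a)\<^sup>2 + (sinh b)\<^sup>2" by (simp add: algebra_simps)
  also have "\<dots> \<le> (cosh b)\<^sup>2"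
    by (simp add: cosh_square_eq abs_square_le_1)
  finally show ?thesis by (rule power2_le_imp_le) simp
qed

text \<open>The hyperbola with vertex \<open>p + \<kappa> * cos \<psi>\<close> and asymptotes of slope \<open>\<plusminus> tan \<psi>\<close>, traversed
  downwards, is the image of a vertical line under \<open>p + \<kappa> cos\<close>.  Shifting the parameter by \<open>\<i> y\<close>
  changes the angle \<open>\<psi>\<close> into \<open>\<psi> - y\<close>.\<close>

definition hyperbola :: "real \<Rightarrow> real \<Rightarrow> real \<Rightarrow> real \<Rightarrow> complex" where
  "hyperbola p \<kappa> \<psi> \<xi> = of_real p + of_real \<kappa> * cos (of_real \<psi> + \<i> * of_real \<xi>)"

definition hyperbola' :: "real \<Rightarrow> real \<Rightarrow> real \<Rightarrow> complex" where
  "hyperbola' \<kappa> \<psi> \<xi> = - \<i> * of_real \<kappa> * sin (of_real \<psi> + \<i> * of_real \<xi>)"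

lemma hyperbola_Re_Im:
  "Re (hyperbola p \<kappa> \<psi> \<xi>) = p + \<kappa> * cos \<psi> * cosh \<xi>"
  "Im (hyperbola p \<kappa> \<psi> \<xi>) = - (\<kappa> * sin \<psi> * sinh \<xi>)"
  by (simp_all add: hyperbola_def cos_complex)

lemma hyperbola_has_derivative:
  "((hyperbola p \<kappa> \<psi>) has_vector_derivative hyperbola' \<kappa> \<psi> \<xi>) (at \<xi> within S)"
proof -
  have "((\<lambda>w. of_real p + of_real \<kappa> * cos (of_real \<psi> + \<i> * w)) has_field_derivative hyperbola' \<kappa> \<psi> \<xi>) (at (of_real \<xi>))"
    unfolding hyperbola'_def by (auto intro!: derivative_eq_intros)
  then have "((\<lambda>w. of_real p + of_real \<kappa> * cos (of_real \<psi> + \<i> * w)) \<circ> of_real has_vector_derivative (1 * hyperbola' \<kappa> \<psi> \<xi>)) (at \<xi>)"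
    by (intro field_vector_diff_chain_at) (auto intro!: derivative_eq_intros)
  then show ?thesis
    by (auto simp: o_def hyperbola_def[abs_def] intro: has_vector_derivative_at_within)
qed

lemma hyperbola_continuous: "continuous_on S (hyperbola p \<kappa> \<psi>)" "continuous_on S (hyperbola' \<kappa> \<psi>)"
  unfolding hyperbola_def[abs_def] hyperbola'_def[abs_def] by (intro continuous_intros)+

lemma hyperbola_bounds:
  assumes "\<kappa> \<ge> 0"
  shows "cmod (hyperbola p \<kappa> \<psi> \<xi>) \<le> \<bar>p\<bar> + \<kappa> * cosh \<xi>" "cmod (hyperbola' \<kappa> \<psi> \<xi>) \<le> \<kappa> * cosh \<xi>"
proof -
  have "cmod (hyperbola p \<kappa> \<psi> \<xi>) \<le> cmod (of_real p) + cmod (of_real \<kappa> * cos (of_real \<psi> + \<i> * of_real \<xi>))"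
    unfolding hyperbola_def by (rule norm_triangle_ineq)
  also have "\<dots> \<le> \<bar>p\<bar> + \<kappa> * cosh \<xi>"
    using assms by (auto simp: norm_mult intro!: mult_left_mono cmod_cos_le_cosh)
  finally show "cmod (hyperbola p \<kappa> \<psi> \<xi>) \<le> \<bar>p\<bar> + \<kappa> * cosh \<xi>" .
  show "cmod (hyperbola' \<kappa> \<psi> \<xi>) \<le> \<kappa> * cosh \<xi>"
    using assms by (auto simp: hyperbola'_def norm_mult intro!: mult_left_mono cmod_sin_le_cosh)
qed

text \<open>\<open>hyp_integral p \<kappa> \<psi> t g\<close> is the integral of \<open>exp (- z t) g\<close> along the hyperbola.  The function \<open>g\<close> takes the parameter of the curve as its
argument, so that products of symbols and resolvents need no special treatment.\<close>

definition hyp_kernel :: "real \<Rightarrow> real \<Rightarrow> real \<Rightarrow> real \<Rightarrow> real \<Rightarrow> complex" where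
  "hyp_kernel p \<kappa> \<psi> t \<xi> = exp (- hyperbola p \<kappa> \<psi> \<xi> * of_real t) * hyperbola' \<kappa> \<psi> \<xi>"

definition hyp_integral :: "real \<Rightarrow> real \<Rightarrow> real \<Rightarrow> real \<Rightarrow> (real \<Rightarrow> 'a::complex_banach) \<Rightarrow> 'a" where
  "hyp_integral p \<kappa> \<psi> t g = integral UNIV (\<lambda>\<xi>. hyp_kernel p \<kappa> \<psi> t \<xi> *\<^sub>C g \<xi>)"

lemma cosh_exp_tendsto_0:
  fixes c :: real assumes "c > 0"
  shows "((\<lambda>n. cosh n ^ p * exp (- c * cosh n)) \<longlongrightarrow> 0) at_top"
proof -
  obtain K where K: "K \<ge> 0" "\<And>x::real. cosh x ^ p * exp (- c * cosh x) \<le> K * exp (- \<bar>x\<bar>)"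
    using cosh_power_exp_bound[OF assms] by blast
  have lim: "((\<lambda>n::real. K * exp (- n)) \<longlongrightarrow> 0) at_top"
    by (intro tendsto_mult_right_zero) (simp add: filterlim_at_top_mult_tendsto_pos exp_at_bot filterlim_compose[OF exp_at_bot filterlim_uminus_at_bot_at_top])
  show ?thesis
  proof (rule Lim_null_comparison[OF _ lim])
    show "\<forall>\<^sub>F n in at_top. norm (cosh n ^ p * exp (- c * cosh n)) \<le> K * exp (- n)"
      using eventually_ge_at_top[of 0]
    proof eventually_elim
      case (elim n)
      then show ?case using K(2)[of n] by (simp add: abs_mult)
    qed
  qed
qed

context
  fixes p \<kappa> \<psi> t :: real
  assumes par: "\<kappa> > 0" "0 < \<psi>" "\<psi> < pi / 2" and t: "t > 0"
begin

lemma cos_psi_pos: "cos \<psi> > 0" using par by (intro cos_gt_zero_pi) auto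

lemma hyp_kernel_bound:
  "cmod (hyp_kernel p \<kappa> \<psi> t \<xi>) \<le> exp (- t * p) * \<kappa> * (cosh \<xi> * exp (- (t * \<kappa> * cos \<psi>) * cosh \<xi>))"
proof -
  have "cmod (hyp_kernel p \<kappa> \<psi> t \<xi>) \<le> exp (- t * p - t * \<kappa> * cos \<psi> * cosh \<xi>) * (\<kappa> * cosh \<xi>)"
    unfolding hyp_kernel_def norm_mult
    using par by (intro mult_mono hyperbola_bounds) (auto simp: hyperbola_Re_Im algebra_simps)
  then show ?thesis by (simp add: exp_diff exp_minus field_simps)
qed

lemma hyp_kernel_decay:
  obtains C where "C \<ge> 0" "\<And>\<xi>. cmod (hyp_kernel p \<kappa> \<psi> t \<xi>) * cosh \<xi> ^ n \<le> C * exp (- 1 * \<bar>\<xi>\<bar>)"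
proof -
  have "t * \<kappa> * cos \<psi> > 0" using par t cos_psi_pos by simp
  then obtain K where K: "K \<ge> 0"
    "\<And>x::real. cosh x ^ Suc n * exp (- (t * \<kappa> * cos \<psi>) * cosh x) \<le> K * exp (- \<bar>x\<bar>)"
    using cosh_power_exp_bound by blast
  show thesis
  proof (rule that[of "exp (- t * p) * \<kappa> * K"])
    fix \<xi>
    have "cmod (hyp_kernel p \<kappa> \<psi> t \<xi>) * cosh \<xi> ^ n \<le>
      exp (- t * p) * \<kappa> * (cosh \<xi> * exp (- (t * \<kappa> * cos \<psi>) * cosh \<xi>)) * cosh \<xi> ^ n"
      by (intro mult_right_mono hyp_kernel_bound) simp
    also have "\<dots> = exp (- t * p) * \<kappa> * (cosh \<xi> ^ Suc n * exp (- (t * \<kappa> * cos \<psi>) * cosh \<xi>))" by simp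
    also have "\<dots> \<le> exp (- t * p) * \<kappa> * (K * exp (- \<bar>\<xi>\<bar>))"
      using par by (intro mult_left_mono K) simp
    finally show "cmod (hyp_kernel p \<kappa> \<psi> t \<xi>) * cosh \<xi> ^ n \<le> exp (- t * p) * \<kappa> * K * exp (- 1 * \<bar>\<xi>\<bar>)"
      by simp
  qed (use par K in auto)
qed

lemma hyp_integrable:
  fixes g :: "real \<Rightarrow> 'a::complex_banach"
  assumes g: "continuous_on UNIV g" "\<And>\<xi>. norm (g \<xi>) \<le> K * cosh \<xi> ^ n"
  shows "(\<lambda>\<xi>. hyp_kernel p \<kappa> \<psi> t \<xi> *\<^sub>C g \<xi>) integrable_on UNIV"
proof -
  obtain C where C: "C \<ge> 0" "\<And>\<xi>. cmod (hyp_kernel p \<kappa> \<psi> t \<xi>) * cosh \<xi> ^ n \<le> C * exp (- 1 * \<bar>\<xi>\<bar>)"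
    using hyp_kernel_decay by blast
  have K: "K \<ge> 0" using order_trans[OF norm_ge_zero g(2)[of 0]] by simp
  show ?thesis
  proof (rule integrable_UNIV_exp_bound(1))
    show "continuous_on UNIV (\<lambda>\<xi>. hyp_kernel p \<kappa> \<psi> t \<xi> *\<^sub>C g \<xi>)"
      unfolding hyp_kernel_def by (intro continuous_intros g hyperbola_continuous)
    fix \<xi> :: real
    have "norm (hyp_kernel p \<kappa> \<psi> t \<xi> *\<^sub>C g \<xi>) \<le> cmod (hyp_kernel p \<kappa> \<psi> t \<xi>) * (K * cosh \<xi> ^ n)"
      unfolding norm_scaleC by (intro mult_left_mono g) simp
    also have "\<dots> = K * (cmod (hyp_kernel p \<kappa> \<psi> t \<xi>) * cosh \<xi> ^ n)" by simp
    also have "\<dots> \<le> K * (C * exp (- 1 * \<bar>\<xi>\<bar>))" using K by (intro mult_left_mono C)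
    finally show "norm (hyp_kernel p \<kappa> \<psi> t \<xi> *\<^sub>C g \<xi>) \<le> (K * C) * exp (- 1 * \<bar>\<xi>\<bar>)" by simp
  qed simp
qed

end

lemma hyp_integral_linear:
  fixes g :: "real \<Rightarrow> 'a::complex_banach" and T :: "'a \<Rightarrow> 'b::complex_banach"
  assumes "(\<lambda>\<xi>. hyp_kernel p \<kappa> \<psi> t \<xi> *\<^sub>C g \<xi>) integrable_on UNIV"
    and "bounded_linear T" "\<And>c x. T (c *\<^sub>C x) = c *\<^sub>C T x"
  shows "T (hyp_integral p \<kappa> \<psi> t g) = hyp_integral p \<kappa> \<psi> t (\<lambda>\<xi>. T (g \<xi>))"
  using integral_linear[OF assms(1,2)] by (simp add: hyp_integral_def o_def assms(3))

lemma vector_derivative_quadratic_remainder: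
  fixes f :: "real \<Rightarrow> 'a::real_normed_vector"
  assumes "\<delta> > 0" "\<And>\<eta>. \<bar>\<eta>\<bar> \<le> \<delta> \<Longrightarrow> norm (f (t + \<eta>) - f t - \<eta> *\<^sub>R d) \<le> C * \<eta>\<^sup>2"
  shows "(f has_vector_derivative d) (at t)"
  unfolding has_vector_derivative_def has_derivative_at
proof (intro conjI)
  show "bounded_linear (\<lambda>x. x *\<^sub>R d)" by (rule bounded_linear_scaleR_left)
  show "(\<lambda>h. norm (f (t + h) - f t - h *\<^sub>R d) / norm h) \<midarrow>0\<rightarrow> 0"
  proof (rule Lim_null_comparison)
    show "\<forall>\<^sub>F h in at 0. norm (norm (f (t + h) - f t - h *\<^sub>R d) / norm h) \<le> C * \<bar>h\<bar>"
      unfolding eventually_at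
    proof (intro exI[of _ \<delta>] conjI ballI impI)
      fix h :: real assume h: "h \<noteq> 0 \<and> dist h 0 < \<delta>"
      then have "norm (f (t + h) - f t - h *\<^sub>R d) / \<bar>h\<bar> \<le> C * h\<^sup>2 / \<bar>h\<bar>"
        by (intro divide_right_mono assms) auto
      also have "C * h\<^sup>2 / \<bar>h\<bar> = C * \<bar>h\<bar>" using h by (simp add: power2_eq_square field_simps abs_if)
      finally show "norm (norm (f (t + h) - f t - h *\<^sub>R d) / norm h) \<le> C * \<bar>h\<bar>" by simp
    qed (use assms in auto)
    show "(\<lambda>h. C * \<bar>h\<bar>) \<midarrow>0\<rightarrow> 0" by (auto intro!: tendsto_eq_intros)
  qed
qed

lemma cmod_exp_remainder: "cmod (exp w - 1 - w) \<le> exp \<bar>Re w\<bar> * (cmod w)\<^sup>2"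
  using Taylor_exp[of w 1] by (simp add: power2_eq_square algebra_simps)

text \<open>The remainder of \<open>exp (- z \<eta>)\<close> after the linear term is at most \<open>exp \<bar>Re (z \<eta>)\<bar> \<bar>z \<eta>\<bar>\<^sup>2\<close>; for \<open>\<bar>\<eta>\<bar> \<le> t / 2\<close> half of the decay of
\<open>exp (- z t)\<close> is left, and this absorbs \<open>\<bar>z\<bar>\<^sup>2\<close>.\<close>

lemma hyp_integral_derivative:
  fixes g :: "real \<Rightarrow> 'a::complex_banach"
  assumes par: "\<kappa> > 0" "0 < \<psi>" "\<psi> < pi / 2" "t > 0"
    and g: "continuous_on UNIV g" "\<And>\<xi>. norm (g \<xi>) \<le> K * cosh \<xi> ^ n"
  shows "((\<lambda>t. hyp_integral 0 \<kappa> \<psi> t g) has_vector_derivative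
            - hyp_integral 0 \<kappa> \<psi> t (\<lambda>\<xi>. hyperbola 0 \<kappa> \<psi> \<xi> *\<^sub>C g \<xi>)) (at t)"
proof -
  let ?z = "hyperbola 0 \<kappa> \<psi>"
  note cos_pos = cos_psi_pos[OF par]
  have t2: "t / 2 > 0" using par by simp
  obtain C where C: "C \<ge> 0" "\<And>\<xi>. cmod (hyp_kernel 0 \<kappa> \<psi> (t / 2) \<xi>) * cosh \<xi> ^ (n + 2) \<le> C * exp (- 1 * \<bar>\<xi>\<bar>)"
    using hyp_kernel_decay[OF par(1-3) t2] by blast
  have K: "K \<ge> 0" using order_trans[OF norm_ge_zero g(2)[of 0]] by simp
  have zg: "continuous_on UNIV (\<lambda>\<xi>. ?z \<xi> *\<^sub>C g \<xi>)"
    by (intro continuous_intros g hyperbola_continuous)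
  have zg': "norm (?z \<xi> *\<^sub>C g \<xi>) \<le> (\<kappa> * K) * cosh \<xi> ^ (Suc n)" for \<xi>
  proof -
    have "norm (?z \<xi> *\<^sub>C g \<xi>) \<le> (\<kappa> * cosh \<xi>) * (K * cosh \<xi> ^ n)"
      unfolding norm_scaleC using par hyperbola_bounds(1)[of \<kappa> 0] by (intro mult_mono g) auto
    then show ?thesis by (simp add: mult_ac)
  qed
  show ?thesis
  proof (rule vector_derivative_quadratic_remainder[OF t2])
    fix \<eta> :: real assume eta: "\<bar>\<eta>\<bar> \<le> t / 2"
    then have teta: "t + \<eta> > 0" using par by linarith
    note int = hyp_integrable[OF par g] hyp_integrable[OF par(1-3) teta g] hyp_integrable[OF par zg zg']
    let ?F = "\<lambda>\<xi>. hyp_kernel 0 \<kappa> \<psi> (t + \<eta>) \<xi> *\<^sub>C g \<xi> - hyp_kernel 0 \<kappa> \<psi> t \<xi> *\<^sub>C g \<xi>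
          - \<eta> *\<^sub>R (- (hyp_kernel 0 \<kappa> \<psi> t \<xi> *\<^sub>C (?z \<xi> *\<^sub>C g \<xi>)))"
    have eq: "hyp_integral 0 \<kappa> \<psi> (t + \<eta>) g - hyp_integral 0 \<kappa> \<psi> t g -
        \<eta> *\<^sub>R (- hyp_integral 0 \<kappa> \<psi> t (\<lambda>\<xi>. ?z \<xi> *\<^sub>C g \<xi>)) = integral UNIV ?F"
      unfolding hyp_integral_def
      by (simp only: Henstock_Kurzweil_Integration.integral_diff Henstock_Kurzweil_Integration.integral_neg
          integral_cmul int integrable_diff integrable_neg integrable_cmul)
    have F: "?F \<xi> = (hyp_kernel 0 \<kappa> \<psi> t \<xi> * (exp (- ?z \<xi> * of_real \<eta>) - 1 - (- ?z \<xi> * of_real \<eta>))) *\<^sub>C g \<xi>" for \<xi>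
    proof -
      have "hyp_kernel 0 \<kappa> \<psi> (t + \<eta>) \<xi> = hyp_kernel 0 \<kappa> \<psi> t \<xi> * exp (- ?z \<xi> * of_real \<eta>)"
      proof -
        have "- ?z \<xi> * of_real (t + \<eta>) = - ?z \<xi> * of_real t + - ?z \<xi> * of_real \<eta>"
          by (simp add: algebra_simps)
        then show ?thesis unfolding hyp_kernel_def by (simp only: exp_add mult_ac)
      qed
      then show ?thesis
        by (simp add: scaleC_of_real[symmetric] scaleC_scaleC scaleC.diff_left scaleC_add_left
            scaleC.minus_left scaleC.minus_right algebra_simps)
    qed
    have "norm (?F \<xi>) \<le> (\<eta>\<^sup>2 * (\<kappa>\<^sup>2 * K * C)) * exp (- 1 * \<bar>\<xi>\<bar>)" for \<xi>
    proof -
      have "\<bar>Re (- ?z \<xi> * of_real \<eta>)\<bar> \<le> Re (?z \<xi>) * (t / 2)"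
      proof -
        have "\<bar>Re (- ?z \<xi> * of_real \<eta>)\<bar> = Re (?z \<xi>) * \<bar>\<eta>\<bar>"
          using par cos_pos by (simp add: hyperbola_Re_Im abs_mult)
        also have "\<dots> \<le> Re (?z \<xi>) * (t / 2)"
          using eta par cos_pos by (intro mult_left_mono) (auto simp: hyperbola_Re_Im)
        finally show ?thesis .
      qed
      then have "exp \<bar>Re (- ?z \<xi> * of_real \<eta>)\<bar> * (cmod (- ?z \<xi> * of_real \<eta>))\<^sup>2 \<le>
          exp (Re (?z \<xi>) * (t / 2)) * (\<kappa> * cosh \<xi> * \<bar>\<eta>\<bar>)\<^sup>2"
        using par hyperbola_bounds(1)[of \<kappa> 0]
        by (intro mult_mono power_mono) (auto simp: norm_mult intro!: mult_right_mono)
      then have r: "cmod (exp (- ?z \<xi> * of_real \<eta>) - 1 - (- ?z \<xi> * of_real \<eta>)) \<le>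
          exp (Re (?z \<xi>) * (t / 2)) * (\<kappa> * cosh \<xi> * \<bar>\<eta>\<bar>)\<^sup>2"
        using cmod_exp_remainder order_trans by blast
      have "norm (?F \<xi>) \<le> cmod (hyp_kernel 0 \<kappa> \<psi> t \<xi>) * (exp (Re (?z \<xi>) * (t / 2)) * (\<kappa> * cosh \<xi> * \<bar>\<eta>\<bar>)\<^sup>2) * (K * cosh \<xi> ^ n)"
        unfolding F norm_scaleC norm_mult by (intro mult_mono r g order_refl) (auto intro!: mult_nonneg_nonneg)
      also have "cmod (hyp_kernel 0 \<kappa> \<psi> t \<xi>) = cmod (hyp_kernel 0 \<kappa> \<psi> (t / 2) \<xi>) * exp (- (Re (?z \<xi>) * (t / 2)))"
        by (simp add: hyp_kernel_def norm_mult exp_minus[symmetric] mult_exp_exp)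
      also have "\<dots> * (exp (Re (?z \<xi>) * (t / 2)) * (\<kappa> * cosh \<xi> * \<bar>\<eta>\<bar>)\<^sup>2) * (K * cosh \<xi> ^ n) =
          (\<eta>\<^sup>2 * \<kappa>\<^sup>2 * K) * (cmod (hyp_kernel 0 \<kappa> \<psi> (t / 2) \<xi>) * cosh \<xi> ^ (n + 2))"
        by (simp add: exp_minus power_mult_distrib power_add power2_eq_square field_simps)
      also have "\<dots> \<le> (\<eta>\<^sup>2 * \<kappa>\<^sup>2 * K) * (C * exp (- 1 * \<bar>\<xi>\<bar>))" using K by (intro mult_left_mono C) simp
      finally show ?thesis by (simp add: mult_ac)
    qed
    moreover have "continuous_on UNIV ?F"
      unfolding hyp_kernel_def by (intro continuous_intros g hyperbola_continuous)
    ultimately have "norm (integral UNIV ?F) \<le> \<eta>\<^sup>2 * (\<kappa>\<^sup>2 * K * C) * (2 / 1)"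
      by (intro integrable_UNIV_exp_bound(2)) auto
    then show "norm (hyp_integral 0 \<kappa> \<psi> (t + \<eta>) g - hyp_integral 0 \<kappa> \<psi> t g -
        \<eta> *\<^sub>R (- hyp_integral 0 \<kappa> \<psi> t (\<lambda>\<xi>. ?z \<xi> *\<^sub>C g \<xi>))) \<le> (\<kappa>\<^sup>2 * K * C * 2) * \<eta>\<^sup>2"
      unfolding eq by (simp add: mult_ac)
  qed
qed

lemma open_starlike_primitive:
  fixes g :: "complex \<Rightarrow> complex"
  assumes "open S" "starlike S" "g holomorphic_on S"
  obtains G where "\<And>z. z \<in> S \<Longrightarrow> (G has_field_derivative g z) (at z)"
proof -
  have "\<exists>G. \<forall>x\<in>S. (G has_field_derivative g x) (at x)"
    using assms by (intro holomorphic_starlike_primitive[of _ _ "{}"])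
      (auto intro: holomorphic_on_imp_continuous_on holomorphic_on_imp_differentiable_at)
  then show thesis using that by blast
qed

lemma has_integral_hyperbola_primitive:
  assumes "\<And>z. z \<in> S \<Longrightarrow> (G has_field_derivative g z) (at z)" "\<And>\<xi>. hyperbola p \<kappa> \<psi> \<xi> \<in> S" "a \<le> b"
  shows "((\<lambda>\<xi>. hyperbola' \<kappa> \<psi> \<xi> * g (hyperbola p \<kappa> \<psi> \<xi>)) has_integral
            G (hyperbola p \<kappa> \<psi> b) - G (hyperbola p \<kappa> \<psi> a)) {a..b}"
proof (rule fundamental_theorem_of_calculus[OF assms(3)])
  fix \<xi> assume "\<xi> \<in> {a..b}"
  have "(G \<circ> hyperbola p \<kappa> \<psi> has_vector_derivative hyperbola' \<kappa> \<psi> \<xi> * g (hyperbola p \<kappa> \<psi> \<xi>)) (at \<xi>)"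
    by (rule field_vector_diff_chain_at[OF hyperbola_has_derivative assms(1)[OF assms(2)]])
  then show "((\<lambda>\<xi>. G (hyperbola p \<kappa> \<psi> \<xi>)) has_vector_derivative hyperbola' \<kappa> \<psi> \<xi> * g (hyperbola p \<kappa> \<psi> \<xi>)) (at \<xi> within {a..b})"
    by (auto simp: o_def intro: has_vector_derivative_at_within)
qed

lemma primitive_segment_bound:
  fixes g :: "complex \<Rightarrow> complex"
  assumes "\<And>z. z \<in> S \<Longrightarrow> (G has_field_derivative g z) (at z)" "closed_segment a b \<subseteq> S"
    "\<And>z. z \<in> closed_segment a b \<Longrightarrow> cmod (g z) \<le> B"
  shows "cmod (G b - G a) \<le> B * cmod (b - a)"
  by (rule field_differentiable_bound[of "closed_segment a b" G g])
     (use assms in \<open>auto intro: has_field_derivative_at_within\<close>)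

lemma closed_segment_Re_ge:
  assumes "w \<in> closed_segment a b" "c \<le> Re a" "c \<le> Re b" shows "c \<le> Re w"
  using closed_segment_subset[of a "{z. c \<le> Re z}" b] assms convex_halfspace_Re_ge[of c] by auto

lemma hyperbola_chord:
  assumes "\<kappa> \<ge> 0"
  shows "cmod (hyperbola p \<kappa> \<psi> n - hyperbola p \<kappa> \<psi> (- n)) \<le> 2 * \<kappa> * cosh n"
proof -
  have "hyperbola p \<kappa> \<psi> n - hyperbola p \<kappa> \<psi> (- n) = Complex 0 (- 2 * (\<kappa> * sin \<psi> * sinh n))"
    by (simp add: complex_eq_iff hyperbola_Re_Im)
  then have "cmod (hyperbola p \<kappa> \<psi> n - hyperbola p \<kappa> \<psi> (- n)) = 2 * \<kappa> * (\<bar>sin \<psi>\<bar> * \<bar>sinh n\<bar>)"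
    using assms by (simp add: complex_norm abs_mult real_sqrt_mult power_mult_distrib)
  also have "\<dots> \<le> 2 * \<kappa> * (1 * cosh n)"
  proof (intro mult_left_mono mult_mono)
    show "\<bar>sinh n\<bar> \<le> cosh n" using sinh_less_cosh_real[of n] sinh_less_cosh_real[of "- n"] by simp
  qed (use assms in auto)
  finally show ?thesis by simp
qed

text \<open>A hyperbola can be closed to the right by the vertical chord through its end points, along which
  \<open>exp (- z t)\<close> is small.\<close>

lemma hyp_integral_right_zero:
  assumes par: "\<kappa> > 0" "0 < \<psi>" "\<psi> < pi / 2" "t > 0"
    and g: "g holomorphic_on {z. Re z > r}" "\<And>z. Re z > r \<Longrightarrow> cmod (g z) \<le> C" and r: "r < p + \<kappa> * cos \<psi>"
  shows "(\<lambda>\<xi>. hyp_kernel p \<kappa> \<psi> t \<xi> *\<^sub>C g (hyperbola p \<kappa> \<psi> \<xi>)) integrable_on UNIV"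
    "hyp_integral p \<kappa> \<psi> t (\<lambda>\<xi>. g (hyperbola p \<kappa> \<psi> \<xi>)) = 0"
proof -
  let ?z = "hyperbola p \<kappa> \<psi>" and ?S = "{z. Re z > r}"
  note cos_pos = cos_psi_pos[OF par]
  have c0: "\<kappa> * cos \<psi> > 0" using par cos_pos by simp
  have zS: "?z \<xi> \<in> ?S" for \<xi>
    using r mult_left_mono[OF cosh_real_ge_1[of \<xi>], of "\<kappa> * cos \<psi>"] c0 by (simp add: hyperbola_Re_Im)
  have op: "open ?S" by (rule open_halfspace_Re_gt)
  have star: "starlike ?S"
    by (rule convex_imp_starlike) (auto simp: convex_halfspace_Re_gt intro!: exI[of _ "of_real (r + 1)"])
  have C: "C \<ge> 0" using order_trans[OF norm_ge_zero g(2)[of "?z 0"]] zS[of 0] by simp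
  have "continuous_on UNIV (\<lambda>\<xi>. g (?z \<xi>))"
    by (rule continuous_on_compose2[OF holomorphic_on_imp_continuous_on[OF g(1)] hyperbola_continuous(1)]) (use zS in auto)
  then show int: "(\<lambda>\<xi>. hyp_kernel p \<kappa> \<psi> t \<xi> *\<^sub>C g (?z \<xi>)) integrable_on UNIV"
    by (rule hyp_integrable[OF par, where n=0 and K=C]) (use zS g in auto)
  have "(\<lambda>z. exp (- z * of_real t) * g z) holomorphic_on ?S"
    by (intro holomorphic_intros g)
  then obtain G where G: "\<And>z. z \<in> ?S \<Longrightarrow> (G has_field_derivative exp (- z * of_real t) * g z) (at z)"
    using open_starlike_primitive[OF op star] by blast
  have eq: "integral {-n..n} (\<lambda>\<xi>. hyp_kernel p \<kappa> \<psi> t \<xi> *\<^sub>C g (?z \<xi>)) = G (?z n) - G (?z (- n))" if "n \<ge> 0" for n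
    using has_integral_hyperbola_primitive[OF G zS, of "- n" n] that
    by (intro integral_unique) (simp add: hyp_kernel_def scaleC_complex_def mult_ac)
  have bd: "cmod (G (?z n) - G (?z (- n))) \<le> (C * exp (- t * p) * (2 * \<kappa>)) * (cosh n ^ 1 * exp (- (t * \<kappa> * cos \<psi>) * cosh n))" for n
  proof -
    have 1: "p + \<kappa> * cos \<psi> * cosh n \<le> Re w" if "w \<in> closed_segment (?z (- n)) (?z n)" for w
      by (rule closed_segment_Re_ge[OF that]) (simp_all add: hyperbola_Re_Im)
    have 2: "r < Re w" if "w \<in> closed_segment (?z (- n)) (?z n)" for w
      using 1[OF that] zS[of n] by (simp add: hyperbola_Re_Im)
    have "cmod (G (?z n) - G (?z (- n))) \<le> (exp (- t * (p + \<kappa> * cos \<psi> * cosh n)) * C) * cmod (?z n - ?z (- n))"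
    proof (rule primitive_segment_bound[OF G])
      fix w assume w: "w \<in> closed_segment (?z (- n)) (?z n)"
      show "cmod (exp (- w * of_real t) * g w) \<le> exp (- t * (p + \<kappa> * cos \<psi> * cosh n)) * C"
        unfolding norm_mult using 1[OF w] 2[OF w] g(2) par C by (intro mult_mono) (auto simp: mult.commute)
    next
      show "closed_segment (?z (- n)) (?z n) \<subseteq> ?S" using 2 by blast
    qed
    also have "\<dots> \<le> (exp (- t * (p + \<kappa> * cos \<psi> * cosh n)) * C) * (2 * \<kappa> * cosh n)"
      using C hyperbola_chord[of \<kappa> p \<psi> n] par by (intro mult_left_mono) auto
    also have "exp (- t * (p + \<kappa> * cos \<psi> * cosh n)) = exp (- t * p) * exp (- (t * \<kappa> * cos \<psi>) * cosh n)"
      by (simp add: exp_add[symmetric] algebra_simps)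
    finally show ?thesis using C by (simp add: mult_ac)
  qed
  have lim: "((\<lambda>n. G (?z n) - G (?z (- n))) \<longlongrightarrow> 0) at_top"
  proof (rule Lim_null_comparison)
    show "((\<lambda>n. (C * exp (- t * p) * (2 * \<kappa>)) * (cosh n ^ 1 * exp (- (t * \<kappa> * cos \<psi>) * cosh n))) \<longlongrightarrow> 0) at_top"
      using par cos_pos by (intro tendsto_mult_right_zero cosh_exp_tendsto_0) simp
  qed (use bd in simp)
  show "hyp_integral p \<kappa> \<psi> t (\<lambda>\<xi>. g (?z \<xi>)) = 0"
    unfolding hyp_integral_def
  proof (rule integral_UNIV_eqI[OF int])
    show "((\<lambda>n. integral {-n..n} (\<lambda>\<xi>. hyp_kernel p \<kappa> \<psi> t \<xi> *\<^sub>C g (?z \<xi>))) \<longlongrightarrow> 0) at_top"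
      by (rule Lim_transform_eventually[OF lim])
         (use eventually_ge_at_top[of 0] in \<open>eventually_elim, simp add: eq\<close>)
  qed
qed

lemma hyperbola_scale: "hyperbola (- s) s \<psi> \<xi> = of_real s * hyperbola (-1) 1 \<psi> \<xi>"
  by (simp add: hyperbola_def algebra_simps)

text \<open>With \<open>w = (\<psi> + \<i> \<xi>) / 2\<close> one has \<open>cos (2 w) - 1 = - 2 sin\<^sup>2 w\<close>, and \<open>\<bar>sin w\<bar>\<close> is smallest at the vertex.\<close>

lemma hyperbola_left_bound:
  assumes "s > 0"
  shows "s * (1 - cos \<psi>) \<le> cmod (hyperbola (- s) s \<psi> \<xi>)"
proof -
  let ?w = "of_real (\<psi> / 2) + \<i> * of_real (\<xi> / 2)"
  have "hyperbola (-1) 1 \<psi> \<xi> = cos (2 * ?w) - 1" by (simp add: hyperbola_def)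
  also have "\<dots> = - 2 * (sin ?w)\<^sup>2" unfolding cos_double_sin by simp
  finally have "cmod (hyperbola (-1) 1 \<psi> \<xi>) = 2 * (cmod (sin ?w))\<^sup>2" by (simp only: norm_mult norm_power) simp
  also have "\<dots> \<ge> 2 * (sin (\<psi> / 2))\<^sup>2" unfolding cmod_sin_complex by simp
  also have "2 * (sin (\<psi> / 2))\<^sup>2 = 1 - cos \<psi>" using cos_double_sin[of "\<psi> / 2"] by simp
  finally show ?thesis using assms by (simp add: hyperbola_scale[of s] norm_mult)
qed

text \<open>On a hyperbola running left of \<open>0\<close>, \<open>1/w\<close> contributes its full residue.  The primitive of
  \<open>exp (- w) / w\<close> is an entire function plus a logarithm; replacing \<open>Ln (- w)\<close>, which is regular across
  the vertex, by \<open>Ln w\<close>, which is regular across the chord on the right, costs \<open>\<plusminus> \<i> \<pi>\<close> at the two ends.\<close>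

lemma hyp_integral_inverse_unit:
  assumes psi: "0 < \<psi>" "\<psi> < pi / 2"
  shows "hyp_integral (-1) 1 \<psi> 1 (\<lambda>\<xi>. inverse (hyperbola (-1) 1 \<psi> \<xi>)) = 2 * of_real pi * \<i>"
proof -
  let ?z = "hyperbola (-1) 1 \<psi>"
  have par: "(1::real) > 0" "0 < \<psi>" "\<psi> < pi / 2" "(1::real) > 0" using psi by auto
  note cos_pos = cos_psi_pos[OF par]
  have sin_pos: "sin \<psi> > 0" using psi by (intro sin_gt_zero) auto
  have cos1: "cos \<psi> < 1" using psi cos_monotone_0_pi[of 0 \<psi>] by simp
  have nz: "?z \<xi> \<noteq> 0 \<and> - ?z \<xi> \<notin> \<real>\<^sub>\<le>\<^sub>0" for \<xi>
  proof (cases "\<xi> = 0")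
    case True
    then have "Re (?z \<xi>) < 0" using cos1 by (simp add: hyperbola_Re_Im)
    then show ?thesis by (auto simp: complex_nonpos_Reals_iff)
  next
    case False
    then have "Im (?z \<xi>) \<noteq> 0" using sin_pos by (simp add: hyperbola_Re_Im)
    then show ?thesis by (auto simp: complex_nonpos_Reals_iff)
  qed
  have zlow: "1 - cos \<psi> \<le> cmod (?z \<xi>)" for \<xi>
    using hyperbola_left_bound[of 1] by simp
  \<comment> \<open>the entire part of \<open>exp (- z) / z\<close>\<close>
  define h :: "complex \<Rightarrow> complex" where
    "h z = (if z = 0 then deriv (\<lambda>z. exp (- z)) 0 else (exp (- z) - exp (- 0)) / (z - 0))" for z
  have "h holomorphic_on UNIV"
    unfolding h_def by (rule pole_lemma) (auto intro!: holomorphic_intros)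
  then obtain E where E: "\<And>z. (E has_field_derivative h z) (at z)"
    using open_starlike_primitive[OF open_UNIV convex_imp_starlike[OF convex_UNIV], of h] by auto
  have h: "h w + inverse w = exp (- w) * inverse w" if "w \<noteq> 0" for w
    using that by (simp add: h_def field_simps)
  define P1 where "P1 w = E w + Ln (- w)" for w
  define P2 where "P2 w = E w + Ln w" for w
  have P1: "(P1 has_field_derivative exp (- w) * inverse w) (at w)"
    if "w \<in> {w. w \<noteq> 0 \<and> - w \<notin> \<real>\<^sub>\<le>\<^sub>0}" for w
  proof -
    have "(P1 has_field_derivative h w + inverse (- w) * (- 1)) (at w)"
      unfolding P1_def using that
      by (auto intro!: derivative_eq_intros E DERIV_chain'[OF _ has_field_derivative_Ln])
    then show ?thesis using h[of w] that by simp
  qed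
  have P2: "(P2 has_field_derivative exp (- w) * inverse w) (at w)" if "w \<in> {w. Re w > 0}" for w
  proof -
    have "w \<notin> \<real>\<^sub>\<le>\<^sub>0" "w \<noteq> 0" using that by (auto simp: complex_nonpos_Reals_iff)
    then show ?thesis using h[of w]
      unfolding P2_def by (auto intro!: derivative_eq_intros E has_field_derivative_Ln simp: mult.commute)
  qed
  let ?F = "\<lambda>\<xi>. hyp_kernel (-1) 1 \<psi> 1 \<xi> *\<^sub>C inverse (?z \<xi>)"
  have int: "?F integrable_on UNIV"
  proof (rule hyp_integrable[OF par, where n=0 and K="1 / (1 - cos \<psi>)"])
    show "continuous_on UNIV (\<lambda>\<xi>. inverse (?z \<xi>))"
      using nz by (intro continuous_intros hyperbola_continuous) auto
    show "norm (inverse (?z \<xi>)) \<le> 1 / (1 - cos \<psi>) * cosh \<xi> ^ 0" for \<xi>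
      using le_imp_inverse_le[OF zlow, of \<xi>] cos1 unfolding norm_inverse by (simp add: divide_inverse)
  qed
  have eq: "integral {-n..n} ?F = 2 * of_real pi * \<i> + (P2 (?z n) - P2 (?z (- n)))" if "n > 0" for n
  proof -
    have "integral {-n..n} ?F = P1 (?z n) - P1 (?z (- n))"
      using has_integral_hyperbola_primitive[where S="{w. w \<noteq> 0 \<and> - w \<notin> \<real>\<^sub>\<le>\<^sub>0}", OF P1, of "-1" 1 \<psi> "-n" n] nz that
      by (intro integral_unique) (simp add: hyp_kernel_def scaleC_complex_def mult_ac)
    moreover have "Ln (- ?z n) = Ln (?z n) + \<i> * pi"
      using nz[of n] that sin_pos by (subst Ln_minus) (auto simp: hyperbola_Re_Im)
    moreover have "Ln (- ?z (- n)) = Ln (?z (- n)) - \<i> * pi"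
      using nz[of "- n"] that sin_pos by (subst Ln_minus) (auto simp: hyperbola_Re_Im mult_le_0_iff)
    ultimately show ?thesis by (simp add: P1_def P2_def algebra_simps)
  qed
  have bd: "cmod (P2 (?z n) - P2 (?z (- n))) \<le> (exp 1 * 2) * (cosh n ^ 1 * exp (- cos \<psi> * cosh n))"
    if n: "2 / cos \<psi> \<le> cosh n" for n
  proof -
    have 0: "cos \<psi> * cosh n \<ge> 2" using n cos_pos by (simp add: field_simps)
    have 1: "- 1 + cos \<psi> * cosh n \<le> Re w" if "w \<in> closed_segment (?z (- n)) (?z n)" for w
      by (rule closed_segment_Re_ge[OF that]) (simp_all add: hyperbola_Re_Im)
    have "cmod (P2 (?z n) - P2 (?z (- n))) \<le> (exp 1 * exp (- cos \<psi> * cosh n)) * cmod (?z n - ?z (- n))"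
    proof (rule primitive_segment_bound[OF P2])
      fix w assume w: "w \<in> closed_segment (?z (- n)) (?z n)"
      have "1 \<le> cmod w" using 1[OF w] 0 complex_Re_le_cmod[of w] by linarith
      then have "inverse (cmod w) \<le> 1" by (rule inverse_le_1_iff[THEN iffD2, OF disjI2])
      then have "exp (- Re w) * inverse (cmod w) \<le> exp (1 - cos \<psi> * cosh n) * 1"
        using 1[OF w] by (intro mult_mono) auto
      then show "cmod (exp (- w) * inverse w) \<le> exp 1 * exp (- cos \<psi> * cosh n)"
        by (simp add: norm_mult norm_inverse exp_add[symmetric])
    next
      show "closed_segment (?z (- n)) (?z n) \<subseteq> {w. Re w > 0}" using 1 0 by force
    qed
    also have "\<dots> \<le> (exp 1 * exp (- cos \<psi> * cosh n)) * (2 * cosh n)"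
      using hyperbola_chord[of 1 "-1" \<psi> n] by (intro mult_left_mono) auto
    finally show ?thesis by (simp add: mult_ac)
  qed
  have ev: "\<forall>\<^sub>F n in at_top. 2 / cos \<psi> \<le> cosh (n::real)"
    using filterlim_at_top[THEN iffD1, OF cosh_real_at_top] by blast
  have lim: "((\<lambda>n. P2 (?z n) - P2 (?z (- n))) \<longlongrightarrow> 0) at_top"
  proof (rule Lim_null_comparison)
    show "\<forall>\<^sub>F n in at_top. norm (P2 (?z n) - P2 (?z (- n))) \<le> (exp 1 * 2) * (cosh n ^ 1 * exp (- cos \<psi> * cosh n))"
      using ev by eventually_elim (rule bd)
    show "((\<lambda>n. (exp 1 * 2) * (cosh n ^ 1 * exp (- cos \<psi> * cosh n))) \<longlongrightarrow> 0) at_top"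
      by (intro tendsto_mult_right_zero cosh_exp_tendsto_0 cos_pos)
  qed
  have lim2: "((\<lambda>n. 2 * of_real pi * \<i> + (P2 (?z n) - P2 (?z (- n)))) \<longlongrightarrow> 2 * of_real pi * \<i>) at_top"
    using tendsto_add[OF tendsto_const lim] by simp
  show ?thesis
    unfolding hyp_integral_def
  proof (rule integral_UNIV_eqI[OF int])
    show "((\<lambda>n. integral {-n..n} ?F) \<longlongrightarrow> 2 * of_real pi * \<i>) at_top"
      by (rule Lim_transform_eventually[OF lim2])
         (use eventually_gt_at_top[of 0] in \<open>eventually_elim, simp add: eq\<close>)
  qed
qed

text \<open>On the hyperbola of size \<open>s\<close> the weight \<open>exp (- z / s)\<close> is that of the unit hyperbola.\<close>

lemma hyp_kernel_scale:
  assumes "s \<noteq> 0"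
  shows "hyp_kernel (- s) s \<psi> (1 / s) \<xi> = of_real s * hyp_kernel (-1) 1 \<psi> 1 \<xi>"
  using assms unfolding hyp_kernel_def hyperbola_scale[of s] by (simp add: hyperbola'_def)

lemma hyp_integral_inverse:
  assumes "0 < \<psi>" "\<psi> < pi / 2" "s > 0"
  shows "hyp_integral (-s) s \<psi> (1 / s) (\<lambda>\<xi>. inverse (hyperbola (-s) s \<psi> \<xi>)) = 2 * of_real pi * \<i>"
  unfolding hyp_integral_inverse_unit[OF assms(1,2), symmetric] hyp_integral_def
  using assms(3) by (intro integral_cong) (simp add: hyperbola_scale[of s] hyp_kernel_scale[of s] scaleC_complex_def)

context sectorial_operator
begin

lemma hyperbola_in_\<Omega>:
  assumes psi: "\<phi> \<le> \<psi>" "\<psi> < pi / 2" and k: "\<kappa> > 0" "p + \<kappa> * cos \<psi> < \<rho>\<^sub>0"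
  shows "hyperbola p \<kappa> \<psi> \<xi> \<in> \<Omega>"
proof -
  have cos: "cos \<psi> > 0" and sin: "sin \<psi> > 0"
    using psi angle by (auto intro!: cos_gt_zero_pi sin_gt_zero)
  have "tan \<phi> \<le> tan \<psi>" using psi angle by (intro tan_mono_le) auto
  then have t: "tan \<phi> * cos \<psi> \<le> sin \<psi>" using cos by (simp add: tan_def field_simps)
  have sc: "cosh \<xi> - 1 \<le> \<bar>sinh \<xi>\<bar>"
  proof (rule power2_le_imp_le)
    show "(cosh \<xi> - 1)\<^sup>2 \<le> \<bar>sinh \<xi>\<bar>\<^sup>2"
      using cosh_real_ge_1[of \<xi>] by (simp add: power2_diff sinh_square_eq)
  qed simp
  have "tan \<phi> * (p + \<kappa> * cos \<psi> * cosh \<xi> - \<rho>\<^sub>0) < tan \<phi> * (\<kappa> * cos \<psi> * (cosh \<xi> - 1))"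
    using k angle by (intro mult_strict_left_mono) (auto simp: algebra_simps)
  also have "\<dots> = \<kappa> * ((tan \<phi> * cos \<psi>) * (cosh \<xi> - 1))" by simp
  also have "\<dots> \<le> \<kappa> * (sin \<psi> * \<bar>sinh \<xi>\<bar>)"
    using k sc t sin cosh_real_ge_1[of \<xi>] by (intro mult_left_mono mult_mono) auto
  finally show ?thesis using k sin by (simp add: \<Omega>_def hyperbola_Re_Im abs_mult)
qed

text \<open>Two hyperbolas with the same asymptotic directions are compared through a primitive on \<open>\<Omega>\<close>; the chords
  joining corresponding points stay in one of the two half planes that make up \<open>\<Omega>\<close>.\<close>

lemma hyp_integral_deform:
  assumes psi: "\<phi> \<le> \<psi>" "\<psi> < pi / 2" and t: "t > 0"
    and k1: "\<kappa>1 > 0" "p1 + \<kappa>1 * cos \<psi> < \<rho>\<^sub>0" and k2: "\<kappa>2 > 0" "p2 + \<kappa>2 * cos \<psi> < \<rho>\<^sub>0"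
    and g: "g holomorphic_on \<Omega>" "\<And>z. z \<in> \<Omega> \<Longrightarrow> cmod (g z) \<le> C"
  shows "hyp_integral p1 \<kappa>1 \<psi> t (\<lambda>\<xi>. g (hyperbola p1 \<kappa>1 \<psi> \<xi>)) = hyp_integral p2 \<kappa>2 \<psi> t (\<lambda>\<xi>. g (hyperbola p2 \<kappa>2 \<psi> \<xi>))"
proof -
  let ?z1 = "hyperbola p1 \<kappa>1 \<psi>" and ?z2 = "hyperbola p2 \<kappa>2 \<psi>"
  have psi0: "0 < \<psi>" using psi angle by simp
  note z1 = hyperbola_in_\<Omega>[OF psi k1] and z2 = hyperbola_in_\<Omega>[OF psi k2]
  note cos_pos = cos_psi_pos[OF k1(1) psi0 psi(2) t]
  have C: "C \<ge> 0" using order_trans[OF norm_ge_zero g(2)[OF zero_in_\<Omega>]] .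
  have cont: "continuous_on UNIV (\<lambda>\<xi>. g (hyperbola p \<kappa> \<psi> \<xi>))"
    if "\<And>\<xi>. hyperbola p \<kappa> \<psi> \<xi> \<in> \<Omega>" for p \<kappa>
    by (rule continuous_on_compose2[OF holomorphic_on_imp_continuous_on[OF g(1)] hyperbola_continuous(1)]) (use that in auto)
  have int1: "(\<lambda>\<xi>. hyp_kernel p1 \<kappa>1 \<psi> t \<xi> *\<^sub>C g (?z1 \<xi>)) integrable_on UNIV"
    by (rule hyp_integrable[OF k1(1) psi0 psi(2) t cont, where n=0 and K=C]) (use z1 g in auto)
  have int2: "(\<lambda>\<xi>. hyp_kernel p2 \<kappa>2 \<psi> t \<xi> *\<^sub>C g (?z2 \<xi>)) integrable_on UNIV"
    by (rule hyp_integrable[OF k2(1) psi0 psi(2) t cont, where n=0 and K=C]) (use z2 g in auto)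
  have "(\<lambda>z. exp (- z * of_real t) * g z) holomorphic_on \<Omega>" by (intro holomorphic_intros g)
  then obtain G where G: "\<And>z. z \<in> \<Omega> \<Longrightarrow> (G has_field_derivative exp (- z * of_real t) * g z) (at z)"
    using open_starlike_primitive[OF open_\<Omega> starlike_\<Omega>] by blast
  have eq1: "integral {-n..n} (\<lambda>\<xi>. hyp_kernel p1 \<kappa>1 \<psi> t \<xi> *\<^sub>C g (?z1 \<xi>)) = G (?z1 n) - G (?z1 (- n))" if "n \<ge> 0" for n
    using has_integral_hyperbola_primitive[OF G z1, of "- n" n] that
    by (intro integral_unique) (simp add: hyp_kernel_def scaleC_complex_def mult_ac)
  have eq2: "integral {-n..n} (\<lambda>\<xi>. hyp_kernel p2 \<kappa>2 \<psi> t \<xi> *\<^sub>C g (?z2 \<xi>)) = G (?z2 n) - G (?z2 (- n))" if "n \<ge> 0" for n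
    using has_integral_hyperbola_primitive[OF G z2, of "- n" n] that
    by (intro integral_unique) (simp add: hyp_kernel_def scaleC_complex_def mult_ac)
  define P where "P = \<bar>p1\<bar> + \<bar>p2\<bar>"
  define c where "c = min \<kappa>1 \<kappa>2 * cos \<psi>"
  have c: "c > 0" using k1 k2 cos_pos by (simp add: c_def)
  have seg: "closed_segment (?z2 \<xi>) (?z1 \<xi>) \<subseteq> \<Omega>" if "\<xi> \<noteq> 0" for \<xi>
  proof -
    have sin: "sin \<psi> > 0" using psi psi0 by (intro sin_gt_zero) auto
    have conv: "convex {z. inner (Complex (- tan \<phi>) s) z > - tan \<phi> * \<rho>\<^sub>0}" for s by (rule convex_halfspace_gt)
    have sub: "{z. inner (Complex (- tan \<phi>) s) z > - tan \<phi> * \<rho>\<^sub>0} \<subseteq> \<Omega>" if "\<bar>s\<bar> = 1" for s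
      using that by (auto simp: \<Omega>_def inner_complex_def algebra_simps abs_if split: if_splits)
    define s where "s = (if \<xi> > 0 then - 1 else 1 :: real)"
    have mem: "hyperbola p \<kappa> \<psi> \<xi> \<in> {z. inner (Complex (- tan \<phi>) s) z > - tan \<phi> * \<rho>\<^sub>0}"
      if "hyperbola p \<kappa> \<psi> \<xi> \<in> \<Omega>" "\<kappa> > 0" for p \<kappa>
    proof -
      have "\<bar>Im (hyperbola p \<kappa> \<psi> \<xi>)\<bar> = s * Im (hyperbola p \<kappa> \<psi> \<xi>)"
        using \<open>\<xi> \<noteq> 0\<close> that(2) sin by (auto simp: hyperbola_Re_Im s_def abs_mult)
      then show ?thesis using that(1) by (simp add: \<Omega>_def inner_complex_def algebra_simps)
    qed
    show ?thesis
      by (rule order_trans[OF closed_segment_subset[OF mem[OF z2 k2(1)] mem[OF z1 k1(1)] conv] sub]) (simp add: s_def)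
  qed
  have bd: "cmod (G (?z1 \<xi>) - G (?z2 \<xi>)) \<le> (exp (t * P) * C * (P + \<kappa>1 + \<kappa>2)) * (cosh \<xi> ^ 1 * exp (- (t * c) * cosh \<xi>))"
    if xi: "\<xi> \<noteq> 0" for \<xi>
  proof -
    have 1: "- P + c * cosh \<xi> \<le> Re w" if "w \<in> closed_segment (?z2 \<xi>) (?z1 \<xi>)" for w
    proof (rule closed_segment_Re_ge[OF that])
      have "min \<kappa>1 \<kappa>2 * (cos \<psi> * cosh \<xi>) \<le> \<kappa> * (cos \<psi> * cosh \<xi>)" if "\<kappa> \<in> {\<kappa>1, \<kappa>2}" for \<kappa>
        using that cos_pos by (intro mult_right_mono) auto
      then show "- P + c * cosh \<xi> \<le> Re (?z2 \<xi>)" "- P + c * cosh \<xi> \<le> Re (?z1 \<xi>)"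
        by (auto simp: hyperbola_Re_Im P_def c_def mult.assoc intro!: add_mono)
    qed
    have "cmod (G (?z1 \<xi>) - G (?z2 \<xi>)) \<le> (exp (- t * (- P + c * cosh \<xi>)) * C) * cmod (?z1 \<xi> - ?z2 \<xi>)"
    proof (rule primitive_segment_bound[OF G seg[OF xi]])
      fix w assume w: "w \<in> closed_segment (?z2 \<xi>) (?z1 \<xi>)"
      show "cmod (exp (- w * of_real t) * g w) \<le> exp (- t * (- P + c * cosh \<xi>)) * C"
        unfolding norm_mult using mult_left_mono[OF 1[OF w], of t] seg[OF xi] w t C
        by (intro mult_mono g) (auto simp: algebra_simps)
    qed
    also have "\<dots> \<le> (exp (- t * (- P + c * cosh \<xi>)) * C) * ((P + \<kappa>1 + \<kappa>2) * cosh \<xi>)"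
    proof (rule mult_left_mono)
      have "cmod (?z1 \<xi> - ?z2 \<xi>) \<le> (\<bar>p1\<bar> + \<kappa>1 * cosh \<xi>) + (\<bar>p2\<bar> + \<kappa>2 * cosh \<xi>)"
        using hyperbola_bounds(1)[of \<kappa>1 p1] hyperbola_bounds(1)[of \<kappa>2 p2] k1 k2
        by (intro order_trans[OF norm_triangle_ineq4] add_mono) auto
      also have "\<dots> \<le> P * cosh \<xi> + \<kappa>1 * cosh \<xi> + \<kappa>2 * cosh \<xi>"
        using mult_left_mono[OF cosh_real_ge_1[of \<xi>], of P] by (simp add: P_def)
      finally show "cmod (?z1 \<xi> - ?z2 \<xi>) \<le> (P + \<kappa>1 + \<kappa>2) * cosh \<xi>" by (simp add: algebra_simps)
    qed (use C in simp)
    also have "exp (- t * (- P + c * cosh \<xi>)) = exp (t * P) * exp (- (t * c) * cosh \<xi>)"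
      by (simp add: exp_add[symmetric] algebra_simps)
    finally show ?thesis using C by (simp add: mult_ac)
  qed
  define d where "d \<xi> = G (?z1 \<xi>) - G (?z2 \<xi>)" for \<xi>
  let ?B = "\<lambda>\<xi>. (exp (t * P) * C * (P + \<kappa>1 + \<kappa>2)) * (cosh \<xi> ^ 1 * exp (- (t * c) * cosh \<xi>))"
  have limB: "(?B \<longlongrightarrow> 0) at_top" using t c by (intro tendsto_mult_right_zero cosh_exp_tendsto_0) simp
  have lim1: "(d \<longlongrightarrow> 0) at_top"
    by (rule Lim_null_comparison[OF _ limB], use eventually_gt_at_top[of 0] in eventually_elim)
       (unfold d_def, rule bd, simp)
  have lim2: "((\<lambda>n. d (- n)) \<longlongrightarrow> 0) at_top"
  proof (rule Lim_null_comparison[OF _ limB], use eventually_gt_at_top[of 0] in eventually_elim)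
    case (elim n) then show ?case using bd[of "- n"] by (simp add: d_def)
  qed
  have lim: "((\<lambda>n. d n - d (- n)) \<longlongrightarrow> 0) at_top" using tendsto_diff[OF lim1 lim2] by simp
  have "((\<lambda>n. integral {-n..n} (\<lambda>\<xi>. hyp_kernel p1 \<kappa>1 \<psi> t \<xi> *\<^sub>C g (?z1 \<xi>)) -
      integral {-n..n} (\<lambda>\<xi>. hyp_kernel p2 \<kappa>2 \<psi> t \<xi> *\<^sub>C g (?z2 \<xi>))) \<longlongrightarrow> 0) at_top"
    by (rule Lim_transform_eventually[OF lim], use eventually_gt_at_top[of 0] in eventually_elim)
       (simp add: eq1 eq2 d_def)
  moreover have "((\<lambda>n. integral {-n..n} (\<lambda>\<xi>. hyp_kernel p1 \<kappa>1 \<psi> t \<xi> *\<^sub>C g (?z1 \<xi>)) -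
      integral {-n..n} (\<lambda>\<xi>. hyp_kernel p2 \<kappa>2 \<psi> t \<xi> *\<^sub>C g (?z2 \<xi>))) \<longlongrightarrow>
      hyp_integral p1 \<kappa>1 \<psi> t (\<lambda>\<xi>. g (?z1 \<xi>)) - hyp_integral p2 \<kappa>2 \<psi> t (\<lambda>\<xi>. g (?z2 \<xi>))) at_top"
    unfolding hyp_integral_def by (intro tendsto_diff integral_UNIV_limit int1 int2)
  ultimately show ?thesis using tendsto_unique[OF trivial_limit_at_top_linorder] by fastforce
qed

end

section \<open>The semigroup as a contour integral\<close>

lemma has_vector_derivative_quotient_iff:
  "(f has_vector_derivative d) (at x within S) \<longleftrightarrow>
     ((\<lambda>y. (f y - f x) /\<^sub>R (y - x)) \<longlongrightarrow> d) (at x within S)"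
proof -
  have "(f has_vector_derivative d) (at x within S) \<longleftrightarrow>
      ((\<lambda>y. norm (f y - f x - (y - x) *\<^sub>R d) / norm (y - x)) \<longlongrightarrow> 0) (at x within S)"
    unfolding has_vector_derivative_def has_derivative_iff_norm by (simp add: bounded_linear_scaleR_left)
  also have "\<dots> \<longleftrightarrow> ((\<lambda>y. norm ((f y - f x) /\<^sub>R (y - x) - d)) \<longlongrightarrow> 0) (at x within S)"
  proof (rule tendsto_cong)
    show "\<forall>\<^sub>F y in at x within S. norm (f y - f x - (y - x) *\<^sub>R d) / norm (y - x) = norm ((f y - f x) /\<^sub>R (y - x) - d)"
      unfolding eventually_at_filter
    proof (rule always_eventually, intro allI impI)
      fix y assume y: "y \<noteq> x" "y \<in> S"
      have "norm (inverse (y - x) *\<^sub>R (f y - f x - (y - x) *\<^sub>R d)) = norm (f y - f x - (y - x) *\<^sub>R d) / norm (y - x)"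
        by (simp add: divide_inverse_commute)
      moreover have "inverse (y - x) *\<^sub>R (f y - f x - (y - x) *\<^sub>R d) = (f y - f x) /\<^sub>R (y - x) - d"
        using y by (simp add: scaleR_diff_right)
      ultimately show "norm (f y - f x - (y - x) *\<^sub>R d) / norm (y - x) = norm ((f y - f x) /\<^sub>R (y - x) - d)" by simp
    qed
  qed
  also have "\<dots> \<longleftrightarrow> ((\<lambda>y. (f y - f x) /\<^sub>R (y - x)) \<longlongrightarrow> d) (at x within S)"
    by (simp add: tendsto_norm_zero_iff LIM_zero_iff)
  finally show ?thesis .
qed

text \<open>The contour runs between the line \<open>Re z = r0\<close> and the sector: to its left the resolvent is holomorphic, to its right so are the
symbols by which the resolvent is multiplied.\<close>

locale sectorial_contour = sectorial_operator +
  fixes \<kappa> \<psi> r0 :: real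
  assumes psi: "\<phi> \<le> \<psi>" "\<psi> < pi / 2" and kappa: "\<kappa> > 0" "\<kappa> * cos \<psi> < \<rho>\<^sub>0"
    and r0: "0 < r0" "r0 < \<kappa> * cos \<psi>"
begin

abbreviation z :: "real \<Rightarrow> complex" where "z \<equiv> hyperbola 0 \<kappa> \<psi>"

lemma psi_pos: "0 < \<psi>" "0 < cos \<psi>" "0 < sin \<psi>" "cos \<psi> < 1"
proof -
  show *: "0 < \<psi>" using psi angle by simp
  show "0 < cos \<psi>" "0 < sin \<psi>" using * psi by (auto intro!: cos_gt_zero_pi sin_gt_zero)
  show "cos \<psi> < 1" using * psi cos_monotone_0_pi[of 0 \<psi>] by simp
qed

lemma z_in_\<Omega>: "z \<xi> \<in> \<Omega>"
  using psi kappa by (intro hyperbola_in_\<Omega>) auto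

lemma z_right: "r0 * cosh \<xi> < Re (z \<xi>)" "r0 < Re (z \<xi>)" "z \<xi> \<noteq> 0"
proof -
  show 1: "r0 * cosh \<xi> < Re (z \<xi>)" using r0 by (simp add: hyperbola_Re_Im)
  have "r0 * 1 \<le> r0 * cosh \<xi>" using r0 cosh_real_ge_1[of \<xi>] by (intro mult_left_mono) auto
  with 1 show 2: "r0 < Re (z \<xi>)" by linarith
  then show "z \<xi> \<noteq> 0" using r0 by auto
qed

text \<open>The contour integral with the symbol \<open>1\<close> is \<open>exp (- A t)\<close>; the symbol \<open>B\<^sup>-\<^sup>1(z)\<close> of the nonlocal condition
gives \<open>B\<^sup>-\<^sup>1 exp (- A t)\<close>.\<close>

definition symbol :: "(complex \<Rightarrow> complex) \<Rightarrow> real \<Rightarrow> bool" where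
  "symbol q Q \<longleftrightarrow> q holomorphic_on {z. r0 < Re z} \<and> (\<forall>z. r0 < Re z \<longrightarrow> cmod (q z) \<le> Q)"

definition contour_op :: "(complex \<Rightarrow> complex) \<Rightarrow> real \<Rightarrow> 'a \<Rightarrow> 'a" where
  "contour_op q t x = inverse (2 * of_real pi * \<i>) *\<^sub>C hyp_integral 0 \<kappa> \<psi> t (\<lambda>\<xi>. q (z \<xi>) *\<^sub>C R (z \<xi>) x)"

lemma symbol_1: "symbol (\<lambda>_. 1) 1" by (simp add: symbol_def)

lemma symbol_nonneg: "symbol q Q \<Longrightarrow> 0 \<le> Q"
  using z_right(2)[of 0] norm_ge_zero order_trans unfolding symbol_def by blast

lemma symbol_continuous: "symbol q Q \<Longrightarrow> continuous_on UNIV (\<lambda>\<xi>. q (z \<xi>))"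
  unfolding symbol_def
  by (rule continuous_on_compose2[OF holomorphic_on_imp_continuous_on hyperbola_continuous(1)]) (use z_right in auto)

lemma R_z_continuous: "continuous_on UNIV (\<lambda>\<xi>. R (z \<xi>) x)"
  by (rule continuous_on_compose2[OF R_continuous hyperbola_continuous(1)]) (use z_in_\<Omega> in auto)

lemma integrand_continuous: "symbol q Q \<Longrightarrow> continuous_on UNIV (\<lambda>\<xi>. q (z \<xi>) *\<^sub>C R (z \<xi>) x)"
  by (intro continuous_intros symbol_continuous R_z_continuous)

lemma integrand_bound:
  assumes "symbol q Q"
  shows "norm (q (z \<xi>) *\<^sub>C R (z \<xi>) x) \<le> (Q * (M * norm x)) * cosh \<xi> ^ 0"
  unfolding norm_scaleC using assms z_right z_in_\<Omega> R_bound' symbol_nonneg[OF assms]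
  by (auto simp: symbol_def intro!: mult_mono)

lemmas hyp_pos = kappa(1) psi_pos(1) psi(2)

lemma contour_integrable:
  assumes "symbol q Q" "t > 0"
  shows "(\<lambda>\<xi>. hyp_kernel 0 \<kappa> \<psi> t \<xi> *\<^sub>C (q (z \<xi>) *\<^sub>C R (z \<xi>) x)) integrable_on UNIV"
  by (rule hyp_integrable[OF hyp_pos assms(2) integrand_continuous[OF assms(1)] integrand_bound[OF assms(1)]])

lemma contour_op_apply:
  assumes q: "symbol q Q" "t > 0" and T: "bounded_linear T" "\<And>c x. T (c *\<^sub>C x) = c *\<^sub>C T x"
  shows "T (contour_op q t x) = inverse (2 * of_real pi * \<i>) *\<^sub>C hyp_integral 0 \<kappa> \<psi> t (\<lambda>\<xi>. q (z \<xi>) *\<^sub>C T (R (z \<xi>) x))"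
  unfolding contour_op_def T(2) by (subst hyp_integral_linear[OF contour_integrable[OF q] T]) (simp add: T(2))

lemma contour_op_R:
  assumes "symbol q Q" "t > 0" "w \<in> \<Omega>"
  shows "R w (contour_op q t x) = contour_op q t (R w x)"
  using contour_op_apply[OF assms(1,2) R_linear[OF assms(3)] R_scaleC[OF assms(3)]]
  by (simp add: contour_op_def R_commute[OF assms(3) z_in_\<Omega>])

lemma contour_op_linear:
  assumes q: "symbol q Q" "t > 0"
  shows "linear (contour_op q t)" "contour_op q t (c *\<^sub>C x) = c *\<^sub>C contour_op q t x"
proof -
  have add: "contour_op q t (x + y) = contour_op q t x + contour_op q t y" for x y
  proof -
    have "(\<lambda>\<xi>. hyp_kernel 0 \<kappa> \<psi> t \<xi> *\<^sub>C (q (z \<xi>) *\<^sub>C R (z \<xi>) (x + y))) =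
      (\<lambda>\<xi>. hyp_kernel 0 \<kappa> \<psi> t \<xi> *\<^sub>C (q (z \<xi>) *\<^sub>C R (z \<xi>) x) + hyp_kernel 0 \<kappa> \<psi> t \<xi> *\<^sub>C (q (z \<xi>) *\<^sub>C R (z \<xi>) y))"
      using linear_add[OF bounded_linear.linear[OF R_linear[OF z_in_\<Omega>]]] by (simp add: scaleC_add_right)
    then show ?thesis
      unfolding contour_op_def hyp_integral_def
      by (simp add: Henstock_Kurzweil_Integration.integral_add[OF contour_integrable[OF q] contour_integrable[OF q]] scaleC_add_right)
  qed
  have hom: "contour_op q t (c *\<^sub>C x) = c *\<^sub>C contour_op q t x" for c x
    using contour_op_apply[OF q scaleC.bounded_linear_right, of c x]
    by (simp add: contour_op_def R_scaleC[OF z_in_\<Omega>] scaleC_scaleC mult.commute)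
  show "linear (contour_op q t)"
    using add hom[of "of_real _"] by (intro linearI) (auto simp: scaleC_of_real)
  show "contour_op q t (c *\<^sub>C x) = c *\<^sub>C contour_op q t x" by (rule hom)
qed

lemma symbol_integral_zero:
  assumes q: "symbol q Q" and t: "t > 0"
  shows "(\<lambda>\<xi>. hyp_kernel 0 \<kappa> \<psi> t \<xi> *\<^sub>C q (z \<xi>) *\<^sub>C x) integrable_on UNIV"
    "hyp_integral 0 \<kappa> \<psi> t (\<lambda>\<xi>. q (z \<xi>) *\<^sub>C x) = 0"
proof -
  have bl: "bounded_linear (\<lambda>c. c *\<^sub>C x)" by (rule scaleC.bounded_linear_left)
  note zero = hyp_integral_right_zero[OF hyp_pos t, of q r0 Q 0]
  have int: "(\<lambda>\<xi>. hyp_kernel 0 \<kappa> \<psi> t \<xi> *\<^sub>C q (z \<xi>)) integrable_on UNIV"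
    using q r0 by (intro zero) (auto simp: symbol_def)
  show "(\<lambda>\<xi>. hyp_kernel 0 \<kappa> \<psi> t \<xi> *\<^sub>C q (z \<xi>) *\<^sub>C x) integrable_on UNIV"
    using integrable_linear[OF int bl] by (simp add: o_def scaleC_scaleC scaleC_complex_def)
  have "hyp_integral 0 \<kappa> \<psi> t (\<lambda>\<xi>. q (z \<xi>)) *\<^sub>C x = hyp_integral 0 \<kappa> \<psi> t (\<lambda>\<xi>. q (z \<xi>) *\<^sub>C x)"
    by (rule hyp_integral_linear[OF int bl]) (simp add: scaleC_scaleC scaleC_complex_def)
  moreover have "hyp_integral 0 \<kappa> \<psi> t (\<lambda>\<xi>. q (z \<xi>)) = 0"
    using q r0 by (intro zero) (auto simp: symbol_def)
  ultimately show "hyp_integral 0 \<kappa> \<psi> t (\<lambda>\<xi>. q (z \<xi>) *\<^sub>C x) = 0" by simp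
qed

text \<open>Since \<open>R z x = R 0 (x - z R z x)\<close>, the bounded operator \<open>R 0\<close> factors out of the integral, which therefore lies in the
  domain; the contribution of \<open>x\<close> vanishes because the contour can be closed to the right.\<close>

lemma contour_op_generator:
  assumes q: "symbol q Q" and t: "t > 0"
  shows "contour_op q t x \<in> D"
    "A (contour_op q t x) = inverse (2 * of_real pi * \<i>) *\<^sub>C hyp_integral 0 \<kappa> \<psi> t (\<lambda>\<xi>. z \<xi> *\<^sub>C (q (z \<xi>) *\<^sub>C R (z \<xi>) x))"
proof -
  let ?g = "\<lambda>\<xi>. z \<xi> *\<^sub>C (q (z \<xi>) *\<^sub>C R (z \<xi>) x)"
  let ?I = "hyp_integral 0 \<kappa> \<psi> t ?g"
  have Q: "0 \<le> Q" by (rule symbol_nonneg[OF q])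
  have "continuous_on UNIV ?g"
    by (intro continuous_intros hyperbola_continuous symbol_continuous[OF q] R_z_continuous)
  moreover have "norm (?g \<xi>) \<le> (\<kappa> * (Q * (M * norm x))) * cosh \<xi> ^ 1" for \<xi>
  proof -
    have "norm (?g \<xi>) \<le> (\<kappa> * cosh \<xi>) * ((Q * (M * norm x)) * cosh \<xi> ^ 0)"
      unfolding norm_scaleC[of "z \<xi>"] using hyperbola_bounds(1)[of \<kappa> 0] kappa
      by (intro mult_mono integrand_bound[OF q]) auto
    then show ?thesis by (simp add: mult_ac)
  qed
  ultimately have int: "(\<lambda>\<xi>. hyp_kernel 0 \<kappa> \<psi> t \<xi> *\<^sub>C ?g \<xi>) integrable_on UNIV"
    by (rule hyp_integrable[OF hyp_pos t])
  have eqi: "(\<lambda>\<xi>. hyp_kernel 0 \<kappa> \<psi> t \<xi> *\<^sub>C (q (z \<xi>) *\<^sub>C x - ?g \<xi>)) =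
     (\<lambda>\<xi>. hyp_kernel 0 \<kappa> \<psi> t \<xi> *\<^sub>C q (z \<xi>) *\<^sub>C x - hyp_kernel 0 \<kappa> \<psi> t \<xi> *\<^sub>C ?g \<xi>)"
    by (simp add: scaleC.diff_right)
  have int': "(\<lambda>\<xi>. hyp_kernel 0 \<kappa> \<psi> t \<xi> *\<^sub>C (q (z \<xi>) *\<^sub>C x - ?g \<xi>)) integrable_on UNIV"
    unfolding eqi by (rule integrable_diff[OF symbol_integral_zero(1)[OF q t] int])
  have I: "hyp_integral 0 \<kappa> \<psi> t (\<lambda>\<xi>. q (z \<xi>) *\<^sub>C x - ?g \<xi>) = - ?I"
    unfolding hyp_integral_def eqi
    using Henstock_Kurzweil_Integration.integral_diff[OF symbol_integral_zero(1)[OF q t] int]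
      symbol_integral_zero(2)[OF q t, of x] by (simp add: hyp_integral_def)
  have "R 0 (q (z \<xi>) *\<^sub>C x - ?g \<xi>) = q (z \<xi>) *\<^sub>C R (z \<xi>) x" for \<xi>
  proof -
    have eq: "R (z \<xi>) x = R 0 x - z \<xi> *\<^sub>C R 0 (R (z \<xi>) x)"
      using resolvent_identity[OF zero_in_\<Omega> z_in_\<Omega>, of x \<xi>] by (simp add: algebra_simps)
    have "q (z \<xi>) *\<^sub>C R (z \<xi>) x = q (z \<xi>) *\<^sub>C (R 0 x - z \<xi> *\<^sub>C R 0 (R (z \<xi>) x))"
      by (rule arg_cong[OF eq])
    then have "q (z \<xi>) *\<^sub>C R (z \<xi>) x = q (z \<xi>) *\<^sub>C R 0 x - (z \<xi> * q (z \<xi>)) *\<^sub>C R 0 (R (z \<xi>) x)"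
      by (simp only: scaleC.diff_right scaleC_scaleC mult.commute)
    moreover have "R 0 (q (z \<xi>) *\<^sub>C x - ?g \<xi>) = q (z \<xi>) *\<^sub>C R 0 x - (z \<xi> * q (z \<xi>)) *\<^sub>C R 0 (R (z \<xi>) x)"
      using linear_diff[OF bounded_linear.linear[OF R_linear[OF zero_in_\<Omega>]]]
      by (simp add: R_scaleC[OF zero_in_\<Omega>] scaleC_scaleC)
    ultimately show ?thesis by (simp only:)
  qed
  then have "hyp_integral 0 \<kappa> \<psi> t (\<lambda>\<xi>. q (z \<xi>) *\<^sub>C R (z \<xi>) x) = R 0 (- ?I)"
    using hyp_integral_linear[OF int' R_linear[OF zero_in_\<Omega>] R_scaleC[OF zero_in_\<Omega>]] by (simp add: I)
  then have eq: "contour_op q t x = inverse (2 * of_real pi * \<i>) *\<^sub>C R 0 (- ?I)" by (simp add: contour_op_def)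
  show "contour_op q t x \<in> D" unfolding eq by (intro domain_linear R_in_D zero_in_\<Omega>)
  show "A (contour_op q t x) = inverse (2 * of_real pi * \<i>) *\<^sub>C ?I"
    unfolding eq by (subst domain_linear(5)[OF R_in_D[OF zero_in_\<Omega>]]) (simp add: A_R[OF zero_in_\<Omega>])
qed

lemma contour_op_derivative:
  assumes q: "symbol q Q" and t: "t > 0"
  shows "((\<lambda>t. contour_op q t x) has_vector_derivative - A (contour_op q t x)) (at t)"
proof -
  interpret bl: bounded_linear "\<lambda>y::'a. inverse (2 * of_real pi * \<i>) *\<^sub>C y" by (rule scaleC.bounded_linear_right)
  show ?thesis
    using bl.has_vector_derivative[OF hyp_integral_derivative[OF hyp_pos t integrand_continuous[OF q] integrand_bound[OF q]], of x]
    unfolding contour_op_generator(2)[OF q t] unfolding contour_op_def by (simp only: scaleC.minus_right)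
qed

lemma contour_op_A:
  assumes q: "symbol q Q" and t: "t > 0" and x: "x \<in> D"
  shows "A (contour_op q t x) = contour_op q t (A x)"
proof -
  have "x = R 0 (- A x)"
    using R_A[OF zero_in_\<Omega> x] linear_neg[OF bounded_linear.linear[OF R_linear[OF zero_in_\<Omega>]]] by simp
  then have "contour_op q t x = R 0 (contour_op q t (- A x))"
    using contour_op_R[OF q t zero_in_\<Omega>] by metis
  then have "A (contour_op q t x) = - contour_op q t (- A x)"
    by (simp add: A_R[OF zero_in_\<Omega>])
  then show ?thesis using linear_neg[OF contour_op_linear(1)[OF q t]] by simp
qed

text \<open>Near \<open>t = 0\<close> the fixed contour gives no uniform bound.  Deforming it to the hyperbola of size \<open>1/t\<close> around the origin
  makes the factor \<open>exp (- z t)\<close> independent of \<open>t\<close>.\<close>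

lemma contour_op_scaled:
  assumes t: "t > 0"
  shows "contour_op (\<lambda>_. 1) t x = inverse (2 * of_real pi * \<i>) *\<^sub>C
            hyp_integral (- (1/t)) (1/t) \<psi> t (\<lambda>\<xi>. R (hyperbola (- (1/t)) (1/t) \<psi> \<xi>) x)"
    "\<And>\<xi>. hyperbola (- (1/t)) (1/t) \<psi> \<xi> \<in> \<Omega>"
    "(\<lambda>\<xi>. hyp_kernel (- (1/t)) (1/t) \<psi> t \<xi> *\<^sub>C R (hyperbola (- (1/t)) (1/t) \<psi> \<xi>) x) integrable_on UNIV"
proof -
  let ?w = "hyperbola (- (1/t)) (1/t) \<psi>"
  have s: "1/t > 0" "- (1/t) + 1/t * cos \<psi> < \<rho>\<^sub>0"
  proof -
    have "1/t * cos \<psi> < 1/t * 1" using t psi_pos by (intro mult_strict_left_mono) auto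
    then show "- (1/t) + 1/t * cos \<psi> < \<rho>\<^sub>0" using angle by simp
  qed (use t in simp)
  show w: "?w \<xi> \<in> \<Omega>" for \<xi> by (rule hyperbola_in_\<Omega>[OF psi s])
  have cont: "continuous_on UNIV (\<lambda>\<xi>. R (?w \<xi>) x)"
    by (rule continuous_on_compose2[OF R_continuous hyperbola_continuous(1)]) (use w in auto)
  show int: "(\<lambda>\<xi>. hyp_kernel (- (1/t)) (1/t) \<psi> t \<xi> *\<^sub>C R (?w \<xi>) x) integrable_on UNIV"
    by (rule hyp_integrable[OF s(1) psi_pos(1) psi(2) t cont, where n=0 and K="M * norm x"]) (use R_bound' w in auto)
  show "contour_op (\<lambda>_. 1) t x = inverse (2 * of_real pi * \<i>) *\<^sub>C hyp_integral (- (1/t)) (1/t) \<psi> t (\<lambda>\<xi>. R (?w \<xi>) x)"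
  proof (rule eq_functionals)
    fix l :: "'a \<Rightarrow> complex" assume l: "contractive_functional l"
    note lD = contractive_functionalD[OF l]
    have lC: "l (c *\<^sub>C y) = c *\<^sub>C l y" for c y by (simp add: lD scaleC_complex_def)
    have "hyp_integral 0 \<kappa> \<psi> t (\<lambda>\<xi>. l (R (z \<xi>) x)) = hyp_integral (- (1/t)) (1/t) \<psi> t (\<lambda>\<xi>. l (R (?w \<xi>) x))"
      by (rule hyp_integral_deform[OF psi t kappa(1) _ s R_holomorphic[OF l]])
         (use kappa order_trans[OF lD(3) R_bound'] in auto)
    then show "l (contour_op (\<lambda>_. 1) t x) = l (inverse (2 * of_real pi * \<i>) *\<^sub>C hyp_integral (- (1/t)) (1/t) \<psi> t (\<lambda>\<xi>. R (?w \<xi>) x))"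
      using contour_op_apply[OF symbol_1 t lD(4) lC, of x] hyp_integral_linear[OF int lD(4) lC]
      by (simp add: lC)
  qed
qed

lemma hyp_kernel_scaled_decay:
  obtains C where "C \<ge> 0"
    "\<And>t \<xi>. t > 0 \<Longrightarrow> cmod (hyp_kernel (- (1/t)) (1/t) \<psi> t \<xi>) \<le> (1 / t) * (C * exp (- 1 * \<bar>\<xi>\<bar>))"
    "\<And>t \<xi>. t > 0 \<Longrightarrow> inverse (cmod (hyperbola (- (1/t)) (1/t) \<psi> \<xi>)) \<le> C * t"
proof -
  obtain C where C: "C \<ge> 0" "\<And>\<xi>. cmod (hyp_kernel (-1) 1 \<psi> 1 \<xi>) * cosh \<xi> ^ 0 \<le> C * exp (- 1 * \<bar>\<xi>\<bar>)"
    using hyp_kernel_decay[where \<kappa>=1 and \<psi>=\<psi> and t=1 and p="-1" and n=0] psi_pos psi by auto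
  let ?C = "max C (1 / (1 - cos \<psi>))"
  show thesis
  proof (rule that[of ?C])
    show "?C \<ge> 0" using C by simp
    fix t \<xi> :: real assume t: "t > 0"
    have "hyp_kernel (- (1/t)) (1/t) \<psi> t \<xi> = of_real (1/t) * hyp_kernel (-1) 1 \<psi> 1 \<xi>"
      using hyp_kernel_scale[of "1/t" \<psi> \<xi>] t by simp
    then have "cmod (hyp_kernel (- (1/t)) (1/t) \<psi> t \<xi>) = (1/t) * cmod (hyp_kernel (-1) 1 \<psi> 1 \<xi>)"
      using t by (simp add: norm_mult norm_divide)
    also have "\<dots> \<le> (1/t) * (?C * exp (- 1 * \<bar>\<xi>\<bar>))"
    proof (rule mult_left_mono)
      have "C * exp (- 1 * \<bar>\<xi>\<bar>) \<le> ?C * exp (- 1 * \<bar>\<xi>\<bar>)" by (rule mult_right_mono) auto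
      then show "cmod (hyp_kernel (-1) 1 \<psi> 1 \<xi>) \<le> ?C * exp (- 1 * \<bar>\<xi>\<bar>)"
        using order_trans[OF C(2)[of \<xi>]] by (simp only: power_0 mult_1_right)
    qed (use t in simp)
    finally show "cmod (hyp_kernel (- (1/t)) (1/t) \<psi> t \<xi>) \<le> (1/t) * (?C * exp (- 1 * \<bar>\<xi>\<bar>))" .
    have "inverse (cmod (hyperbola (- (1/t)) (1/t) \<psi> \<xi>)) \<le> inverse ((1/t) * (1 - cos \<psi>))"
      using hyperbola_left_bound[of "1/t" \<psi> \<xi>] t psi_pos by (intro le_imp_inverse_le) auto
    also have "\<dots> = (1 / (1 - cos \<psi>)) * t" by (simp add: field_simps)
    also have "\<dots> \<le> ?C * t" using t by (intro mult_right_mono) auto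
    finally show "inverse (cmod (hyperbola (- (1/t)) (1/t) \<psi> \<xi>)) \<le> ?C * t" .
  qed
qed

lemma scaled_nonzero:
  assumes "t > 0" shows "hyperbola (- (1/t)) (1/t) \<psi> \<xi> \<noteq> 0"
proof -
  have "0 < 1/t * (1 - cos \<psi>)" using assms psi_pos by simp
  also have "\<dots> \<le> cmod (hyperbola (- (1/t)) (1/t) \<psi> \<xi>)"
    using assms by (intro hyperbola_left_bound) simp
  finally show ?thesis by auto
qed

lemma R_bound_inverse:
  assumes "w \<in> \<Omega>" "w \<noteq> 0" shows "norm (R w x) \<le> M * inverse (cmod w) * norm x"
proof -
  have "M / (1 + cmod w) \<le> M * inverse (cmod w)"
    unfolding divide_inverse using M_pos assms(2) by (intro mult_left_mono le_imp_inverse_le) auto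
  then show ?thesis by (rule order_trans[OF R_bound[OF assms(1)] mult_right_mono]) simp
qed

lemma norm_inverse_2_pi: "cmod (inverse (2 * of_real pi * \<i>)) = 1 / (2 * pi)"
  by (simp add: norm_divide norm_mult inverse_eq_divide)

lemma contour_op_uniform_bound:
  obtains K where "K \<ge> 1" "\<And>t x. t > 0 \<Longrightarrow> norm (contour_op (\<lambda>_. 1) t x) \<le> K * norm x"
proof -
  obtain C where C: "C \<ge> 0" "\<And>t \<xi>. t > 0 \<Longrightarrow> cmod (hyp_kernel (- (1/t)) (1/t) \<psi> t \<xi>) \<le> (1 / t) * (C * exp (- 1 * \<bar>\<xi>\<bar>))"
    "\<And>t \<xi>. t > 0 \<Longrightarrow> inverse (cmod (hyperbola (- (1/t)) (1/t) \<psi> \<xi>)) \<le> C * t"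
    using hyp_kernel_scaled_decay by blast
  let ?K = "1 / (2 * pi) * (C * (M * C) * (2 / 1))"
  have "norm (contour_op (\<lambda>_. 1) t x) \<le> max 1 ?K * norm x" if t: "t > 0" for t x
  proof -
    let ?w = "hyperbola (- (1/t)) (1/t) \<psi>"
    note sc = contour_op_scaled(1,3)[OF t, of x]
    have cont: "continuous_on UNIV (\<lambda>\<xi>. hyp_kernel (- (1/t)) (1/t) \<psi> t \<xi> *\<^sub>C R (?w \<xi>) x)"
      unfolding hyp_kernel_def
      by (intro continuous_intros hyperbola_continuous continuous_on_compose2[OF R_continuous hyperbola_continuous(1)])
         (use contour_op_scaled(2)[OF t] in auto)
    have bd: "norm (hyp_kernel (- (1/t)) (1/t) \<psi> t \<xi> *\<^sub>C R (?w \<xi>) x) \<le> (C * (M * C) * norm x) * exp (- 1 * \<bar>\<xi>\<bar>)" for \<xi>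
    proof -
      have "M * inverse (cmod (?w \<xi>)) \<le> M * (C * t)" using C(3)[OF t] M_pos by (intro mult_left_mono) auto
      then have "norm (R (?w \<xi>) x) \<le> M * (C * t) * norm x"
        by (rule order_trans[OF R_bound_inverse[OF contour_op_scaled(2)[OF t] scaled_nonzero[OF t]] mult_right_mono]) simp
      then have "norm (hyp_kernel (- (1/t)) (1/t) \<psi> t \<xi> *\<^sub>C R (?w \<xi>) x) \<le>
          ((1 / t) * (C * exp (- 1 * \<bar>\<xi>\<bar>))) * (M * (C * t) * norm x)"
        unfolding norm_scaleC using C(1) t by (intro mult_mono C(2)) auto
      then show ?thesis using t by (simp add: mult_ac)
    qed
    have "norm (hyp_integral (- (1/t)) (1/t) \<psi> t (\<lambda>\<xi>. R (?w \<xi>) x)) \<le> (C * (M * C) * norm x) * (2 / 1)"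
      unfolding hyp_integral_def by (rule integrable_UNIV_exp_bound(2)[OF cont _ bd]) simp
    then have "norm (contour_op (\<lambda>_. 1) t x) \<le> 1 / (2 * pi) * ((C * (M * C) * norm x) * (2 / 1))"
      unfolding sc(1) norm_scaleC norm_inverse_2_pi by (intro mult_left_mono) auto
    also have "\<dots> = ?K * norm x" by (simp add: mult_ac)
    also have "\<dots> \<le> max 1 ?K * norm x" by (intro mult_right_mono) auto
    finally show ?thesis .
  qed
  then show thesis using that[of "max 1 ?K"] by simp
qed

text \<open>By the residue of \<open>1/z\<close> the vector \<open>x\<close> is \<open>1 / (2 \<pi> \<i>)\<close> times the integral of \<open>exp (- z t) x / z\<close> over the hyperbola of size \<open>1/t\<close>.  For \<open>x\<close> in the domain the
difference \<open>R z x - x / z = R z (A x) / z\<close> is of order \<open>1 / \<bar>z\<bar>\<^sup>2\<close>, hence of order \<open>t\<^sup>2\<close> on that contour, whose length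
element is of order \<open>1/t\<close>.\<close>

lemma contour_op_near_0:
  obtains K where "K \<ge> 0" "\<And>t x. t > 0 \<Longrightarrow> x \<in> D \<Longrightarrow> norm (contour_op (\<lambda>_. 1) t x - x) \<le> K * t * norm (A x)"
proof -
  obtain C where C: "C \<ge> 0" "\<And>t \<xi>. t > 0 \<Longrightarrow> cmod (hyp_kernel (- (1/t)) (1/t) \<psi> t \<xi>) \<le> (1 / t) * (C * exp (- 1 * \<bar>\<xi>\<bar>))"
    "\<And>t \<xi>. t > 0 \<Longrightarrow> inverse (cmod (hyperbola (- (1/t)) (1/t) \<psi> \<xi>)) \<le> C * t"
    using hyp_kernel_scaled_decay by blast
  let ?K = "1 / (2 * pi) * (C * (C * (M * C)) * (2 / 1))"
  have "norm (contour_op (\<lambda>_. 1) t x - x) \<le> ?K * t * norm (A x)" if t: "t > 0" and x: "x \<in> D" for t x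
  proof -
    let ?w = "hyperbola (- (1/t)) (1/t) \<psi>"
    let ?k = "hyp_kernel (- (1/t)) (1/t) \<psi> t"
    note sc = contour_op_scaled(1,3)[OF t, of x]
    have s: "1/t > 0" using t by simp
    have w0: "?w \<xi> \<noteq> 0" for \<xi> by (rule scaled_nonzero[OF t])
    have bl: "bounded_linear (\<lambda>c. c *\<^sub>C x)" by (rule scaleC.bounded_linear_left)
    have int0: "(\<lambda>\<xi>. ?k \<xi> *\<^sub>C inverse (?w \<xi>)) integrable_on UNIV"
    proof (rule hyp_integrable[OF s psi_pos(1) psi(2) t, where n=0 and K="C * t"])
      show "continuous_on UNIV (\<lambda>\<xi>. inverse (?w \<xi>))" using w0 by (intro continuous_intros hyperbola_continuous) auto
    qed (use C(3)[OF t] in \<open>auto simp: norm_inverse\<close>)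
    have int: "(\<lambda>\<xi>. ?k \<xi> *\<^sub>C inverse (?w \<xi>) *\<^sub>C x) integrable_on UNIV"
      using integrable_linear[OF int0 bl] by (simp add: o_def scaleC_scaleC scaleC_complex_def)
    have "hyp_integral (- (1/t)) (1/t) \<psi> t (\<lambda>\<xi>. inverse (?w \<xi>) *\<^sub>C x) = (2 * of_real pi * \<i>) *\<^sub>C x"
      using hyp_integral_linear[OF int0 bl] hyp_integral_inverse[OF psi_pos(1) psi(2) s] t
      by (simp add: scaleC_scaleC scaleC_complex_def)
    then have xi: "x = inverse (2 * of_real pi * \<i>) *\<^sub>C hyp_integral (- (1/t)) (1/t) \<psi> t (\<lambda>\<xi>. inverse (?w \<xi>) *\<^sub>C x)"
      using scaleC_inverse_cancel[of "2 * of_real pi * \<i>" x] by simp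
    have diff: "?k \<xi> *\<^sub>C R (?w \<xi>) x - ?k \<xi> *\<^sub>C inverse (?w \<xi>) *\<^sub>C x = ?k \<xi> *\<^sub>C inverse (?w \<xi>) *\<^sub>C R (?w \<xi>) (A x)" for \<xi>
      using w0[of \<xi>] by (simp add: R_A[OF contour_op_scaled(2)[OF t] x] scaleC.diff_right scaleC_scaleC)
    have "contour_op (\<lambda>_. 1) t x - x = inverse (2 * of_real pi * \<i>) *\<^sub>C
        (integral UNIV (\<lambda>\<xi>. ?k \<xi> *\<^sub>C R (?w \<xi>) x) - integral UNIV (\<lambda>\<xi>. ?k \<xi> *\<^sub>C inverse (?w \<xi>) *\<^sub>C x))"
      by (subst (2) xi) (simp add: sc(1) hyp_integral_def scaleC.diff_right)
    also have "\<dots> = inverse (2 * of_real pi * \<i>) *\<^sub>C integral UNIV (\<lambda>\<xi>. ?k \<xi> *\<^sub>C inverse (?w \<xi>) *\<^sub>C R (?w \<xi>) (A x))"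
      by (simp only: Henstock_Kurzweil_Integration.integral_diff[OF sc(2) int, symmetric] diff)
    finally have eq: "contour_op (\<lambda>_. 1) t x - x = \<dots>" .
    have cont: "continuous_on UNIV (\<lambda>\<xi>. ?k \<xi> *\<^sub>C inverse (?w \<xi>) *\<^sub>C R (?w \<xi>) (A x))"
      unfolding hyp_kernel_def
      by (intro continuous_intros hyperbola_continuous continuous_on_compose2[OF R_continuous hyperbola_continuous(1)])
         (use contour_op_scaled(2)[OF t] w0 in auto)
    have bd: "norm (?k \<xi> *\<^sub>C inverse (?w \<xi>) *\<^sub>C R (?w \<xi>) (A x)) \<le> (t * (C * (C * (M * C))) * norm (A x)) * exp (- 1 * \<bar>\<xi>\<bar>)" for \<xi>
    proof -
      have "M * inverse (cmod (?w \<xi>)) \<le> M * (C * t)" using C(3)[OF t] M_pos by (intro mult_left_mono) auto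
      then have "norm (R (?w \<xi>) (A x)) \<le> M * (C * t) * norm (A x)"
        by (rule order_trans[OF R_bound_inverse[OF contour_op_scaled(2)[OF t] scaled_nonzero[OF t]] mult_right_mono]) simp
      then have "norm (?k \<xi> *\<^sub>C inverse (?w \<xi>) *\<^sub>C R (?w \<xi>) (A x)) \<le>
          ((1 / t) * (C * exp (- 1 * \<bar>\<xi>\<bar>))) * ((C * t) * (M * (C * t) * norm (A x)))"
        unfolding norm_scaleC norm_inverse using C(1) t by (intro mult_mono C(2,3)) (auto simp: M_pos intro!: mult_nonneg_nonneg)
      then show ?thesis using t by (simp add: mult_ac)
    qed
    have "norm (integral UNIV (\<lambda>\<xi>. ?k \<xi> *\<^sub>C inverse (?w \<xi>) *\<^sub>C R (?w \<xi>) (A x))) \<le> (t * (C * (C * (M * C))) * norm (A x)) * (2 / 1)"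
      by (rule integrable_UNIV_exp_bound(2)[OF cont _ bd]) simp
    then have "norm (contour_op (\<lambda>_. 1) t x - x) \<le> 1 / (2 * pi) * ((t * (C * (C * (M * C))) * norm (A x)) * (2 / 1))"
      unfolding eq norm_scaleC norm_inverse_2_pi by (intro mult_left_mono) auto
    then show ?thesis by (simp add: mult_ac)
  qed
  moreover have "?K \<ge> 0" using C M_pos by simp
  ultimately show thesis using that by blast
qed

end

lemma at_0_within_nonneg: "at (0::real) within {0..} = at_right 0"
proof -
  have "{0::real..} - {0} = {0<..} - {0}" by auto
  then show ?thesis by (simp add: at_within_def)
qed

text \<open>If no bound held near \<open>0\<close>, there would be \<open>t n\<close> tending to \<open>0\<close> with unbounded operators \<open>S (t n)\<close>; but these converge pointwise to the
identity.\<close>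

lemma C0_semigroup_locally_bounded:
  fixes S :: "real \<Rightarrow> 'a::complex_banach \<Rightarrow> 'a"
  assumes S: "C0_semigroup S"
  obtains \<delta> K where "\<delta> > 0" "\<And>t x. 0 \<le> t \<Longrightarrow> t \<le> \<delta> \<Longrightarrow> norm (S t x) \<le> K * norm x"
proof -
  have cl: "bounded_linear (S t)" if "t \<ge> 0" for t
    using S that by (auto simp: C0_semigroup_def bounded_clinear_def)
  have "\<exists>n::nat. \<forall>t x. 0 \<le> t \<longrightarrow> t \<le> inverse (Suc n) \<longrightarrow> norm (S t x) \<le> real n * norm x"
  proof (rule ccontr)
    assume "\<not> ?thesis"
    then have "\<forall>n::nat. \<exists>t. 0 \<le> t \<and> t \<le> inverse (Suc n) \<and> (\<exists>x. norm (S t x) > real n * norm x)"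
      by (meson not_le)
    then obtain t where t: "\<And>n. 0 \<le> t n" "\<And>n. t n \<le> inverse (real (Suc n))"
       "\<And>n. \<exists>x. norm (S (t n) x) > real n * norm x" by metis
    have t0: "t \<longlonglongrightarrow> 0"
      by (rule tendsto_sandwich[OF _ _ tendsto_const LIMSEQ_inverse_real_of_nat]) (use t in auto)
    have "\<exists>K. \<forall>T\<in>range (\<lambda>n. S (t n)). \<forall>x. norm (T x) \<le> K * norm x"
    proof (rule uniform_boundedness)
      show "bounded_linear T" if "T \<in> range (\<lambda>n. S (t n))" for T using that cl t by auto
      fix x :: 'a
      have "((\<lambda>s. S s x) \<longlongrightarrow> S 0 x) (at 0 within {0..})"
        using S by (simp add: C0_semigroup_def at_0_within_nonneg)
      then have "continuous (at 0 within {0..}) (\<lambda>s. S s x)" by (simp add: continuous_within)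
      then have "(\<lambda>n. S (t n) x) \<longlonglongrightarrow> S 0 x"
        using t t0 by (simp add: continuous_within_sequentially o_def)
      then have "Bseq (\<lambda>n. S (t n) x)" by (rule convergent_imp_Bseq[OF convergentI])
      then show "\<exists>b. \<forall>T\<in>range (\<lambda>n. S (t n)). norm (T x) \<le> b" by (auto simp: Bseq_def)
    qed
    then obtain K where K: "\<And>n x. norm (S (t n) x) \<le> K * norm x" by auto
    obtain n where n: "K \<le> real n" using real_arch_simple by blast
    obtain x where "norm (S (t n) x) > real n * norm x" using t(3) by blast
    moreover have "K * norm x \<le> real n * norm x" using n by (intro mult_right_mono) auto
    ultimately show False using K[of n x] by linarith
  qed
  then obtain n :: nat where "\<And>t x. 0 \<le> t \<Longrightarrow> t \<le> inverse (Suc n) \<Longrightarrow> norm (S t x) \<le> real n * norm x" by blast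
  moreover have "inverse (real (Suc n)) > 0" by simp
  ultimately show thesis by (rule that[rotated])
qed

context sectorial_contour
begin

text \<open>At \<open>t = 0\<close> the contour integral is no longer absolutely convergent; the value there is set to the identity.\<close>

definition sg :: "real \<Rightarrow> 'a \<Rightarrow> 'a" where
  "sg t x = (if t = 0 then x else contour_op (\<lambda>_. 1) t x)"

lemma sg_bounded:
  obtains K where "K \<ge> 1" "\<And>t x. t \<ge> 0 \<Longrightarrow> norm (sg t x) \<le> K * norm x"
proof -
  obtain K where K: "K \<ge> 1" "\<And>t x. t > 0 \<Longrightarrow> norm (contour_op (\<lambda>_. 1) t x) \<le> K * norm x"
    using contour_op_uniform_bound by blast
  show thesis
  proof (rule that[OF K(1)])
    fix t :: real and x assume t: "t \<ge> 0"
    show "norm (sg t x) \<le> K * norm x"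
      using K t mult_right_mono[OF K(1), of "norm x"] by (auto simp: sg_def)
  qed
qed

lemma sg_linear: "t \<ge> 0 \<Longrightarrow> linear (sg t)" "t \<ge> 0 \<Longrightarrow> sg t (c *\<^sub>C x) = c *\<^sub>C sg t x"
  using contour_op_linear[OF symbol_1, of t] by (auto simp: sg_def[abs_def] linear_iff)

lemma sg_bounded_linear: "t \<ge> 0 \<Longrightarrow> bounded_linear (sg t)"
proof -
  assume t: "t \<ge> 0"
  obtain K where K: "K \<ge> 1" "\<And>t x. t \<ge> 0 \<Longrightarrow> norm (sg t x) \<le> K * norm x" by (rule sg_bounded) (rule that)
  show ?thesis
    using sg_linear(1)[OF t] K(2)[OF t]
    by (intro bounded_linear_intro[where K=K]) (auto simp: linear_add linear_scale mult.commute)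
qed

lemma sg_R: "t \<ge> 0 \<Longrightarrow> w \<in> \<Omega> \<Longrightarrow> R w (sg t x) = sg t (R w x)"
  using contour_op_R[OF symbol_1] by (auto simp: sg_def)

lemma sg_domain: "t \<ge> 0 \<Longrightarrow> x \<in> D \<Longrightarrow> sg t x \<in> D" "t \<ge> 0 \<Longrightarrow> x \<in> D \<Longrightarrow> A (sg t x) = sg t (A x)"
  using contour_op_generator(1)[OF symbol_1] contour_op_A[OF symbol_1] by (auto simp: sg_def)

lemma sg_derivative:
  assumes "t > 0"
  shows "((\<lambda>t. sg t x) has_vector_derivative - A (sg t x)) (at t)" "sg t x \<in> D"
proof -
  have "((\<lambda>t. contour_op (\<lambda>_. 1) t x) has_vector_derivative - A (sg t x)) (at t)"
    using contour_op_derivative[OF symbol_1 assms] assms by (simp add: sg_def)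
  then show "((\<lambda>t. sg t x) has_vector_derivative - A (sg t x)) (at t)"
    by (rule has_vector_derivative_transform_within_open[of _ _ _ "{0<..}"]) (use assms in \<open>auto simp: sg_def\<close>)
  show "sg t x \<in> D" using contour_op_generator(1)[OF symbol_1 assms] assms by (simp add: sg_def)
qed

lemma sg_at_0: "((\<lambda>t. sg t x) \<longlongrightarrow> x) (at_right 0)"
proof (rule tendstoI)
  fix e :: real assume e: "e > 0"
  obtain K where K: "K \<ge> 1" "\<And>t x. t \<ge> 0 \<Longrightarrow> norm (sg t x) \<le> K * norm x" by (rule sg_bounded) (rule that)
  obtain K' where K': "K' \<ge> 0" "\<And>t x. t > 0 \<Longrightarrow> x \<in> D \<Longrightarrow> norm (contour_op (\<lambda>_. 1) t x - x) \<le> K' * t * norm (A x)"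
    using contour_op_near_0 by blast
  \<comment> \<open>on the domain the convergence is linear in \<open>t\<close>; the uniform bound extends it to the closure\<close>
  have "x \<in> closure D" using domain_linear(6) by simp
  then obtain y where y: "y \<in> D" "dist y x < e / (4 * K)"
    using closure_approachable[of x D] e K(1) by (metis divide_pos_pos less_le_trans mult_pos_pos zero_less_numeral zero_less_one)
  have "((\<lambda>t. K' * t * norm (A y)) \<longlongrightarrow> 0) (at_right 0)"
    by (auto intro!: tendsto_eq_intros)
  then have "\<forall>\<^sub>F t in at_right 0. K' * t * norm (A y) < e / 4"
    by (rule order_tendstoD) (use e in simp)
  moreover have "\<forall>\<^sub>F t in at_right 0. (t::real) > 0" by (rule eventually_at_right_less)
  ultimately show "\<forall>\<^sub>F t in at_right 0. dist (sg t x) x < e"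
  proof eventually_elim
    case (elim t)
    have xy: "norm (x - y) < e / (4 * K)" using y(2) by (simp add: dist_norm norm_minus_commute)
    have "norm (sg t (x - y)) \<le> K * (e / (4 * K))"
      using K(2)[of t "x - y"] elim xy K(1) mult_left_mono[of "norm (x - y)" "e / (4 * K)" K] by simp
    then have 1: "norm (sg t x - sg t y) \<le> e / 4"
      using K(1) elim linear_diff[OF sg_linear(1), of t x y] by simp
    have 2: "norm (sg t y - y) < e / 4" using K'(2)[OF _ y(1), of t] elim by (simp add: sg_def)
    have "e / (4 * K) \<le> e / 4" using e K(1) by (simp add: field_simps)
    then have 3: "norm (y - x) < e / 4" using xy by (simp add: norm_minus_commute)
    have "sg t x - x = (sg t x - sg t y) + ((sg t y - y) + (y - x))" by simp
    then have "norm (sg t x - x) \<le> norm (sg t x - sg t y) + (norm (sg t y - y) + norm (y - x))"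
      by (metis norm_triangle_mono norm_triangle_ineq order_refl)
    then show ?case using 1 2 3 e by (simp add: dist_norm)
  qed
qed

lemma sg_continuous: "continuous_on {0..} (\<lambda>t. sg t x)"
  unfolding continuous_on_eq_continuous_within
proof
  fix t :: real assume "t \<in> {0..}"
  then consider "t = 0" | "t > 0" by force
  then show "continuous (at t within {0..}) (\<lambda>t. sg t x)"
  proof cases
    case 1
    then show ?thesis using sg_at_0[of x] by (simp add: continuous_within at_0_within_nonneg sg_def)
  next
    case 2
    then show ?thesis
      using has_vector_derivative_continuous[OF sg_derivative(1)] continuous_at_imp_continuous_at_within by blast
  qed
qed

lemma sg_tendsto:
  assumes \<tau>: "(\<tau> \<longlongrightarrow> \<tau>0) F" "\<tau>0 \<ge> 0" "\<forall>\<^sub>F y in F. \<tau> y \<ge> 0" and u: "(u \<longlongrightarrow> u0) F"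
  shows "((\<lambda>y. sg (\<tau> y) (u y)) \<longlongrightarrow> sg \<tau>0 u0) F"
proof -
  obtain K where K: "K \<ge> 1" "\<And>t x. t \<ge> 0 \<Longrightarrow> norm (sg t x) \<le> K * norm x" by (rule sg_bounded) (rule that)
  have c: "((\<lambda>y. sg (\<tau> y) u0) \<longlongrightarrow> sg \<tau>0 u0) F"
    by (rule continuous_on_tendsto_compose[OF sg_continuous \<tau>(1)]) (use \<tau> in auto)
  have "((\<lambda>y. sg (\<tau> y) (u y) - sg (\<tau> y) u0) \<longlongrightarrow> 0) F"
  proof (rule Lim_null_comparison)
    show "\<forall>\<^sub>F y in F. norm (sg (\<tau> y) (u y) - sg (\<tau> y) u0) \<le> K * norm (u y - u0)"
      using \<tau>(3) by eventually_elim (metis K(2) linear_diff sg_linear(1))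
    show "((\<lambda>y. K * norm (u y - u0)) \<longlongrightarrow> 0) F"
      using u by (auto intro!: tendsto_eq_intros)
  qed
  then show ?thesis using tendsto_add[OF _ c] by fastforce
qed

text \<open>For a solution \<open>v\<close> of \<open>v' = - A v\<close> the function \<open>s \<mapsto> sg (t - s) (v s)\<close> has derivative zero.  This one uniqueness
  statement gives the semigroup law, the uniqueness of the generated semigroup, and the composition of the semigroup with
  every other contour integral.\<close>

lemma cauchy_problem_unique:
  assumes v0: "(v \<longlongrightarrow> v0) (at_right 0)"
    and v: "\<And>s. s > 0 \<Longrightarrow> v s \<in> D" "\<And>s. s > 0 \<Longrightarrow> (v has_vector_derivative - A (v s)) (at s)"
    and t: "t > 0"
  shows "v t = sg t v0"
proof -
  define w where "w s = sg (t - s) (if s = 0 then v0 else v s)" for s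
  have deriv: "(w has_vector_derivative 0) (at s)" if s: "0 < s" "s < t" for s
  proof -
    have ev0: "\<forall>\<^sub>F y in at s. y > 0 \<and> y < t"
      using eventually_at_in_open'[of "{0<..<t}" s] s by auto
    have 1: "((\<lambda>y. sg (t - y) ((v y - v s) /\<^sub>R (y - s))) \<longlongrightarrow> sg (t - s) (- A (v s))) (at s)"
    proof (rule sg_tendsto)
      show "((\<lambda>y. t - y) \<longlongrightarrow> t - s) (at s)" by (intro tendsto_intros)
      show "\<forall>\<^sub>F y in at s. t - y \<ge> 0" using ev0 by eventually_elim simp
      show "((\<lambda>y. (v y - v s) /\<^sub>R (y - s)) \<longlongrightarrow> - A (v s)) (at s)"
        using v(2)[OF s(1)] by (simp add: has_vector_derivative_quotient_iff)
    qed (use s in simp)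
    have "((\<lambda>y. sg (t - y) (v s)) has_vector_derivative (- 1) *\<^sub>R (- A (sg (t - s) (v s)))) (at s)"
    proof -
      have "((\<lambda>y. t - y) has_vector_derivative - 1) (at s)" by (auto intro!: derivative_eq_intros)
      from vector_diff_chain_at[OF this sg_derivative(1), of "v s"] s
      show ?thesis by (simp add: o_def)
    qed
    then have 2: "((\<lambda>y. (sg (t - y) (v s) - sg (t - s) (v s)) /\<^sub>R (y - s)) \<longlongrightarrow> A (sg (t - s) (v s))) (at s)"
      by (simp add: has_vector_derivative_quotient_iff)
    have "sg (t - s) (- A (v s)) + A (sg (t - s) (v s)) = 0"
      using s linear_neg[OF sg_linear(1), of "t - s" "A (v s)"] by (simp add: sg_domain(2) v(1))
    then have "((\<lambda>y. sg (t - y) ((v y - v s) /\<^sub>R (y - s)) + (sg (t - y) (v s) - sg (t - s) (v s)) /\<^sub>R (y - s)) \<longlongrightarrow> 0) (at s)"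
      using tendsto_add[OF 1 2] by simp
    then have "((\<lambda>y. (w y - w s) /\<^sub>R (y - s)) \<longlongrightarrow> 0) (at s)"
    proof (rule Lim_transform_eventually)
      show "\<forall>\<^sub>F y in at s. sg (t - y) ((v y - v s) /\<^sub>R (y - s)) + (sg (t - y) (v s) - sg (t - s) (v s)) /\<^sub>R (y - s) = (w y - w s) /\<^sub>R (y - s)"
        using ev0
      proof eventually_elim
        case (elim y)
        have l: "linear (sg (t - y))" using elim by (intro sg_linear) simp
        show ?case using elim s by (simp add: w_def linear_scale[OF l] linear_diff[OF l] scaleR_diff_right)
      qed
    qed
    then show ?thesis by (simp add: has_vector_derivative_quotient_iff)
  qed
  have cont: "continuous_on {0..t} w"
    unfolding continuous_on_eq_continuous_within
  proof
    fix s assume s: "s \<in> {0..t}"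
    have u: "((\<lambda>s. if s = 0 then v0 else v s) \<longlongrightarrow> (if s = 0 then v0 else v s)) (at s within {0..t})"
    proof (cases "s = 0")
      case True
      have "(v \<longlongrightarrow> v0) (at 0 within {0..t})"
        using v0 unfolding at_0_within_nonneg[symmetric] by (rule tendsto_within_subset) auto
      then have "((\<lambda>s. if s = 0 then v0 else v s) \<longlongrightarrow> v0) (at 0 within {0..t})"
        by (rule Lim_transform_eventually) (simp add: eventually_at_filter)
      then show ?thesis by (simp add: True)
    next
      case False
      then have "isCont v s" using s has_vector_derivative_continuous[OF v(2)] by simp
      then have "(v \<longlongrightarrow> v s) (at s)" by (simp add: isCont_def)
      then have "((\<lambda>s. if s = 0 then v0 else v s) \<longlongrightarrow> v s) (at s)"
        by (rule Lim_transform_within_open[of _ _ _ _ "{0<..}"]) (use s False in auto)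
      then show ?thesis using False by (simp add: tendsto_within_subset[OF _ subset_UNIV])
    qed
    show "continuous (at s within {0..t}) w"
      unfolding continuous_within w_def
      by (rule sg_tendsto[OF _ _ _ u]) (use s in \<open>auto intro!: tendsto_intros simp: eventually_at_filter\<close>)
  qed
  have "((\<lambda>_. 0) has_integral (w t - w 0)) {0..t}"
    by (rule fundamental_theorem_of_calculus_interior) (use t deriv cont in auto)
  then have "w t = w 0" using has_integral_unique[OF has_integral_0] by fastforce
  then show ?thesis using t by (simp add: w_def sg_def)
qed

text \<open>As a function of \<open>r\<close>, \<open>contour_op q (t + r) x\<close> solves \<open>v' = - A v\<close> with initial value \<open>contour_op q t x\<close>.\<close>

lemma sg_contour_op:
  assumes q: "symbol q Q" and t: "t > 0" and r: "r \<ge> 0"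
  shows "sg r (contour_op q t x) = contour_op q (t + r) x"
proof (cases "r = 0")
  case False
  have d: "((\<lambda>r. contour_op q (t + r) x) has_vector_derivative - A (contour_op q (t + r) x)) (at r)" if "t + r > 0" for r
  proof -
    have "((\<lambda>y. t + y) has_vector_derivative 1) (at r)" by (auto intro!: derivative_eq_intros)
    from vector_diff_chain_at[OF this contour_op_derivative[OF q that], of x]
    show ?thesis by (simp add: o_def)
  qed
  have "isCont (\<lambda>r. contour_op q (t + r) x) 0" using has_vector_derivative_continuous[OF d[of 0]] t by simp
  then have "((\<lambda>r. contour_op q (t + r) x) \<longlongrightarrow> contour_op q t x) (at_right 0)"
    by (simp add: isCont_def filterlim_at_split)
  then have "contour_op q (t + r) x = sg r (contour_op q t x)"
    by (rule cauchy_problem_unique) (use t r False d contour_op_generator(1)[OF q] in auto)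
  then show ?thesis by simp
qed (simp add: sg_def)

lemma sg_add:
  assumes "s \<ge> 0" "t \<ge> 0" shows "sg (s + t) x = sg s (sg t x)"
  using sg_contour_op[OF symbol_1, of t s x] assms by (cases "t = 0") (auto simp: sg_def add.commute)

lemma sg_right_derivative:
  assumes x: "x \<in> D"
  shows "((\<lambda>t. (sg t x - x) /\<^sub>R t) \<longlongrightarrow> - A x) (at_right 0)"
proof (rule tendstoI)
  fix e :: real assume e: "e > 0"
  have "\<forall>\<^sub>F s in at_right 0. dist (sg s (A x)) (A x) < e / 2"
    by (rule tendstoD[OF sg_at_0]) (use e in simp)
  then obtain b where b: "b > 0" "\<And>s. 0 < s \<Longrightarrow> s < b \<Longrightarrow> norm (sg s (A x) - A x) < e / 2"
    by (auto simp: eventually_at_right_field dist_norm)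
  show "\<forall>\<^sub>F t in at_right 0. dist ((sg t x - x) /\<^sub>R t) (- A x) < e"
    unfolding eventually_at_right_field
  proof (intro exI[of _ b] conjI allI impI b(1))
    fix t assume t: "0 < t" "t < b"
    have hi: "((\<lambda>s. - A (sg s x)) has_integral (sg t x - sg 0 x)) {0..t}"
      by (rule fundamental_theorem_of_calculus_interior)
         (use t sg_derivative in \<open>auto intro: continuous_on_subset[OF sg_continuous]\<close>)
    have "((\<lambda>s. A x) has_integral (t *\<^sub>R A x)) {0..t}"
      using has_integral_const_real[of "A x" 0 t] t by simp
    from has_integral_add[OF hi this]
    have hi2: "((\<lambda>s. - A (sg s x) + A x) has_integral (sg t x - x + t *\<^sub>R A x)) {0..t}" by (simp add: sg_def)
    have "norm (sg t x - x + t *\<^sub>R A x) \<le> (e / 2) * measure lborel {0..t}"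
    proof (rule has_integral_bound_real[OF _ finite.emptyI hi2])
      fix s assume "s \<in> {0..t} - {}"
      then consider "s = 0" | "0 < s" "s < b" using t by force
      then show "norm (- A (sg s x) + A x) \<le> e / 2"
      proof cases
        case 1 then show ?thesis using e by (simp add: sg_def)
      next
        case 2
        then have "norm (- A (sg s x) + A x) = norm (sg s (A x) - A x)"
          using sg_domain(2)[OF _ x, of s] by (simp add: norm_minus_commute)
        then show ?thesis using b(2)[OF 2] by simp
      qed
    qed (use e in auto)
    then have "norm (sg t x - x + t *\<^sub>R A x) / t \<le> e / 2" using t by (simp add: field_simps)
    moreover have "(sg t x - x) /\<^sub>R t - (- A x) = (sg t x - x + t *\<^sub>R A x) /\<^sub>R t"
      using t by (simp add: scaleR_add_right)
    moreover have "norm ((sg t x - x + t *\<^sub>R A x) /\<^sub>R t) = norm (sg t x - x + t *\<^sub>R A x) / t"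
      using t by (simp only: norm_scaleR abs_inverse abs_of_pos divide_inverse_commute)
    ultimately have "norm ((sg t x - x) /\<^sub>R t - (- A x)) \<le> e / 2" by (simp only:)
    then show "dist ((sg t x - x) /\<^sub>R t) (- A x) < e" using e by (simp add: dist_norm)
  qed
qed

text \<open>That no further \<open>x\<close> admits a right derivative \<open>y\<close> of its orbit at \<open>0\<close> is seen by applying \<open>R 0\<close>: the orbit of \<open>R 0 x\<close> has the derivatives
\<open>R 0 y\<close> and \<open>x\<close>, so \<open>x = R 0 y\<close> lies in the domain.\<close>

lemma generates_sg: "generates D (\<lambda>x. - A x) sg"
  unfolding generates_def
proof (intro conjI allI)
  show "C0_semigroup sg"
    unfolding C0_semigroup_def bounded_clinear_def
    using sg_bounded_linear sg_linear(2) sg_add sg_at_0 by (auto simp: sg_def[of 0] fun_eq_iff)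
  fix x y
  show "x \<in> D \<and> - A x = y \<longleftrightarrow> ((\<lambda>t. (sg t x - x) /\<^sub>R t) \<longlongrightarrow> y) (at_right 0)"
  proof
    assume "x \<in> D \<and> - A x = y"
    then show "((\<lambda>t. (sg t x - x) /\<^sub>R t) \<longlongrightarrow> y) (at_right 0)" using sg_right_derivative by blast
  next
    assume lim: "((\<lambda>t. (sg t x - x) /\<^sub>R t) \<longlongrightarrow> y) (at_right 0)"
    interpret R0: bounded_linear "R 0" by (rule R_linear[OF zero_in_\<Omega>])
    have "((\<lambda>t. R 0 ((sg t x - x) /\<^sub>R t)) \<longlongrightarrow> R 0 y) (at_right 0)" by (rule R0.tendsto[OF lim])
    moreover have "\<forall>\<^sub>F t in at_right 0. R 0 ((sg t x - x) /\<^sub>R t) = (sg t (R 0 x) - R 0 x) /\<^sub>R t"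
      using eventually_at_right_less[of 0]
      by eventually_elim (simp add: R0.scaleR R0.diff sg_R[OF _ zero_in_\<Omega>])
    ultimately have "((\<lambda>t. (sg t (R 0 x) - R 0 x) /\<^sub>R t) \<longlongrightarrow> R 0 y) (at_right 0)"
      by (rule Lim_transform_eventually)
    moreover have "((\<lambda>t. (sg t (R 0 x) - R 0 x) /\<^sub>R t) \<longlongrightarrow> x) (at_right 0)"
      using sg_right_derivative[OF R_in_D[OF zero_in_\<Omega>], of x] by (simp add: A_R[OF zero_in_\<Omega>])
    ultimately have x: "x = R 0 y" using tendsto_unique[OF trivial_limit_at_right_real] by blast
    then show "x \<in> D \<and> - A x = y" by (simp add: R_in_D[OF zero_in_\<Omega>] A_R[OF zero_in_\<Omega>])
  qed
qed

text \<open>Orbits of \<open>S\<close> starting in the domain solve \<open>v' = - A v\<close>.  The right derivative is immediate from the semigroup law; for the left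
derivative the quotients are transported by \<open>S (s - \<eta>)\<close>, which requires the bound of \<open>S\<close> near \<open>0\<close>.\<close>

lemma generates_unique:
  assumes gen: "generates D (\<lambda>x. - A x) S" and t: "t \<ge> 0"
  shows "S t x = sg t x"
proof (cases "t = 0")
  case True
  then show ?thesis using gen by (simp add: generates_def C0_semigroup_def sg_def)
next
  case False
  then have t: "t > 0" using t by simp
  have C0: "C0_semigroup S" and der: "\<And>x y. x \<in> D \<and> - A x = y \<longleftrightarrow> ((\<lambda>t. (S t x - x) /\<^sub>R t) \<longlongrightarrow> y) (at_right 0)"
    using gen by (auto simp: generates_def)
  have bl: "\<And>s. s \<ge> 0 \<Longrightarrow> bounded_linear (S s)" and add: "\<And>r s x. r \<ge> 0 \<Longrightarrow> s \<ge> 0 \<Longrightarrow> S (r + s) x = S r (S s x)"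
    and lim0: "\<And>x. ((\<lambda>t. S t x) \<longlongrightarrow> x) (at_right 0)"
    using C0 by (auto simp: C0_semigroup_def bounded_clinear_def)
  note lin = bounded_linear.linear[OF bl]
  obtain \<delta> K where \<delta>: "\<delta> > 0" "\<And>t x. 0 \<le> t \<Longrightarrow> t \<le> \<delta> \<Longrightarrow> norm (S t x) \<le> K * norm x"
    using C0_semigroup_locally_bounded[OF C0] by blast
  have eqD: "S t x = sg t x" if x: "x \<in> D" for x
  proof (rule cauchy_problem_unique[OF lim0 _ _ t])
    fix s :: real assume s: "s > 0"
    define u where "u \<eta> = (S \<eta> x - x) /\<^sub>R \<eta>" for \<eta>
    have u: "(u \<longlongrightarrow> - A x) (at_right 0)" unfolding u_def using der x by blast
    have right: "((\<lambda>\<eta>. S s (u \<eta>)) \<longlongrightarrow> S s (- A x)) (at_right 0)"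
      using s by (intro bounded_linear.tendsto[OF bl u]) simp
    have eq: "S s (u \<eta>) = (S (s + \<eta>) x - S s x) /\<^sub>R \<eta>" if "\<eta> > 0" for \<eta>
      using that s by (simp add: u_def linear_scale[OF lin] linear_diff[OF lin] add)
    have "((\<lambda>\<eta>. (S \<eta> (S s x) - S s x) /\<^sub>R \<eta>) \<longlongrightarrow> S s (- A x)) (at_right 0)"
      by (rule Lim_transform_eventually[OF right], use eventually_at_right_less[of 0] in eventually_elim)
         (use s add in \<open>simp add: eq add.commute[of s]\<close>)
    then have SD: "S s x \<in> D" "- A (S s x) = S s (- A x)" using der by blast+
    show "S s x \<in> D" by (rule SD)
    have R: "((\<lambda>y. (S y x - S s x) /\<^sub>R (y - s)) \<longlongrightarrow> S s (- A x)) (at_right s)"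
      unfolding filterlim_at_right_to_0[of _ _ s]
      by (rule Lim_transform_eventually[OF right], use eventually_at_right_less[of 0] in eventually_elim)
         (simp add: eq add.commute)
    define d where "d = min \<delta> s"
    have d: "d > 0" "d \<le> \<delta>" "d \<le> s" using \<delta> s by (auto simp: d_def)
    obtain K1 where K1: "\<And>y. norm (S (s - d) y) \<le> norm y * K1"
      using bounded_linear.bounded[OF bl[of "s - d"]] d by auto
    have K1': "norm (S (s - \<eta>) y) \<le> (\<bar>K1\<bar> * \<bar>K\<bar>) * norm y" if "0 \<le> \<eta>" "\<eta> \<le> d" for \<eta> y
    proof -
      have "S (s - \<eta>) y = S (s - d) (S (d - \<eta>) y)" using add[of "s - d" "d - \<eta>" y] d that by simp
      then have "norm (S (s - \<eta>) y) \<le> norm (S (d - \<eta>) y) * K1" using K1 by simp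
      also have "\<dots> \<le> norm (S (d - \<eta>) y) * \<bar>K1\<bar>" by (intro mult_left_mono) auto
      also have "\<dots> \<le> (\<bar>K\<bar> * norm y) * \<bar>K1\<bar>"
      proof (rule mult_right_mono)
        have "norm (S (d - \<eta>) y) \<le> K * norm y" using \<delta>(2)[of "d - \<eta>" y] that d by simp
        also have "\<dots> \<le> \<bar>K\<bar> * norm y" by (intro mult_right_mono) auto
        finally show "norm (S (d - \<eta>) y) \<le> \<bar>K\<bar> * norm y" .
      qed simp
      finally show ?thesis by (simp add: mult_ac)
    qed
    have evd: "\<forall>\<^sub>F \<eta> in at_right 0. 0 < \<eta> \<and> \<eta> < d"
      unfolding eventually_at_right_field by (rule exI[of _ d]) (use d in auto)
    have "((\<lambda>\<eta>. S (s - \<eta>) (u \<eta>) - S s (- A x)) \<longlongrightarrow> 0) (at_right 0)"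
    proof (rule Lim_null_comparison)
      let ?y = "- A x"
      show "((\<lambda>\<eta>. (\<bar>K1\<bar> * \<bar>K\<bar>) * (norm (u \<eta> - ?y) + norm (?y - S \<eta> ?y))) \<longlongrightarrow> 0) (at_right 0)"
      proof -
        have "((\<lambda>\<eta>. (\<bar>K1\<bar> * \<bar>K\<bar>) * (norm (u \<eta> - ?y) + norm (?y - S \<eta> ?y))) \<longlongrightarrow> (\<bar>K1\<bar> * \<bar>K\<bar>) * (norm (?y - ?y) + norm (?y - ?y))) (at_right 0)"
          by (intro tendsto_intros u lim0)
        then show ?thesis by simp
      qed
      show "\<forall>\<^sub>F \<eta> in at_right 0. norm (S (s - \<eta>) (u \<eta>) - S s ?y) \<le> (\<bar>K1\<bar> * \<bar>K\<bar>) * (norm (u \<eta> - ?y) + norm (?y - S \<eta> ?y))"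
        using evd
      proof eventually_elim
        case (elim \<eta>)
        have le: "linear (S (s - \<eta>))" using elim d by (intro lin) simp
        have "S s ?y = S (s - \<eta>) (S \<eta> ?y)" using add[of "s - \<eta>" \<eta> ?y] elim d by simp
        then have "S (s - \<eta>) (u \<eta>) - S s ?y = S (s - \<eta>) ((u \<eta> - ?y) + (?y - S \<eta> ?y))"
          by (simp add: linear_diff[OF le, symmetric])
        then have "norm (S (s - \<eta>) (u \<eta>) - S s ?y) \<le> (\<bar>K1\<bar> * \<bar>K\<bar>) * norm ((u \<eta> - ?y) + (?y - S \<eta> ?y))"
          using K1' elim by simp
        also have "\<dots> \<le> (\<bar>K1\<bar> * \<bar>K\<bar>) * (norm (u \<eta> - ?y) + norm (?y - S \<eta> ?y))"
          by (intro mult_left_mono norm_triangle_ineq) simp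
        finally show ?case .
      qed
    qed
    then have left: "((\<lambda>\<eta>. S (s - \<eta>) (u \<eta>)) \<longlongrightarrow> S s (- A x)) (at_right 0)" by (simp add: LIM_zero_iff)
    have L: "((\<lambda>y. (S y x - S s x) /\<^sub>R (y - s)) \<longlongrightarrow> S s (- A x)) (at_left s)"
      unfolding filterlim_at_left_to_right filterlim_at_right_to_0[of _ _ "- s"]
    proof (rule Lim_transform_eventually[OF left], use evd in eventually_elim)
      case (elim \<eta>)
      have le: "linear (S (s - \<eta>))" using elim d by (intro lin) simp
      have "S s x = S (s - \<eta>) (S \<eta> x)" using add[of "s - \<eta>" \<eta> x] elim d by simp
      then have "S (s - \<eta>) (u \<eta>) = (S s x - S (s - \<eta>) x) /\<^sub>R \<eta>"
        by (simp add: u_def linear_scale[OF le] linear_diff[OF le])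
      also have "\<dots> = (S (s - \<eta>) x - S s x) /\<^sub>R (- \<eta>)" by (simp add: scaleR_minus_left scaleR_diff_right)
      finally show ?case by simp
    qed
    show "((\<lambda>s. S s x) has_vector_derivative - A (S s x)) (at s)"
      unfolding has_vector_derivative_quotient_iff SD(2) using L R by (rule filterlim_split_at)
  qed
  have "closed {x. S t x = sg t x}"
    using t by (intro closed_Collect_eq linear_continuous_on bl sg_bounded_linear) auto
  then have "closure D \<subseteq> {x. S t x = sg t x}" by (intro closure_minimal) (use eqD in auto)
  then show ?thesis using domain_linear(6) by auto
qed

lemma semigroup_neg_eq: "t \<ge> 0 \<Longrightarrow> semigroup_neg D A t x = sg t x"
  unfolding semigroup_neg_def by (rule generates_unique[OF someI[of "generates D (\<lambda>x. - A x)"]]) (rule generates_sg)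

text \<open>The contour lies in \<open>Re z > r0\<close>, whence the decay for \<open>t \<ge> 1\<close>; for small \<open>t\<close> the uniform bound is enough.\<close>

lemma sg_exponential_bound:
  obtains K where "K \<ge> 1" "\<And>t x. t \<ge> 0 \<Longrightarrow> norm (sg t x) \<le> K * exp (- r0 * t) * norm x"
proof -
  obtain K0 where K0: "K0 \<ge> 1" "\<And>t x. t \<ge> 0 \<Longrightarrow> norm (sg t x) \<le> K0 * norm x" by (rule sg_bounded) (rule that)
  obtain C where C: "C \<ge> 0" "\<And>\<xi>. cmod (hyp_kernel 0 \<kappa> \<psi> 1 \<xi>) * cosh \<xi> ^ 0 \<le> C * exp (- 1 * \<bar>\<xi>\<bar>)"
    using hyp_kernel_decay[OF hyp_pos zero_less_one] by blast
  define K where "K = max (K0 * exp r0) (1 / (2 * pi) * (C * exp r0 * M * (2 / 1)))"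
  have KK: "K \<ge> 1"
  proof -
    have "1 * 1 \<le> K0 * exp r0" using K0(1) r0 by (intro mult_mono) auto
    then show ?thesis by (simp add: K_def le_max_iff_disj)
  qed
  have "norm (sg t x) \<le> K * exp (- r0 * t) * norm x" if t: "t \<ge> 0" for t x
  proof (cases "t \<le> 1")
    case True
    have "norm (sg t x) \<le> K0 * norm x" by (rule K0(2)[OF t])
    also have "\<dots> \<le> (K * exp (- r0 * t)) * norm x"
    proof (rule mult_right_mono)
      have "K0 * 1 \<le> K0 * (exp r0 * exp (- r0 * t))"
        using K0(1) True r0 mult_left_mono[of t 1 r0]
        by (intro mult_left_mono) (auto simp: exp_add[symmetric])
      also have "\<dots> \<le> K * exp (- r0 * t)" unfolding mult.assoc[symmetric] by (intro mult_right_mono) (auto simp: K_def)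
      finally show "K0 \<le> K * exp (- r0 * t)" by simp
    qed simp
    finally show ?thesis .
  next
    case False
    then have t1: "t > 1" by simp
    have cont: "continuous_on UNIV (\<lambda>\<xi>. hyp_kernel 0 \<kappa> \<psi> t \<xi> *\<^sub>C R (z \<xi>) x)"
      unfolding hyp_kernel_def by (intro continuous_intros hyperbola_continuous R_z_continuous)
    have bd: "norm (hyp_kernel 0 \<kappa> \<psi> t \<xi> *\<^sub>C R (z \<xi>) x) \<le> (C * exp (- r0 * (t - 1)) * (M * norm x)) * exp (- 1 * \<bar>\<xi>\<bar>)" for \<xi>
    proof -
      have "cmod (hyp_kernel 0 \<kappa> \<psi> t \<xi>) = exp (- (t - 1) * Re (z \<xi>)) * cmod (hyp_kernel 0 \<kappa> \<psi> 1 \<xi>)"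
        by (simp add: hyp_kernel_def norm_mult mult_exp_exp algebra_simps)
      also have "\<dots> \<le> exp (- r0 * (t - 1)) * (C * exp (- 1 * \<bar>\<xi>\<bar>))"
      proof (rule mult_mono)
        show "exp (- (t - 1) * Re (z \<xi>)) \<le> exp (- r0 * (t - 1))"
        proof -
          have "(t - 1) * r0 \<le> (t - 1) * Re (z \<xi>)"
            using z_right(2)[of \<xi>] t1 by (intro mult_left_mono) auto
          then show ?thesis by (simp add: algebra_simps)
        qed
        show "cmod (hyp_kernel 0 \<kappa> \<psi> 1 \<xi>) \<le> C * exp (- 1 * \<bar>\<xi>\<bar>)" using C(2)[of \<xi>] by (simp only: power_0 mult_1_right)
      qed auto
      finally have "norm (hyp_kernel 0 \<kappa> \<psi> t \<xi> *\<^sub>C R (z \<xi>) x) \<le> (exp (- r0 * (t - 1)) * (C * exp (- 1 * \<bar>\<xi>\<bar>))) * (M * norm x)"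
        unfolding norm_scaleC using C(1) by (intro mult_mono R_bound' z_in_\<Omega>) auto
      then show ?thesis by (simp add: mult_ac)
    qed
    have "norm (hyp_integral 0 \<kappa> \<psi> t (\<lambda>\<xi>. R (z \<xi>) x)) \<le> (C * exp (- r0 * (t - 1)) * (M * norm x)) * (2 / 1)"
      unfolding hyp_integral_def by (rule integrable_UNIV_exp_bound(2)[OF cont _ bd]) simp
    moreover have "sg t x = inverse (2 * of_real pi * \<i>) *\<^sub>C hyp_integral 0 \<kappa> \<psi> t (\<lambda>\<xi>. R (z \<xi>) x)"
      using t1 by (simp add: sg_def contour_op_def)
    ultimately have "norm (sg t x) \<le> 1 / (2 * pi) * ((C * exp (- r0 * (t - 1)) * (M * norm x)) * (2 / 1))"
      by (simp only: norm_scaleC norm_inverse_2_pi) (intro mult_left_mono, auto)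
    also have "exp (- r0 * (t - 1)) = exp r0 * exp (- r0 * t)" by (simp add: exp_add[symmetric] algebra_simps)
    also have "1 / (2 * pi) * ((C * (exp r0 * exp (- r0 * t)) * (M * norm x)) * (2 / 1)) =
        (1 / (2 * pi) * (C * exp r0 * M * (2 / 1))) * (exp (- r0 * t) * norm x)" by simp
    also have "\<dots> \<le> K * (exp (- r0 * t) * norm x)" by (intro mult_right_mono) (auto simp: K_def)
    finally show ?thesis by (simp add: mult.assoc)
  qed
  then show thesis using that KK by blast
qed

end

section \<open>The nonlocal operator\<close>

locale sectorial_nonlocal = sectorial_contour +
  fixes m :: nat and a \<tau> :: "nat \<Rightarrow> real"
  assumes \<tau>_pos: "\<And>i. i \<in> {1..m} \<Longrightarrow> \<tau> i > 0"
    and subunit: "(\<Sum>i=1..m. \<bar>a i\<bar> * exp (- r0 * \<tau> i)) < 1"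
begin

definition q0 :: real where "q0 = (\<Sum>i=1..m. \<bar>a i\<bar> * exp (- r0 * \<tau> i))"

lemma q0: "0 \<le> q0" "q0 < 1"
  using subunit by (auto simp: q0_def intro!: sum_nonneg)

abbreviation (input) B :: "'a \<Rightarrow> 'a" where "B \<equiv> nonlocal_op D A m a \<tau>"
abbreviation (input) b :: "complex \<Rightarrow> complex" where "b \<equiv> nonlocal_sym_inv m a \<tau>"

lemma symbol_sum_bound:
  assumes "r0 \<le> Re w"
  shows "cmod (\<Sum>i=1..m. of_real (a i) * exp (- w * of_real (\<tau> i))) \<le> q0"
  unfolding q0_def
proof (rule sum_norm_le)
  fix i assume "i \<in> {1..m}"
  then have "r0 * \<tau> i \<le> Re w * \<tau> i" using \<tau>_pos[of i] assms by (intro mult_right_mono) auto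
  then show "cmod (of_real (a i) * exp (- w * of_real (\<tau> i))) \<le> \<bar>a i\<bar> * exp (- r0 * \<tau> i)"
    by (auto simp: norm_mult intro!: mult_left_mono)
qed

lemma symbol_denominator:
  assumes "r0 \<le> Re w"
  shows "1 - q0 \<le> cmod (1 + (\<Sum>i=1..m. of_real (a i) * exp (- w * of_real (\<tau> i))))"
  using symbol_sum_bound[OF assms] norm_diff_ineq[of 1 "\<Sum>i=1..m. of_real (a i) * exp (- w * of_real (\<tau> i))"]
  by simp

lemma nonlocal_symbol_bound:
  assumes "r0 \<le> Re w" shows "cmod (b w) \<le> 1 / (1 - q0)"
  unfolding nonlocal_sym_inv_def norm_inverse
  using le_imp_inverse_le[OF symbol_denominator[OF assms]] q0 by (simp add: inverse_eq_divide)

lemma nonlocal_symbol_holomorphic: "b holomorphic_on {z. r0 \<le> Re z}"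
proof -
  have "1 + (\<Sum>i=1..m. of_real (a i) * exp (- w * of_real (\<tau> i))) \<noteq> 0" if "r0 \<le> Re w" for w
    using symbol_denominator[OF that] q0 by force
  then show ?thesis
    unfolding nonlocal_sym_inv_def[abs_def] by (intro holomorphic_intros) auto
qed

lemma nonlocal_symbol: "symbol b (1 / (1 - q0))"
  unfolding symbol_def
  using nonlocal_symbol_bound holomorphic_on_subset[OF nonlocal_symbol_holomorphic] by (auto simp: subset_iff)

definition shift_sum :: "'a \<Rightarrow> 'a" where
  "shift_sum x = (\<Sum>i=1..m. a i *\<^sub>R sg (\<tau> i) x)"

lemma nonlocal_op_eq: "B x = x + shift_sum x"
  unfolding nonlocal_op_def shift_sum_def
  using \<tau>_pos by (auto intro!: sum.cong simp: semigroup_neg_eq less_imp_le)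

lemma shift_sum_linear: "linear shift_sum"
  unfolding shift_sum_def[abs_def]
  by (intro linear_compose_sum ballI linear_compose_scale_right sg_linear(1)) (use \<tau>_pos in \<open>auto intro: less_imp_le\<close>)

lemma shift_sum_power_linear: "linear (shift_sum ^^ n)"
  by (induction n) (auto simp: linear_id linear_ident id_def intro!: linear_compose[of _ shift_sum, unfolded o_def] shift_sum_linear)

text \<open>By the semigroup law the shifts accumulate in the argument of a single \<open>sg\<close>: each application of \<open>shift_sum\<close>
  contributes a factor \<open>q0 < 1\<close>, while the constant in the bound of the semigroup enters once.\<close>

lemma shift_sum_power_bound:
  assumes K: "\<And>t x. t \<ge> 0 \<Longrightarrow> norm (sg t x) \<le> K * exp (- r0 * t) * norm x" and r: "r \<ge> 0"
  shows "norm (sg r ((shift_sum ^^ n) x)) \<le> K * exp (- r0 * r) * q0 ^ n * norm x"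
  using r
proof (induction n arbitrary: r)
  case 0 then show ?case using K[of r x] by simp
next
  case (Suc n)
  have l: "linear (sg r)" using Suc.prems by (rule sg_linear)
  have "sg r ((shift_sum ^^ Suc n) x) = (\<Sum>i=1..m. a i *\<^sub>R sg r (sg (\<tau> i) ((shift_sum ^^ n) x)))"
    by (simp add: shift_sum_def linear_sum[OF l] linear_scale[OF l])
  also have "\<dots> = (\<Sum>i=1..m. a i *\<^sub>R sg (r + \<tau> i) ((shift_sum ^^ n) x))"
    using \<tau>_pos Suc.prems by (intro sum.cong refl) (simp add: sg_add less_imp_le)
  finally have eq: "sg r ((shift_sum ^^ Suc n) x) = (\<Sum>i=1..m. a i *\<^sub>R sg (r + \<tau> i) ((shift_sum ^^ n) x))" .
  have "norm (sg r ((shift_sum ^^ Suc n) x)) \<le> (\<Sum>i=1..m. (\<bar>a i\<bar> * exp (- r0 * \<tau> i)) * (K * exp (- r0 * r) * q0 ^ n * norm x))"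
    unfolding eq
  proof (rule sum_norm_le)
    fix i assume "i \<in> {1..m}"
    then have "norm (sg (r + \<tau> i) ((shift_sum ^^ n) x)) \<le> K * exp (- r0 * (r + \<tau> i)) * q0 ^ n * norm x"
      using Suc.prems \<tau>_pos[of i] by (intro Suc.IH) auto
    then have "norm (a i *\<^sub>R sg (r + \<tau> i) ((shift_sum ^^ n) x)) \<le> \<bar>a i\<bar> * (K * exp (- r0 * (r + \<tau> i)) * q0 ^ n * norm x)"
      by (simp add: mult_left_mono)
    moreover have "exp (- r0 * (r + \<tau> i)) = exp (- r0 * \<tau> i) * exp (- r0 * r)"
      by (simp add: exp_add[symmetric] algebra_simps)
    ultimately show "norm (a i *\<^sub>R sg (r + \<tau> i) ((shift_sum ^^ n) x)) \<le> (\<bar>a i\<bar> * exp (- r0 * \<tau> i)) * (K * exp (- r0 * r) * q0 ^ n * norm x)"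
      by (simp only: mult_ac)
  qed
  also have "\<dots> = q0 * (K * exp (- r0 * r) * q0 ^ n * norm x)" by (simp only: q0_def sum_distrib_right)
  finally show ?case by (simp add: mult_ac)
qed

text \<open>Solving \<open>x = B x - shift_sum x\<close> recursively bounds \<open>x\<close> by a geometric series in \<open>B x\<close> and a remainder that tends to \<open>0\<close>.\<close>

lemma nonlocal_op_lower_bound:
  obtains C where "C \<ge> 0" "\<And>x. norm x \<le> C * norm (B x)"
proof -
  obtain K where K: "K \<ge> 1" "\<And>t x. t \<ge> 0 \<Longrightarrow> norm (sg t x) \<le> K * exp (- r0 * t) * norm x"
    using sg_exponential_bound by blast
  have pb: "norm ((shift_sum ^^ n) x) \<le> K * q0 ^ n * norm x" for n x
    using shift_sum_power_bound[OF K(2), of 0 n x] by (simp add: sg_def)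
  have "norm x \<le> K / (1 - q0) * norm (B x)" for x
  proof -
    have it: "norm x \<le> K * (\<Sum>i<n. q0 ^ i) * norm (B x) + norm ((shift_sum ^^ n) x)" for n
    proof (induction n)
      case (Suc n)
      have "(shift_sum ^^ n) x = (shift_sum ^^ n) (B x) - (shift_sum ^^ n) (shift_sum x)"
        by (simp add: nonlocal_op_eq linear_add[OF shift_sum_power_linear])
      also have "(shift_sum ^^ n) (shift_sum x) = (shift_sum ^^ Suc n) x" by (simp add: funpow_swap1)
      finally have "norm ((shift_sum ^^ n) x) \<le> norm ((shift_sum ^^ n) (B x)) + norm ((shift_sum ^^ Suc n) x)"
        by (metis norm_triangle_ineq4)
      then show ?case using Suc.IH pb[of n "B x"] by (simp add: algebra_simps)
    qed simp
    have "norm x \<le> K / (1 - q0) * norm (B x) + K * norm x * q0 ^ n" for n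
    proof -
      have "(\<Sum>i<n. q0 ^ i) \<le> 1 / (1 - q0)"
        using q0 sum_le_suminf[OF summable_geometric, of q0 "{..<n}"] suminf_geometric[of q0] by simp
      then have "K * (\<Sum>i<n. q0 ^ i) * norm (B x) \<le> K * (1 / (1 - q0)) * norm (B x)"
        using K(1) by (intro mult_right_mono mult_left_mono) auto
      then show ?thesis using it[of n] pb[of n x] by (simp add: mult_ac)
    qed
    moreover have "(\<lambda>n. K / (1 - q0) * norm (B x) + K * norm x * q0 ^ n) \<longlonglongrightarrow> K / (1 - q0) * norm (B x) + K * norm x * 0"
      using q0 by (intro tendsto_intros LIMSEQ_realpow_zero) auto
    ultimately have "norm x \<le> K / (1 - q0) * norm (B x) + K * norm x * 0"
      by (intro LIMSEQ_le_const) auto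
    then show ?thesis by simp
  qed
  moreover have "K / (1 - q0) \<ge> 0" using K(1) q0 by simp
  ultimately show thesis using that by blast
qed

lemma nonlocal_op_inj: "inj B"
proof (rule injI)
  fix x y assume xy: "B x = B y"
  obtain C where C: "\<And>x. norm x \<le> C * norm (B x)" by (rule nonlocal_op_lower_bound) (rule that)
  have "B (x - y) = B x - B y" by (simp add: nonlocal_op_eq linear_diff[OF shift_sum_linear])
  then have "B (x - y) = 0" using xy by simp
  then have "norm (x - y) \<le> C * norm (0::'a)" using C[of "x - y"] by metis
  then show "x = y" by simp
qed

text \<open>Applying \<open>sg (\<tau> i)\<close> multiplies the symbol by \<open>exp (- z \<tau> i)\<close>, so \<open>B\<close> multiplies it by the denominator of \<open>b\<close>.\<close>

lemma nonlocal_op_contour: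
  assumes t: "t > 0"
  shows "B (contour_op b t x) = sg t x"
proof -
  note q = nonlocal_symbol
  let ?k = "\<lambda>t \<xi>. hyp_kernel 0 \<kappa> \<psi> t \<xi> *\<^sub>C (b (z \<xi>) *\<^sub>C R (z \<xi>) x)"
  have kshift: "a i *\<^sub>R ?k (t + \<tau> i) \<xi> = hyp_kernel 0 \<kappa> \<psi> t \<xi> *\<^sub>C (of_real (a i) * exp (- z \<xi> * of_real (\<tau> i)) * b (z \<xi>)) *\<^sub>C R (z \<xi>) x" for i \<xi>
  proof -
    have e: "- z \<xi> * of_real (t + \<tau> i) = - z \<xi> * of_real t + - z \<xi> * of_real (\<tau> i)" by (simp add: algebra_simps)
    have "hyp_kernel 0 \<kappa> \<psi> (t + \<tau> i) \<xi> = hyp_kernel 0 \<kappa> \<psi> t \<xi> * exp (- z \<xi> * of_real (\<tau> i))"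
      unfolding hyp_kernel_def e exp_add by simp
    then show ?thesis
      by (simp only: scaleC_of_real[symmetric] scaleC_scaleC mult_ac)
  qed
  have tt: "t + \<tau> i > 0" if "i \<in> {1..m}" for i using t \<tau>_pos[OF that] by simp
  have "B (contour_op b t x) = contour_op b t x + (\<Sum>i=1..m. a i *\<^sub>R contour_op b (t + \<tau> i) x)"
    unfolding nonlocal_op_eq shift_sum_def
    using \<tau>_pos by (simp add: sg_contour_op[OF q t] less_imp_le)
  also have "\<dots> = inverse (2 * of_real pi * \<i>) *\<^sub>C (integral UNIV (?k t) + (\<Sum>i=1..m. integral UNIV (\<lambda>\<xi>. a i *\<^sub>R ?k (t + \<tau> i) \<xi>)))"
    unfolding contour_op_def hyp_integral_def
    by (simp add: scaleC_add_right scaleC.sum_right scaleC.scaleR_right)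
  also have "(\<Sum>i=1..m. integral UNIV (\<lambda>\<xi>. a i *\<^sub>R ?k (t + \<tau> i) \<xi>)) = integral UNIV (\<lambda>\<xi>. \<Sum>i=1..m. a i *\<^sub>R ?k (t + \<tau> i) \<xi>)"
    by (rule integral_sum[symmetric]) (auto intro!: integrable_cmul contour_integrable[OF q] tt)
  also have "integral UNIV (?k t) + \<dots> = integral UNIV (\<lambda>\<xi>. ?k t \<xi> + (\<Sum>i=1..m. a i *\<^sub>R ?k (t + \<tau> i) \<xi>))"
    by (rule Henstock_Kurzweil_Integration.integral_add[symmetric])
       (auto intro!: integrable_sum integrable_cmul contour_integrable[OF q] tt t)
  also have "(\<lambda>\<xi>. ?k t \<xi> + (\<Sum>i=1..m. a i *\<^sub>R ?k (t + \<tau> i) \<xi>)) = (\<lambda>\<xi>. hyp_kernel 0 \<kappa> \<psi> t \<xi> *\<^sub>C (1 *\<^sub>C R (z \<xi>) x))"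
  proof
    fix \<xi>
    let ?d = "\<Sum>i=1..m. of_real (a i) * exp (- z \<xi> * of_real (\<tau> i))"
    have "1 + ?d \<noteq> 0" using symbol_denominator[of "z \<xi>"] z_right(2)[of \<xi>] q0 by force
    then have one: "b (z \<xi>) + ?d * b (z \<xi>) = 1"
      by (simp add: nonlocal_sym_inv_def distrib_right[of 1 ?d, simplified, symmetric])
    have "?k t \<xi> + (\<Sum>i=1..m. a i *\<^sub>R ?k (t + \<tau> i) \<xi>) =
        hyp_kernel 0 \<kappa> \<psi> t \<xi> *\<^sub>C ((b (z \<xi>) + ?d * b (z \<xi>)) *\<^sub>C R (z \<xi>) x)"
      unfolding kshift by (simp add: scaleC.sum_right scaleC.sum_left scaleC_add_right scaleC_add_left sum_distrib_right)
    then show "?k t \<xi> + (\<Sum>i=1..m. a i *\<^sub>R ?k (t + \<tau> i) \<xi>) = hyp_kernel 0 \<kappa> \<psi> t \<xi> *\<^sub>C (1 *\<^sub>C R (z \<xi>) x)"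
      by (simp only: one)
  qed
  finally show ?thesis using t by (simp add: sg_def contour_op_def hyp_integral_def)
qed

lemma inv_nonlocal_op_sg: "t > 0 \<Longrightarrow> inv B (sg t x) = contour_op b t x"
  using inv_f_f[OF nonlocal_op_inj] nonlocal_op_contour by metis

lemma nonlocal_contour_bound:
  obtains C where "C \<ge> 0" "\<And>t x. t > 0 \<Longrightarrow> norm (contour_op b t x) \<le> C * norm x"
proof -
  obtain C where C: "C \<ge> 0" "\<And>x. norm x \<le> C * norm (B x)" by (rule nonlocal_op_lower_bound) (rule that)
  obtain K where K: "K \<ge> 1" "\<And>t x. t \<ge> 0 \<Longrightarrow> norm (sg t x) \<le> K * norm x" by (rule sg_bounded) (rule that)
  show thesis
  proof (rule that[of "C * K"])
    fix t :: real and x assume t: "t > 0"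
    have "norm (contour_op b t x) \<le> C * norm (sg t x)" using C(2)[of "contour_op b t x"] nonlocal_op_contour[OF t] by simp
    also have "\<dots> \<le> C * (K * norm x)" using K(2)[of t x] t C(1) by (intro mult_left_mono) auto
    finally show "norm (contour_op b t x) \<le> C * K * norm x" by simp
  qed (use C K in auto)
qed

end

section \<open>The trapezoidal rule for functions holomorphic in a strip\<close>

lemma contour_integral_linepath_horizontal:
  assumes "a < b"
  shows "contour_integral (linepath (Complex a c) (Complex b c)) f = integral {a..b} (\<lambda>x. f (Complex x c))"
proof -
  have "contour_integral (linepath (Complex a c) (Complex b c)) f =
      (Complex b c - Complex a c) * integral {0..1} (\<lambda>x. f (linepath (Complex a c) (Complex b c) x))"
    by (simp add: contour_integral_integral)
  also have "Complex b c - Complex a c = of_real (b - a)" by (simp add: complex_eq_iff)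
  also have "integral {0..1} (\<lambda>x. f (linepath (Complex a c) (Complex b c) x)) =
      integral {0..1} (\<lambda>x. f (Complex (a + (b - a) * x) c))"
    by (intro integral_cong arg_cong[of _ _ f]) (simp add: linepath_def complex_eq_iff algebra_simps)
  also have "\<dots> = integral {0..(b - a) / (b - a)} (\<lambda>x. f (Complex (a + (b - a) * x) c))"
    using assms by simp
  also have "{0..(b - a) / (b - a)} = (\<lambda>x. x / (b - a)) ` {0..b - a}"
    using assms by simp
  also have "integral \<dots> (\<lambda>x. f (Complex (a + (b - a) * x) c)) =
      integral {a-a..b-a} (\<lambda>x. f (Complex (x + a) c)) / of_real (b - a)"
    using assms by (subst integral_stretch_real) (auto simp: scaleR_conv_of_real add_ac)
  also have "\<dots> = integral {a..b} (\<lambda>x. f (Complex x c)) / of_real (b - a)"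
    by (subst integral_shift_real_ivl) (rule refl)
  finally show ?thesis using assms by simp
qed

lemma sum_symmetric_Suc:
  fixes f :: "int \<Rightarrow> 'b::comm_monoid_add"
  shows "(\<Sum>k=-int (Suc n)..int (Suc n). f k) = (\<Sum>k=-int n..int n. f k) + (f (int (Suc n)) + f (- int (Suc n)))"
proof -
  have "{-int (Suc n)..int (Suc n)} = insert (int (Suc n)) (insert (- int (Suc n)) {-int n..int n})" by auto
  then show ?thesis by (simp add: add_ac)
qed

text \<open>This makes sums of \<open>h exp (- \<beta> k h)\<close> telescope, with a bound uniform in \<open>h\<close>.\<close>

lemma exp_step_telescope:
  fixes \<beta> h x :: real
  assumes "\<beta> > 0" "h > 0"
  shows "h * exp (- \<beta> * (x + h)) \<le> (exp (- \<beta> * x) - exp (- \<beta> * (x + h))) / \<beta>"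
proof -
  have "1 + \<beta> * h \<le> exp (\<beta> * h)" by (rule exp_ge_add_one_self)
  then have "(1 + \<beta> * h) * exp (- \<beta> * (x + h)) \<le> exp (\<beta> * h) * exp (- \<beta> * (x + h))"
    by (rule mult_right_mono) simp
  also have "\<dots> = exp (- \<beta> * x)" by (simp add: exp_add[symmetric] algebra_simps)
  finally show ?thesis using assms by (simp add: field_simps)
qed

lemma truncated_sum_tail:
  fixes f :: "int \<Rightarrow> 'b::real_normed_vector"
  assumes par: "\<beta> > 0" "h > 0" "C \<ge> 0" and f: "\<And>k. norm (f k) \<le> C * exp (- \<beta> * (\<bar>real_of_int k\<bar> * h))" and "N \<le> n"
  shows "h * norm ((\<Sum>k=-int n..int n. f k) - (\<Sum>k=-int N..int N. f k)) \<le>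
           2 * C * (exp (- \<beta> * (real N * h)) - exp (- \<beta> * (real n * h))) / \<beta>"
  using \<open>N \<le> n\<close>
proof (induction n rule: dec_induct)
  case (step n)
  let ?S = "\<lambda>n. \<Sum>k=-int n..int n. f k"
  have "norm (?S (Suc n) - ?S N) \<le> norm (?S n - ?S N) + norm (f (int (Suc n)) + f (- int (Suc n)))"
  proof -
    have "?S (Suc n) - ?S N = (?S n - ?S N) + (f (int (Suc n)) + f (- int (Suc n)))"
      unfolding sum_symmetric_Suc[of f n] by (simp only: add_diff_eq diff_add_eq)
    then show ?thesis by (simp only: norm_triangle_ineq)
  qed
  also have "norm (f (int (Suc n)) + f (- int (Suc n))) \<le> 2 * C * exp (- \<beta> * (real n * h + h))"
    using f[of "int (Suc n)"] f[of "- int (Suc n)"]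
    by (intro order_trans[OF norm_triangle_ineq]) (simp add: algebra_simps)
  finally have "h * norm (?S (Suc n) - ?S N) \<le> h * (norm (?S n - ?S N) + 2 * C * exp (- \<beta> * (real n * h + h)))"
    using par by (intro mult_left_mono) auto
  also have "\<dots> = h * norm (?S n - ?S N) + 2 * C * (h * exp (- \<beta> * (real n * h + h)))" by (simp add: algebra_simps)
  also have "\<dots> \<le> 2 * C * (exp (- \<beta> * (real N * h)) - exp (- \<beta> * (real n * h))) / \<beta> +
      2 * C * ((exp (- \<beta> * (real n * h)) - exp (- \<beta> * (real n * h + h))) / \<beta>)"
    using par by (intro add_mono step.IH mult_left_mono exp_step_telescope) auto
  also have "\<dots> = 2 * C * (exp (- \<beta> * (real N * h)) - exp (- \<beta> * (real (Suc n) * h))) / \<beta>"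
  proof -
    have "real n * h + h = real (Suc n) * h" by (simp add: algebra_simps)
    then show ?thesis using par by (simp only:) (simp add: field_simps)
  qed
  finally show ?case .
qed simp

lemma norm_integral_interval_exp_bound:
  fixes f :: "real \<Rightarrow> 'b::banach"
  assumes f: "continuous_on {-X..X} f" and b: "\<beta> > 0" "K \<ge> 0" "\<And>x. norm (f x) \<le> K * exp (- \<beta> * \<bar>x\<bar>)"
  shows "norm (integral {-X..X} f) \<le> K * (2 / \<beta>)"
proof -
  have g: "((\<lambda>x. K * exp (- \<beta> * \<bar>x\<bar>)) has_integral K * (2 / \<beta>)) UNIV"
    by (rule has_integral_mult_right[OF has_integral_exp_abs[OF b(1)]])
  have gi: "(\<lambda>x. K * exp (- \<beta> * \<bar>x\<bar>)) integrable_on {-X..X}"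
    by (intro integrable_continuous_real continuous_intros)
  have "norm (integral {-X..X} f) \<le> integral {-X..X} (\<lambda>x. K * exp (- \<beta> * \<bar>x\<bar>))"
    by (rule Henstock_Kurzweil_Integration.integral_norm_bound_integral[OF integrable_continuous_real[OF f] gi]) (rule b)
  also have "\<dots> \<le> integral UNIV (\<lambda>x. K * exp (- \<beta> * \<bar>x\<bar>))"
    using b g by (intro integral_subset_le gi) auto
  also have "\<dots> = K * (2 / \<beta>)" by (rule integral_unique[OF g])
  finally show ?thesis .
qed

text \<open>The kernel \<open>1 / (exp (2 \<pi> \<i> w / h) - 1)\<close> has residue \<open>h / (2 \<pi> \<i>)\<close> at each node \<open>k h\<close>.  It is exponentially small
  in \<open>d / h\<close> on the line \<open>Im w = - d\<close>, and exponentially close to \<open>-1\<close> on \<open>Im w = d\<close>; so the contour integral over a long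
  rectangle is both the trapezoidal sum and, up to an exponentially small error, the integral.\<close>

context
  fixes \<Phi> :: "complex \<Rightarrow> complex" and d0 d \<beta> C h :: real
  assumes d: "0 < d" "d < d0" and \<beta>: "\<beta> > 0" and h: "h > 0"
    and holo: "\<Phi> holomorphic_on {w. \<bar>Im w\<bar> < d0}"
    and decay: "\<And>w. \<bar>Im w\<bar> \<le> d \<Longrightarrow> cmod (\<Phi> w) \<le> C * exp (- \<beta> * \<bar>Re w\<bar>)"
begin

definition "nodal_exp w = exp (2 * of_real pi * \<i> * w / of_real h)"

lemma C_nonneg: "C \<ge> 0"
  using order_trans[OF norm_ge_zero decay[of 0]] d by simp

lemma cmod_nodal_exp: "cmod (nodal_exp w) = exp (- 2 * pi * Im w / h)"
proof -
  have "Re (2 * of_real pi * \<i> * w / of_real h) = - 2 * pi * Im w / h" by (simp add: Re_divide_of_real)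
  then show ?thesis by (simp add: nodal_exp_def)
qed

lemma nodal_exp_eq_1: "nodal_exp w = 1 \<longleftrightarrow> (\<exists>k::int. w = of_real (real_of_int k * h))"
proof
  assume "nodal_exp w = 1"
  then obtain k :: int where k: "Re (2 * of_real pi * \<i> * w / of_real h) = 0"
      "Im (2 * of_real pi * \<i> * w / of_real h) = of_int (2 * k) * pi"
    unfolding nodal_exp_def exp_eq_1 by blast
  have "w = of_real (real_of_int k * h)"
    using k h by (simp add: complex_eq_iff Re_divide_of_real Im_divide_of_real field_simps)
  then show "\<exists>k::int. w = of_real (real_of_int k * h)" by blast
next
  assume "\<exists>k::int. w = of_real (real_of_int k * h)"
  then obtain k :: int where k: "w = of_real (real_of_int k * h)" by blast
  show "nodal_exp w = 1"
    unfolding nodal_exp_def exp_eq_1 k using h by (auto simp: Re_divide_of_real Im_divide_of_real intro!: exI[of _ k])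
qed

lemma strip: "open {w. \<bar>Im w\<bar> < d0}" "starlike {w. \<bar>Im w\<bar> < d0}" "convex {w. \<bar>Im w\<bar> < d0}"
proof -
  have eq: "{w. \<bar>Im w\<bar> < d0} = {w. Im w < d0} \<inter> {w. Im w > - d0}" by auto
  show "open {w. \<bar>Im w\<bar> < d0}" unfolding eq by (intro open_Int open_halfspace_Im_lt open_halfspace_Im_gt)
  show c: "convex {w. \<bar>Im w\<bar> < d0}" unfolding eq by (intro convex_Int convex_halfspace_Im_lt convex_halfspace_Im_gt)
  show "starlike {w. \<bar>Im w\<bar> < d0}" by (rule convex_imp_starlike[OF c]) (use d in \<open>auto intro!: exI[of _ 0]\<close>)
qed

lemma residue_node:
  "residue (\<lambda>w. \<Phi> w / (nodal_exp w - 1)) (of_real (real_of_int k * h)) = of_real h / (2 * of_real pi * \<i>) * \<Phi> (of_real (real_of_int k * h))"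
proof (rule residue_simple')
  let ?p = "of_real (real_of_int k * h) :: complex"
  let ?s = "ball ?p (min h d0)"
  show "open ?s" "?p \<in> ?s" using h d by auto
  have "nodal_exp w \<noteq> 1" if "w \<in> ?s - {?p}" for w
  proof
    assume "nodal_exp w = 1"
    then obtain l :: int where l: "w = of_real (real_of_int l * h)" unfolding nodal_exp_eq_1 by blast
    then have "w - ?p = of_real (real_of_int (l - k) * h)" by (simp add: algebra_simps)
    then have "cmod (w - ?p) = \<bar>real_of_int (l - k)\<bar> * h"
      using h by (simp only: norm_of_real abs_mult abs_of_pos)
    moreover have "l \<noteq> k" using that l by auto
    then have "1 * h \<le> \<bar>real_of_int (l - k)\<bar> * h" using h by (intro mult_right_mono) linarith+
    ultimately show False using that by (simp add: dist_norm norm_minus_commute)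
  qed
  moreover have sub: "?s \<subseteq> {w. \<bar>Im w\<bar> < d0}"
  proof
    fix w assume "w \<in> ?s"
    then have "cmod (w - ?p) < d0" by (simp add: dist_norm norm_minus_commute)
    then show "w \<in> {w. \<bar>Im w\<bar> < d0}" using abs_Im_le_cmod[of "w - ?p"] by simp
  qed
  ultimately show "(\<lambda>w. \<Phi> w / (nodal_exp w - 1)) holomorphic_on ?s - {?p}"
    unfolding nodal_exp_def by (intro holomorphic_intros holomorphic_on_subset[OF holo]) (use h in auto)
  have E1: "nodal_exp ?p = 1" unfolding nodal_exp_eq_1 by blast
  have "(nodal_exp has_field_derivative (2 * of_real pi * \<i> / of_real h) * nodal_exp ?p) (at ?p)"
    unfolding nodal_exp_def by (auto intro!: derivative_eq_intros simp: h)
  then have limE: "((\<lambda>w. (nodal_exp w - nodal_exp ?p) / (w - ?p)) \<longlongrightarrow> 2 * of_real pi * \<i> / of_real h) (at ?p)"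
    by (simp add: has_field_derivative_iff E1 del: of_real_mult)
  have "isCont \<Phi> ?p"
    using holomorphic_on_imp_continuous_on[OF holo] strip(1) d by (auto simp: continuous_on_eq_continuous_at)
  then have limP: "(\<Phi> \<longlongrightarrow> \<Phi> ?p) (at ?p)" by (simp add: isCont_def)
  have "((\<lambda>w. \<Phi> w / ((nodal_exp w - nodal_exp ?p) / (w - ?p))) \<longlongrightarrow> \<Phi> ?p / (2 * of_real pi * \<i> / of_real h)) (at ?p)"
    by (rule tendsto_divide[OF limP limE]) (use h in simp)
  moreover have "\<Phi> w / ((nodal_exp w - 1) / (w - ?p)) = \<Phi> w / (nodal_exp w - 1) * (w - ?p)" for w by simp
  moreover have "\<Phi> ?p / (2 * of_real pi * \<i> / of_real h) = of_real h / (2 * of_real pi * \<i>) * \<Phi> ?p" by simp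
  ultimately show "((\<lambda>w. \<Phi> w / (nodal_exp w - 1) * (w - ?p)) \<longlongrightarrow> of_real h / (2 * of_real pi * \<i>) * \<Phi> ?p) (at ?p)"
    by (simp only: E1)
qed

text \<open>The vertical sides pass half-way between two nodes, where the kernel is bounded by one.\<close>

lemma rectangle_identity:
  fixes n :: nat
  defines "X \<equiv> (real n + 1/2) * h"
  shows "of_real h * (\<Sum>k=-int n..int n. \<Phi> (of_real (real_of_int k * h))) =
     integral {-X..X} (\<lambda>x. \<Phi> (Complex x (-d)) / (nodal_exp (Complex x (-d)) - 1))
     + contour_integral (linepath (Complex X (-d)) (Complex X d)) (\<lambda>w. \<Phi> w / (nodal_exp w - 1))
     - integral {-X..X} (\<lambda>x. \<Phi> (Complex x d) / (nodal_exp (Complex x d) - 1))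
     + contour_integral (linepath (Complex (-X) d) (Complex (-X) (-d))) (\<lambda>w. \<Phi> w / (nodal_exp w - 1))"
     (is "?S = _")
proof -
  let ?g = "\<lambda>w. \<Phi> w / (nodal_exp w - 1)"
  let ?a = "Complex (-X) (-d)" and ?b = "Complex X d"
  define P where "P = (\<lambda>k::int. of_real (real_of_int k * h) :: complex) ` {-int n..int n}"
  define U where "U = {w. \<bar>Re w\<bar> < (real n + 1) * h} \<inter> {w. \<bar>Im w\<bar> < d0}"
  have X: "0 < X" "X < (real n + 1) * h" using h by (auto simp: X_def intro!: mult_strict_right_mono)
  have eqU: "{w. \<bar>Re w\<bar> < c} = {w. Re w < c} \<inter> {w. Re w > - c}" for c by auto
  have opU: "open U" unfolding U_def eqU by (intro open_Int open_halfspace_Re_lt open_halfspace_Re_gt strip)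
  have cU: "connected U" unfolding U_def eqU
    by (intro convex_connected convex_Int convex_halfspace_Re_lt convex_halfspace_Re_gt strip)
  \<comment> \<open>the nodes in \<open>P\<close> are the only poles in \<open>U\<close>\<close>
  have pole: "nodal_exp w \<noteq> 1" if w: "w \<in> U - P" for w
  proof
    assume "nodal_exp w = 1"
    then obtain k :: int where k: "w = of_real (real_of_int k * h)" unfolding nodal_exp_eq_1 by blast
    have "\<bar>real_of_int k\<bar> * h < (real n + 1) * h" using w h by (simp add: U_def k abs_mult)
    then have "\<bar>real_of_int k\<bar> < real n + 1" using h by simp
    then have "k \<in> {-int n..int n}" by auto
    then show False using w k by (auto simp: P_def)
  qed
  have holg: "?g holomorphic_on U - P"
    using pole unfolding nodal_exp_def
    by (intro holomorphic_intros holomorphic_on_subset[OF holo]) (use h in \<open>auto simp: U_def\<close>)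
  have img: "path_image (rectpath ?a ?b) \<subseteq> U - P"
  proof
    fix w assume "w \<in> path_image (rectpath ?a ?b)"
    then have w: "(Re w \<in> {-X, X} \<and> Im w \<in> {-d..d}) \<or> (Im w \<in> {-d, d} \<and> Re w \<in> {-X..X})"
      using X d by (subst (asm) path_image_rectpath) auto
    then have "w \<in> U" using X d by (auto simp: U_def)
    moreover have "w \<notin> P"
    proof
      assume "w \<in> P"
      then obtain k :: int where "w = of_real (real_of_int k * h)" "k \<in> {-int n..int n}"
        unfolding P_def by (rule imageE)
      then have k: "w = of_real (real_of_int k * h)" "\<bar>real_of_int k\<bar> \<le> real n" by auto
      then have "Im w = 0" "\<bar>Re w\<bar> \<le> real n * h" using h by (auto simp: abs_mult intro!: mult_right_mono)
      moreover have "real n * h < X" using h by (simp add: X_def)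
      ultimately show False using w d by auto
    qed
    ultimately show "w \<in> U - P" by blast
  qed
  have "contour_integral (rectpath ?a ?b) ?g = 2 * pi * \<i> * (\<Sum>p\<in>P. winding_number (rectpath ?a ?b) p * residue ?g p)"
  proof (rule Residue_theorem[OF opU cU _ holg _ _ img])
    show "\<forall>z. z \<notin> U \<longrightarrow> winding_number (rectpath ?a ?b) z = 0"
    proof (intro allI impI)
      fix w assume "w \<notin> U"
      then have "w \<notin> cbox ?a ?b" using X d by (auto simp: U_def in_cbox_complex_iff)
      then show "winding_number (rectpath ?a ?b) w = 0"
        using X d by (intro winding_number_rectpath_outside) auto
    qed
  qed (auto simp: P_def)
  also have "(\<Sum>p\<in>P. winding_number (rectpath ?a ?b) p * residue ?g p) =
     (\<Sum>k=-int n..int n. of_real h / (2 * of_real pi * \<i>) * \<Phi> (of_real (real_of_int k * h)))"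
    unfolding P_def
  proof (subst sum.reindex)
    show "inj_on (\<lambda>k::int. of_real (real_of_int k * h) :: complex) {-int n..int n}"
      using h by (auto simp: inj_on_def)
    show "sum ((\<lambda>p. winding_number (rectpath ?a ?b) p * residue ?g p) \<circ> (\<lambda>k. of_real (real_of_int k * h))) {-int n..int n} =
       (\<Sum>k=-int n..int n. of_real h / (2 * of_real pi * \<i>) * \<Phi> (of_real (real_of_int k * h)))"
    proof (rule sum.cong[OF refl])
      fix k assume k: "k \<in> {-int n..int n}"
      have "\<bar>real_of_int k\<bar> * h \<le> real n * h" using k h by (intro mult_right_mono) auto
      also have "\<dots> < X" using h by (simp add: X_def)
      finally have "\<bar>real_of_int k * h\<bar> < X" using h by (simp add: abs_mult)
      then have "of_real (real_of_int k * h) \<in> box ?a ?b"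
        using d by (auto simp: in_box_complex_iff abs_less_iff simp del: of_real_mult)
      then show "((\<lambda>p. winding_number (rectpath ?a ?b) p * residue ?g p) \<circ> (\<lambda>k. of_real (real_of_int k * h))) k =
         of_real h / (2 * of_real pi * \<i>) * \<Phi> (of_real (real_of_int k * h))"
        unfolding o_def residue_node by (simp only: winding_number_rectpath mult_1_left)
    qed
  qed
  finally have "contour_integral (rectpath ?a ?b) ?g =
      2 * pi * \<i> * (of_real h / (2 * of_real pi * \<i>) * (\<Sum>k=-int n..int n. \<Phi> (of_real (real_of_int k * h))))"
    by (simp only: sum_distrib_left)
  then have 1: "contour_integral (rectpath ?a ?b) ?g = ?S" by simp
  have cont: "continuous_on (path_image (rectpath ?a ?b)) ?g"
    using continuous_on_subset[OF holomorphic_on_imp_continuous_on[OF holg] img] .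
  have segs: "path_image (rectpath ?a ?b) = closed_segment ?a (Complex X (-d)) \<union> closed_segment (Complex X (-d)) ?b \<union>
      closed_segment ?b (Complex (-X) d) \<union> closed_segment (Complex (-X) d) ?a"
    by (simp add: rectpath_def Let_def path_image_join Un_assoc)
  have int: "?g contour_integrable_on linepath ?a (Complex X (-d))" "?g contour_integrable_on linepath (Complex X (-d)) ?b"
    "?g contour_integrable_on linepath ?b (Complex (-X) d)" "?g contour_integrable_on linepath (Complex (-X) d) ?a"
    by (intro contour_integrable_continuous_linepath continuous_on_subset[OF cont]; auto simp: segs)+
  have "contour_integral (rectpath ?a ?b) ?g = contour_integral (linepath ?a (Complex X (-d))) ?g +
     (contour_integral (linepath (Complex X (-d)) ?b) ?g + (contour_integral (linepath ?b (Complex (-X) d)) ?g +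
      contour_integral (linepath (Complex (-X) d) ?a) ?g))"
    unfolding rectpath_def Let_def using int by (simp add: contour_integrable_joinI)
  also have "contour_integral (linepath ?b (Complex (-X) d)) ?g = - contour_integral (linepath (Complex (-X) d) ?b) ?g"
    by (rule contour_integral_reverse_linepath)
       (intro continuous_on_subset[OF cont], auto simp: segs closed_segment_commute)
  finally show ?thesis using X
    unfolding 1 by (simp add: contour_integral_linepath_horizontal)
qed

lemma nodal_exp_minus_1_bounds:
  assumes "q = exp (2 * pi * d / h)"
  shows "Im w = - d \<Longrightarrow> cmod (inverse (nodal_exp w - 1)) \<le> 1 / (q - 1)"
    "Im w = d \<Longrightarrow> cmod (nodal_exp w * inverse (nodal_exp w - 1)) \<le> 1 / (q - 1)"
    "\<bar>Im w\<bar> = d \<Longrightarrow> nodal_exp w \<noteq> 1"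
    "\<bar>Re w\<bar> = (real n + 1/2) * h \<Longrightarrow> cmod (inverse (nodal_exp w - 1)) \<le> 1"
proof -
  have q: "q > 1" using d h by (simp add: assms)
  show "cmod (inverse (nodal_exp w - 1)) \<le> 1 / (q - 1)" if "Im w = - d"
  proof -
    have "cmod (nodal_exp w) = q" using that by (simp add: cmod_nodal_exp assms)
    then have "q - 1 \<le> cmod (nodal_exp w - 1)" using norm_triangle_ineq2[of "nodal_exp w" 1] by simp
    then show ?thesis unfolding norm_inverse using q le_imp_inverse_le[of "q - 1"] by (simp add: inverse_eq_divide)
  qed
  show "cmod (nodal_exp w * inverse (nodal_exp w - 1)) \<le> 1 / (q - 1)" if "Im w = d"
  proof -
    have e: "cmod (nodal_exp w) = 1 / q" using that by (simp add: cmod_nodal_exp assms exp_minus inverse_eq_divide[symmetric])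
    then have "1 - 1 / q \<le> cmod (nodal_exp w - 1)" using norm_triangle_ineq2[of 1 "nodal_exp w"] by (simp add: norm_minus_commute)
    then have "inverse (cmod (nodal_exp w - 1)) \<le> inverse (1 - 1 / q)" using q by (intro le_imp_inverse_le) auto
    then have "(1 / q) * inverse (cmod (nodal_exp w - 1)) \<le> (1 / q) * inverse (1 - 1 / q)" using q by (intro mult_left_mono) auto
    also have "\<dots> = 1 / (q - 1)" using q by (simp add: field_simps)
    finally show ?thesis by (simp only: norm_mult norm_inverse e)
  qed
  show "nodal_exp w \<noteq> 1" if "\<bar>Im w\<bar> = d"
  proof
    assume "nodal_exp w = 1"
    then show False using nodal_exp_eq_1[of w] that d by auto
  qed
  show "cmod (inverse (nodal_exp w - 1)) \<le> 1" if "\<bar>Re w\<bar> = (real n + 1/2) * h"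
  proof -
    have "Re (nodal_exp w) = exp (- 2 * pi * Im w / h) * cos (2 * pi * Re w / h)"
      unfolding nodal_exp_def Re_exp by (simp add: Re_divide_of_real Im_divide_of_real)
    moreover have "cos (2 * pi * Re w / h) = cos (2 * pi * \<bar>Re w\<bar> / h)"
      by (cases "Re w \<ge> 0") (auto simp: abs_if)
    moreover have "2 * pi * \<bar>Re w\<bar> / h = 2 * real n * pi + pi" using h by (simp add: that field_simps)
    moreover have "cos (2 * real n * pi + pi) = - 1" by (simp add: cos_add)
    ultimately have "Re (nodal_exp w) \<le> 0" by simp
    then have "1 \<le> cmod (nodal_exp w - 1)" using abs_Re_le_cmod[of "nodal_exp w - 1"] by simp
    then show ?thesis unfolding norm_inverse by (rule inverse_le_1_iff[THEN iffD2, OF disjI2])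
  qed
qed

lemma horizontal_continuous:
  assumes "\<bar>y\<bar> < d0" shows "continuous_on S (\<lambda>x. \<Phi> (Complex x y))"
proof -
  have "continuous_on S (\<lambda>x. of_real x + \<i> * of_real y :: complex)" by (intro continuous_intros)
  then have "continuous_on S (\<lambda>x. Complex x y)" by (simp add: Complex_eq)
  then show ?thesis
    by (rule continuous_on_compose2[OF holomorphic_on_imp_continuous_on[OF holo]]) (use assms in auto)
qed

lemma nodal_exp_horizontal_continuous: "continuous_on S (\<lambda>x. nodal_exp (Complex x y))"
  unfolding nodal_exp_def Complex_eq using h by (intro continuous_intros) auto

lemma integral_shift_strip:
  assumes X: "0 < X"
  shows "cmod (integral {-X..X} (\<lambda>x. \<Phi> (Complex x d)) - integral {-X..X} (\<lambda>x. \<Phi> (of_real x)))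
     \<le> 2 * (C * exp (- \<beta> * X) * d)"
proof -
  obtain G where G: "\<And>w. w \<in> {w. \<bar>Im w\<bar> < d0} \<Longrightarrow> (G has_field_derivative \<Phi> w) (at w)"
    using open_starlike_primitive[OF strip(1,2) holo] by blast
  have int: "integral {-X..X} (\<lambda>x. \<Phi> (Complex x y)) = G (Complex X y) - G (Complex (-X) y)" if y: "\<bar>y\<bar> < d0" for y
  proof (intro integral_unique fundamental_theorem_of_calculus)
    fix x assume "x \<in> {-X..X}"
    have "((\<lambda>x. of_real x + \<i> * of_real y :: complex) has_vector_derivative 1) (at x)"
      by (auto intro!: derivative_eq_intros)
    then have "((\<lambda>x. Complex x y) has_vector_derivative 1) (at x)" by (simp add: Complex_eq)
    from field_vector_diff_chain_at[OF this G[of "Complex x y"]]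
    have "(G \<circ> (\<lambda>x. Complex x y) has_vector_derivative \<Phi> (Complex x y)) (at x)" using y by simp
    then show "((\<lambda>x. G (Complex x y)) has_vector_derivative \<Phi> (Complex x y)) (at x within {-X..X})"
      by (simp add: o_def has_vector_derivative_at_within)
  qed (use X in simp)
  have vert: "cmod (G (Complex x d) - G (Complex x 0)) \<le> C * exp (- \<beta> * X) * d" if x: "\<bar>x\<bar> = X" for x
  proof -
    have seg: "Re w = x \<and> 0 \<le> Im w \<and> Im w \<le> d" if "w \<in> closed_segment (Complex x 0) (Complex x d)" for w
      using that d by (auto simp: closed_segment_same_Re closed_segment_eq_real_ivl)
    have "cmod (G (Complex x d) - G (Complex x 0)) \<le> (C * exp (- \<beta> * X)) * cmod (Complex x d - Complex x 0)"
    proof (rule primitive_segment_bound[OF G])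
      show "closed_segment (Complex x 0) (Complex x d) \<subseteq> {w. \<bar>Im w\<bar> < d0}"
      proof
        fix w assume "w \<in> closed_segment (Complex x 0) (Complex x d)"
        from seg[OF this] d show "w \<in> {w. \<bar>Im w\<bar> < d0}" by simp
      qed
      fix w assume "w \<in> closed_segment (Complex x 0) (Complex x d)"
      from seg[OF this] show "cmod (\<Phi> w) \<le> C * exp (- \<beta> * X)" using decay[of w] x by simp
    qed
    also have "Complex x d - Complex x 0 = \<i> * of_real d" by (simp add: complex_eq_iff)
    also have "cmod (\<i> * of_real d) = d" using d by (simp add: norm_mult)
    finally show ?thesis .
  qed
  have "(\<lambda>x. \<Phi> (of_real x)) = (\<lambda>x. \<Phi> (Complex x 0))" by (simp add: complex_of_real_def)
  then have eq: "integral {-X..X} (\<lambda>x. \<Phi> (Complex x d)) - integral {-X..X} (\<lambda>x. \<Phi> (of_real x)) =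
      (G (Complex X d) - G (Complex X 0)) - (G (Complex (-X) d) - G (Complex (-X) 0))"
    using int[of d] int[of 0] d by simp
  show ?thesis unfolding eq
    using norm_triangle_ineq4[of "G (Complex X d) - G (Complex X 0)" "G (Complex (-X) d) - G (Complex (-X) 0)"]
      vert[of X] vert[of "-X"] X by simp
qed

lemma rectangle_error:
  fixes n :: nat
  defines "X \<equiv> (real n + 1/2) * h"
  shows "cmod (of_real h * (\<Sum>k=-int n..int n. \<Phi> (of_real (real_of_int k * h))) - integral {-X..X} (\<lambda>x. \<Phi> (of_real x)))
     \<le> C * (4 / \<beta>) / (exp (2 * pi * d / h) - 1) + 6 * d * C * exp (- \<beta> * X)"
proof -
  define q where "q = exp (2 * pi * d / h)"
  have q: "q > 1" using d h by (simp add: q_def)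
  note bnd = nodal_exp_minus_1_bounds[OF q_def]
  have X: "X > 0" using h by (simp add: X_def)
  have ce: "C * (1 / (q - 1)) \<ge> 0" using C_nonneg q by simp
  have bottom: "cmod (integral {-X..X} (\<lambda>x. \<Phi> (Complex x (-d)) / (nodal_exp (Complex x (-d)) - 1))) \<le> C * (1 / (q - 1)) * (2 / \<beta>)"
  proof (rule norm_integral_interval_exp_bound[OF _ \<beta> ce])
    show "continuous_on {-X..X} (\<lambda>x. \<Phi> (Complex x (-d)) / (nodal_exp (Complex x (-d)) - 1))"
      using d bnd(3) by (intro continuous_intros horizontal_continuous nodal_exp_horizontal_continuous) auto
    fix x
    have "cmod (\<Phi> (Complex x (-d)) / (nodal_exp (Complex x (-d)) - 1)) \<le> (C * exp (- \<beta> * \<bar>x\<bar>)) * (1 / (q - 1))"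
      unfolding divide_inverse norm_mult using decay[of "Complex x (-d)"] bnd(1)[of "Complex x (-d)"] d C_nonneg
      by (intro mult_mono) (auto simp: divide_inverse)
    then show "cmod (\<Phi> (Complex x (-d)) / (nodal_exp (Complex x (-d)) - 1)) \<le> C * (1 / (q - 1)) * exp (- \<beta> * \<bar>x\<bar>)" by (simp add: mult_ac)
  qed
  let ?T = "integral {-X..X} (\<lambda>x. \<Phi> (Complex x d) * (nodal_exp (Complex x d) * inverse (nodal_exp (Complex x d) - 1)))"
  have contT: "continuous_on {-X..X} (\<lambda>x. \<Phi> (Complex x d) * (nodal_exp (Complex x d) * inverse (nodal_exp (Complex x d) - 1)))"
    using d bnd(3) by (intro continuous_intros horizontal_continuous nodal_exp_horizontal_continuous) auto
  have top: "cmod ?T \<le> C * (1 / (q - 1)) * (2 / \<beta>)"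
  proof (rule norm_integral_interval_exp_bound[OF contT \<beta> ce])
    fix x
    have "cmod (\<Phi> (Complex x d) * (nodal_exp (Complex x d) * inverse (nodal_exp (Complex x d) - 1))) \<le> (C * exp (- \<beta> * \<bar>x\<bar>)) * (1 / (q - 1))"
      unfolding norm_mult[of "\<Phi> _"] using decay[of "Complex x d"] bnd(2)[of "Complex x d"] d C_nonneg
      by (intro mult_mono) auto
    then show "cmod (\<Phi> (Complex x d) * (nodal_exp (Complex x d) * inverse (nodal_exp (Complex x d) - 1))) \<le> C * (1 / (q - 1)) * exp (- \<beta> * \<bar>x\<bar>)"
      by (simp add: mult_ac)
  qed
  \<comment> \<open>\<open>- 1 / (e - 1) = 1 - e / (e - 1)\<close> splits off the integral over the upper side\<close>
  have top_eq: "integral {-X..X} (\<lambda>x. \<Phi> (Complex x d) / (nodal_exp (Complex x d) - 1)) = ?T - integral {-X..X} (\<lambda>x. \<Phi> (Complex x d))"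
  proof -
    have "?T - integral {-X..X} (\<lambda>x. \<Phi> (Complex x d)) =
       integral {-X..X} (\<lambda>x. \<Phi> (Complex x d) * (nodal_exp (Complex x d) * inverse (nodal_exp (Complex x d) - 1)) - \<Phi> (Complex x d))"
      using d by (intro Henstock_Kurzweil_Integration.integral_diff[symmetric] integrable_continuous_real contT horizontal_continuous) auto
    also have "\<dots> = integral {-X..X} (\<lambda>x. \<Phi> (Complex x d) / (nodal_exp (Complex x d) - 1))"
    proof (rule integral_cong)
      fix x
      have "nodal_exp (Complex x d) - 1 \<noteq> 0" using bnd(3)[of "Complex x d"] d by simp
      then show "\<Phi> (Complex x d) * (nodal_exp (Complex x d) * inverse (nodal_exp (Complex x d) - 1)) - \<Phi> (Complex x d) = \<Phi> (Complex x d) / (nodal_exp (Complex x d) - 1)"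
        by (simp add: field_simps)
    qed
    finally show ?thesis by simp
  qed
  have side: "cmod (contour_integral (linepath (Complex x y1) (Complex x y2)) (\<lambda>w. \<Phi> w / (nodal_exp w - 1))) \<le> 2 * d * C * exp (- \<beta> * X)"
    if x: "\<bar>x\<bar> = X" and y: "{y1, y2} = {-d, d}" for x y1 y2
  proof -
    let ?s = "closed_segment (Complex x y1) (Complex x y2)"
    have seg: "Re w = x \<and> \<bar>Im w\<bar> \<le> d" if "w \<in> ?s" for w
      using that y d by (auto simp: closed_segment_same_Re closed_segment_eq_real_ivl doubleton_eq_iff split: if_splits)
    have E1: "nodal_exp w \<noteq> 1" if "w \<in> ?s" for w
    proof
      assume "nodal_exp w = 1"
      then obtain k :: int where "w = of_real (real_of_int k * h)" unfolding nodal_exp_eq_1 by blast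
      then have "\<bar>real_of_int k\<bar> * h = X" using seg[OF that] x h by (auto simp: abs_mult)
      then have "\<bar>real_of_int k\<bar> = real n + 1/2" using h by (simp add: X_def)
      then have "real_of_int (2 * \<bar>k\<bar>) = real_of_int (2 * int n + 1)" by simp
      then have "2 * \<bar>k\<bar> = 2 * int n + 1" by (simp only: of_int_eq_iff)
      then show False by presburger
    qed
    have bound: "cmod (\<Phi> w / (nodal_exp w - 1)) \<le> C * exp (- \<beta> * X)" if "w \<in> ?s" for w
    proof -
      have "cmod (\<Phi> w / (nodal_exp w - 1)) \<le> (C * exp (- \<beta> * X)) * 1"
        unfolding divide_inverse norm_mult using seg[OF that] decay[of w] bnd(4)[of w n] x C_nonneg
        by (intro mult_mono) (auto simp: X_def)
      then show ?thesis by simp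
    qed
    have "continuous_on ?s (\<lambda>w. \<Phi> w / (nodal_exp w - 1))"
      using E1 h seg d unfolding nodal_exp_def
      by (intro continuous_intros continuous_on_subset[OF holomorphic_on_imp_continuous_on[OF holo]]) force+
    then have "cmod (contour_integral (linepath (Complex x y1) (Complex x y2)) (\<lambda>w. \<Phi> w / (nodal_exp w - 1))) \<le>
        (C * exp (- \<beta> * X)) * cmod (Complex x y2 - Complex x y1)"
      using bound C_nonneg by (intro contour_integral_bound_linepath contour_integrable_continuous_linepath) auto
    also have "cmod (Complex x y2 - Complex x y1) = 2 * d"
    proof -
      have "Complex x y2 - Complex x y1 = \<i> * of_real (y2 - y1)" by (simp add: complex_eq_iff)
      then have "cmod (Complex x y2 - Complex x y1) = \<bar>y2 - y1\<bar>" by (simp only: norm_mult norm_ii norm_of_real mult_1_left)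
      then show ?thesis using y d by (auto simp: doubleton_eq_iff)
    qed
    finally show ?thesis by (simp add: mult_ac)
  qed
  let ?S1 = "contour_integral (linepath (Complex X (-d)) (Complex X d)) (\<lambda>w. \<Phi> w / (nodal_exp w - 1))"
  let ?S2 = "contour_integral (linepath (Complex (-X) d) (Complex (-X) (-d))) (\<lambda>w. \<Phi> w / (nodal_exp w - 1))"
  let ?Bt = "integral {-X..X} (\<lambda>x. \<Phi> (Complex x (-d)) / (nodal_exp (Complex x (-d)) - 1))"
  let ?Sh = "integral {-X..X} (\<lambda>x. \<Phi> (Complex x d)) - integral {-X..X} (\<lambda>x. \<Phi> (of_real x))"
  have eq: "of_real h * (\<Sum>k=-int n..int n. \<Phi> (of_real (real_of_int k * h))) - integral {-X..X} (\<lambda>x. \<Phi> (of_real x)) =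
     ?Bt + ?S1 - ?T + ?Sh + ?S2"
    unfolding rectangle_identity[of n, folded X_def] top_eq by simp
  have "cmod (?Bt + ?S1 - ?T + ?Sh + ?S2) \<le> cmod ?Bt + cmod ?S1 + cmod ?T + cmod ?Sh + cmod ?S2"
    by (intro order_trans[OF norm_triangle_ineq] order_trans[OF norm_triangle_ineq4] add_mono order_refl)
  also have "\<dots> \<le> C * (1 / (q - 1)) * (2 / \<beta>) + 2 * d * C * exp (- \<beta> * X) + C * (1 / (q - 1)) * (2 / \<beta>) +
      2 * (C * exp (- \<beta> * X) * d) + 2 * d * C * exp (- \<beta> * X)"
    using X by (intro add_mono bottom top side integral_shift_strip) auto
  also have "\<dots> = C * (4 / \<beta>) / (q - 1) + 6 * d * C * exp (- \<beta> * X)" by (simp add: field_simps)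
  finally show ?thesis unfolding eq by (simp only: q_def)
qed

text \<open>The rectangles grow to the whole strip; the nodes beyond \<open>N\<close> contribute the second term.\<close>

lemma trapezoidal_error:
  "cmod (of_real h * (\<Sum>k=-int N..int N. \<Phi> (of_real (real_of_int k * h))) - integral UNIV (\<lambda>x. \<Phi> (of_real x)))
     \<le> C * (4 / \<beta> / (exp (2 * pi * d / h) - 1) + 2 / \<beta> * exp (- \<beta> * (real N * h)))"
proof -
  define S where "S n = of_real h * (\<Sum>k=-int n..int n. \<Phi> (of_real (real_of_int k * h)))" for n :: nat
  define X where "X n = (real n + 1/2) * h" for n :: nat
  have int: "(\<lambda>x. \<Phi> (of_real x)) integrable_on UNIV"
  proof (rule integrable_UNIV_exp_bound(1)[OF _ \<beta>])
    show "continuous_on UNIV (\<lambda>x. \<Phi> (of_real x))"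
      using horizontal_continuous[of 0 UNIV] d by (simp add: complex_of_real_def)
    show "cmod (\<Phi> (of_real x)) \<le> C * exp (- \<beta> * \<bar>x\<bar>)" for x :: real using decay[of "of_real x"] d by simp
  qed
  have Xinf: "filterlim X at_top sequentially"
    unfolding X_def using h
    by (intro filterlim_at_top_mult_tendsto_pos[OF tendsto_const] filterlim_tendsto_add_at_top[OF tendsto_const, of _ _ "1/2", unfolded add.commute[of "1/2"]] filterlim_real_sequentially) auto
  have limI: "(\<lambda>n. integral {-X n..X n} (\<lambda>x. \<Phi> (of_real x))) \<longlonglongrightarrow> integral UNIV (\<lambda>x. \<Phi> (of_real x))"
    by (rule filterlim_compose[OF integral_UNIV_limit[OF int] Xinf])
  have tail: "cmod (S N - S n) \<le> 2 * C * exp (- \<beta> * (real N * h)) / \<beta>" if "N \<le> n" for n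
  proof -
    let ?f = "\<lambda>k. \<Phi> (of_real (real_of_int k * h))"
    have "h * norm ((\<Sum>k=-int n..int n. ?f k) - (\<Sum>k=-int N..int N. ?f k)) \<le>
           2 * C * (exp (- \<beta> * (real N * h)) - exp (- \<beta> * (real n * h))) / \<beta>"
    proof (rule truncated_sum_tail[OF \<beta> h C_nonneg _ that])
      show "norm (?f k) \<le> C * exp (- \<beta> * (\<bar>real_of_int k\<bar> * h))" for k
        using decay[of "of_real (real_of_int k * h)"] d h by (simp add: abs_mult)
    qed
    also have "\<dots> \<le> 2 * C * exp (- \<beta> * (real N * h)) / \<beta>"
      using \<beta> C_nonneg by (intro divide_right_mono mult_left_mono) auto
    finally have "h * norm ((\<Sum>k=-int n..int n. ?f k) - (\<Sum>k=-int N..int N. ?f k)) \<le> 2 * C * exp (- \<beta> * (real N * h)) / \<beta>" .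
    moreover have "cmod (S N - S n) = h * norm ((\<Sum>k=-int n..int n. ?f k) - (\<Sum>k=-int N..int N. ?f k))"
      unfolding S_def right_diff_distrib[symmetric] norm_mult using h by (simp add: norm_minus_commute)
    ultimately show ?thesis by simp
  qed
  have "cmod (S N - integral {-X n..X n} (\<lambda>x. \<Phi> (of_real x))) \<le>
      2 * C * exp (- \<beta> * (real N * h)) / \<beta> + (C * (4 / \<beta>) / (exp (2 * pi * d / h) - 1) + 6 * d * C * exp (- \<beta> * X n))"
    if "N \<le> n" for n
  proof -
    have "cmod (S N - integral {-X n..X n} (\<lambda>x. \<Phi> (of_real x))) \<le>
       cmod (S N - S n) + cmod (S n - integral {-X n..X n} (\<lambda>x. \<Phi> (of_real x)))"
      using norm_triangle_ineq[of "S N - S n" "S n - integral {-X n..X n} (\<lambda>x. \<Phi> (of_real x))"] by simp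
    also have "\<dots> \<le> 2 * C * exp (- \<beta> * (real N * h)) / \<beta> + (C * (4 / \<beta>) / (exp (2 * pi * d / h) - 1) + 6 * d * C * exp (- \<beta> * X n))"
      using tail[OF that] rectangle_error[of n] unfolding S_def X_def by (rule add_mono)
    finally show ?thesis .
  qed
  then have ev: "\<forall>\<^sub>F n in sequentially. cmod (S N - integral {-X n..X n} (\<lambda>x. \<Phi> (of_real x))) \<le>
      2 * C * exp (- \<beta> * (real N * h)) / \<beta> + (C * (4 / \<beta>) / (exp (2 * pi * d / h) - 1) + 6 * d * C * exp (- \<beta> * X n))"
    using eventually_ge_at_top[of N] by (rule eventually_mono[rotated]) auto
  have bX: "filterlim (\<lambda>n. \<beta> * X n) at_top sequentially"
    by (rule filterlim_tendsto_pos_mult_at_top[OF tendsto_const \<beta> Xinf])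
  have "(\<lambda>n. exp (- \<beta> * X n)) \<longlonglongrightarrow> 0"
    using filterlim_compose[OF exp_at_bot filterlim_compose[OF filterlim_uminus_at_bot_at_top bX]] by simp
  then have rhs: "(\<lambda>n. 2 * C * exp (- \<beta> * (real N * h)) / \<beta> + (C * (4 / \<beta>) / (exp (2 * pi * d / h) - 1) + 6 * d * C * exp (- \<beta> * X n)))
      \<longlonglongrightarrow> 2 * C * exp (- \<beta> * (real N * h)) / \<beta> + (C * (4 / \<beta>) / (exp (2 * pi * d / h) - 1) + 6 * d * C * 0)"
    by (intro tendsto_intros)
  have lhs: "(\<lambda>n. cmod (S N - integral {-X n..X n} (\<lambda>x. \<Phi> (of_real x)))) \<longlonglongrightarrow> cmod (S N - integral UNIV (\<lambda>x. \<Phi> (of_real x)))"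
    by (intro tendsto_intros limI)
  have "cmod (S N - integral UNIV (\<lambda>x. \<Phi> (of_real x))) \<le>
     2 * C * exp (- \<beta> * (real N * h)) / \<beta> + (C * (4 / \<beta>) / (exp (2 * pi * d / h) - 1) + 6 * d * C * 0)"
    by (rule tendsto_le[OF _ rhs lhs ev]) simp
  then show ?thesis by (simp add: S_def algebra_simps)
qed

end

text \<open>The rule is applied in \<open>\<xi>\<close> for each fixed real \<open>\<eta>\<close> and the error integrated over \<open>\<eta>\<close>, then in \<open>\<eta>\<close> at each node \<open>\<xi> = k h\<close> and the errors summed;
the order of integration is kept throughout.\<close>

lemma trapezoidal_error_double:
  fixes \<Psi> :: "complex \<Rightarrow> complex \<Rightarrow> complex"
  assumes d: "0 < d" "d < d0" and \<beta>: "\<beta> > 0" and h: "h > 0"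
    and holo1: "\<And>\<eta>::real. (\<lambda>\<xi>. \<Psi> \<xi> (of_real \<eta>)) holomorphic_on {w. \<bar>Im w\<bar> < d0}"
    and decay1: "\<And>\<xi> \<eta>. \<bar>Im \<xi>\<bar> \<le> d \<Longrightarrow> cmod (\<Psi> \<xi> (of_real \<eta>)) \<le> C * exp (- \<beta> * \<bar>\<eta>\<bar>) * exp (- \<beta> * \<bar>Re \<xi>\<bar>)"
    and holo2: "\<And>\<xi>::real. (\<lambda>\<eta>. \<Psi> (of_real \<xi>) \<eta>) holomorphic_on {w. \<bar>Im w\<bar> < d0}"
    and decay2: "\<And>\<xi> \<eta>. \<bar>Im \<eta>\<bar> \<le> d \<Longrightarrow> cmod (\<Psi> (of_real \<xi>) \<eta>) \<le> C * exp (- \<beta> * \<bar>\<xi>\<bar>) * exp (- \<beta> * \<bar>Re \<eta>\<bar>)"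
    and J: "continuous_on UNIV (\<lambda>\<eta>::real. integral UNIV (\<lambda>\<xi>::real. \<Psi> (of_real \<xi>) (of_real \<eta>)))"
  shows "cmod (of_real h * (of_real h * (\<Sum>k=-int N..int N. \<Sum>p=-int N..int N. \<Psi> (of_real (real_of_int k * h)) (of_real (real_of_int p * h))))
            - integral UNIV (\<lambda>\<eta>::real. integral UNIV (\<lambda>\<xi>::real. \<Psi> (of_real \<xi>) (of_real \<eta>))))
         \<le> C * (4 / \<beta> / (exp (2 * pi * d / h) - 1) + 2 / \<beta> * exp (- \<beta> * (real N * h))) * (4 / \<beta> + h)"
proof -
  define \<epsilon> where "\<epsilon> = 4 / \<beta> / (exp (2 * pi * d / h) - 1) + 2 / \<beta> * exp (- \<beta> * (real N * h))"
  define nd :: "int \<Rightarrow> complex" where "nd k = of_real (real_of_int k * h)" for k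
  define S where "S \<eta> = of_real h * (\<Sum>k=-int N..int N. \<Psi> (nd k) (of_real \<eta>))" for \<eta> :: real
  let ?J = "\<lambda>\<eta>::real. integral UNIV (\<lambda>\<xi>::real. \<Psi> (of_real \<xi>) (of_real \<eta>))"
  have C: "C \<ge> 0" using order_trans[OF norm_ge_zero decay1[of 0 0]] d by simp
  have e: "\<epsilon> \<ge> 0" using \<beta> d h by (simp add: \<epsilon>_def)
  have err1: "cmod (S \<eta> - ?J \<eta>) \<le> (C * \<epsilon>) * exp (- \<beta> * \<bar>\<eta>\<bar>)" for \<eta>
    using trapezoidal_error[OF d \<beta> h holo1 decay1, of \<eta> N] by (simp add: S_def nd_def \<epsilon>_def mult_ac)
  have err2: "cmod (of_real h * (\<Sum>p=-int N..int N. \<Psi> (of_real \<xi>) (nd p)) - integral UNIV (\<lambda>\<eta>::real. \<Psi> (of_real \<xi>) (of_real \<eta>)))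
      \<le> C * exp (- \<beta> * \<bar>\<xi>\<bar>) * \<epsilon>" for \<xi> :: real
    using trapezoidal_error[OF d \<beta> h holo2 decay2, of \<xi> N] by (simp add: nd_def \<epsilon>_def)
  have contk: "continuous_on UNIV (\<lambda>\<eta>::real. \<Psi> (of_real \<xi>) (of_real \<eta>))" for \<xi> :: real
    by (rule continuous_on_compose2[OF holomorphic_on_imp_continuous_on[OF holo2]])
       (use d in \<open>auto intro!: continuous_intros\<close>)
  have intk: "(\<lambda>\<eta>::real. \<Psi> (of_real \<xi>) (of_real \<eta>)) integrable_on UNIV" for \<xi> :: real
    by (rule integrable_UNIV_exp_bound(1)[OF contk \<beta>]) (use decay2[of "of_real _" \<xi>] d in simp)
  have contS: "continuous_on UNIV S"
    unfolding S_def nd_def by (intro continuous_intros contk)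
  have intS: "S integrable_on UNIV"
    unfolding S_def nd_def by (intro integrable_on_mult_right integrable_sum intk) auto
  have Jb: "cmod (?J \<eta>) \<le> (C * (2 / \<beta>)) * exp (- \<beta> * \<bar>\<eta>\<bar>)" for \<eta>
  proof -
    have "continuous_on UNIV (\<lambda>\<xi>::real. \<Psi> (of_real \<xi>) (of_real \<eta>))"
      by (rule continuous_on_compose2[OF holomorphic_on_imp_continuous_on[OF holo1]])
         (use d in \<open>auto intro!: continuous_intros\<close>)
    then have "cmod (?J \<eta>) \<le> (C * exp (- \<beta> * \<bar>\<eta>\<bar>)) * (2 / \<beta>)"
      by (rule integrable_UNIV_exp_bound(2)[OF _ \<beta>]) (use decay1[of "of_real _" \<eta>] d in simp)
    then show ?thesis by (simp add: mult_ac)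
  qed
  have intJ: "?J integrable_on UNIV" by (rule integrable_UNIV_exp_bound(1)[OF J \<beta> Jb])
  have "cmod (integral UNIV (\<lambda>\<eta>. S \<eta> - ?J \<eta>)) \<le> (C * \<epsilon>) * (2 / \<beta>)"
    by (rule integrable_UNIV_exp_bound(2)[OF _ \<beta> err1]) (intro continuous_intros contS J)
  then have A: "cmod (integral UNIV S - integral UNIV ?J) \<le> (C * \<epsilon>) * (2 / \<beta>)"
    by (simp only: Henstock_Kurzweil_Integration.integral_diff[OF intS intJ])
  have Sint: "integral UNIV S = of_real h * (\<Sum>k=-int N..int N. integral UNIV (\<lambda>\<eta>::real. \<Psi> (nd k) (of_real \<eta>)))"
  proof -
    have "(\<lambda>\<eta>::real. \<Psi> (nd k) (of_real \<eta>)) integrable_on UNIV" for k unfolding nd_def by (rule intk)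
    then show ?thesis unfolding S_def by (subst integral_mult_right, subst integral_sum) auto
  qed
  have sumexp: "h * (\<Sum>k=-int N..int N. exp (- \<beta> * (\<bar>real_of_int k\<bar> * h))) \<le> h + 2 / \<beta>"
  proof -
    let ?s = "\<Sum>k=-int N..int N. exp (- \<beta> * (\<bar>real_of_int k\<bar> * h))"
    have "h * norm (?s - (\<Sum>k=-int 0..int 0. exp (- \<beta> * (\<bar>real_of_int k\<bar> * h)))) \<le>
        2 * 1 * (exp (- \<beta> * (real 0 * h)) - exp (- \<beta> * (real N * h))) / \<beta>"
      by (rule truncated_sum_tail[OF \<beta> h]) auto
    then have "h * \<bar>?s - 1\<bar> \<le> 2 * (1 - exp (- \<beta> * (real N * h))) / \<beta>" by simp
    also have "\<dots> \<le> 2 * 1 / \<beta>" using \<beta> by (intro divide_right_mono mult_left_mono) auto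
    finally have "h * \<bar>?s - 1\<bar> \<le> 2 / \<beta>" by simp
    moreover have "h * (?s - 1) \<le> h * \<bar>?s - 1\<bar>" using h by (intro mult_left_mono) auto
    ultimately show ?thesis by (simp add: right_diff_distrib)
  qed
  let ?D = "of_real h * (of_real h * (\<Sum>k=-int N..int N. \<Sum>p=-int N..int N. \<Psi> (nd k) (nd p)))"
  have "?D - integral UNIV S = of_real h * (\<Sum>k=-int N..int N. of_real h * (\<Sum>p=-int N..int N. \<Psi> (nd k) (nd p)) -
      integral UNIV (\<lambda>\<eta>::real. \<Psi> (nd k) (of_real \<eta>)))"
    unfolding Sint by (simp add: sum_subtractf sum_distrib_left right_diff_distrib)
  then have "cmod (?D - integral UNIV S) = h * cmod (\<Sum>k=-int N..int N. of_real h * (\<Sum>p=-int N..int N. \<Psi> (nd k) (nd p)) -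
      integral UNIV (\<lambda>\<eta>::real. \<Psi> (nd k) (of_real \<eta>)))"
    using h by (simp add: norm_mult)
  also have "\<dots> \<le> h * (\<Sum>k=-int N..int N. (C * \<epsilon>) * exp (- \<beta> * (\<bar>real_of_int k\<bar> * h)))"
  proof (intro mult_left_mono sum_norm_le)
    fix k
    show "cmod (of_real h * (\<Sum>p=-int N..int N. \<Psi> (nd k) (nd p)) - integral UNIV (\<lambda>\<eta>::real. \<Psi> (nd k) (of_real \<eta>)))
       \<le> (C * \<epsilon>) * exp (- \<beta> * (\<bar>real_of_int k\<bar> * h))"
      using err2[of "real_of_int k * h", folded nd_def] h by (simp add: abs_mult mult_ac)
  qed (use h in simp)
  also have "\<dots> = (C * \<epsilon>) * (h * (\<Sum>k=-int N..int N. exp (- \<beta> * (\<bar>real_of_int k\<bar> * h))))"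
    by (simp only: sum_distrib_left[symmetric] mult.left_commute)
  also have "\<dots> \<le> (C * \<epsilon>) * (h + 2 / \<beta>)" using sumexp C e by (intro mult_left_mono) auto
  finally have B: "cmod (?D - integral UNIV S) \<le> (C * \<epsilon>) * (h + 2 / \<beta>)" .
  have "cmod (?D - integral UNIV ?J) \<le> cmod (?D - integral UNIV S) + cmod (integral UNIV S - integral UNIV ?J)"
    using norm_triangle_ineq[of "?D - integral UNIV S" "integral UNIV S - integral UNIV ?J"] by simp
  also have "\<dots> \<le> (C * \<epsilon>) * (h + 2 / \<beta>) + (C * \<epsilon>) * (2 / \<beta>)" by (rule add_mono[OF B A])
  also have "\<dots> = C * \<epsilon> * (4 / \<beta> + h)" by (simp add: algebra_simps)
  finally show ?thesis by (simp add: nd_def \<epsilon>_def)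
qed

text \<open>With \<open>h = c0 / sqrt N\<close> the discretization error and the truncation error are both of order \<open>exp (- c * sqrt N)\<close>.\<close>

lemma balanced_step_error:
  fixes d \<beta> c0 :: real
  assumes "d > 0" "\<beta> > 0" "c0 > 0"
  obtains K c1 where "K > 0" "c1 > 0" "\<And>N. N \<ge> 1 \<Longrightarrow>
     4 / \<beta> / (exp (2 * pi * d / (c0 / sqrt (real N))) - 1) + 2 / \<beta> * exp (- \<beta> * (real N * (c0 / sqrt (real N)))) \<le> K * exp (- c1 * sqrt (real N))"
proof -
  define a where "a = 2 * pi * d / c0"
  define c1 where "c1 = min a (\<beta> * c0)"
  define K where "K = 4 / \<beta> / (1 - exp (- a)) + 2 / \<beta>"
  have a: "a > 0" using assms by (simp add: a_def)
  have ea: "exp (- a) < 1" using a by simp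
  show thesis
  proof (rule that[of K c1])
    show "K > 0" using assms ea by (simp add: K_def add_pos_pos)
    show "c1 > 0" using a assms by (simp add: c1_def)
    fix N :: nat assume N: "N \<ge> 1"
    let ?s = "sqrt (real N)"
    have s: "?s \<ge> 1" using N by simp
    have 1: "2 * pi * d / (c0 / ?s) = a * ?s" by (simp add: a_def)
    have 2: "\<beta> * (real N * (c0 / ?s)) = \<beta> * c0 * ?s"
      using s by (simp add: real_div_sqrt field_simps)
    have c1le: "exp (- (a * ?s)) \<le> exp (- c1 * ?s)" "exp (- (\<beta> * c0 * ?s)) \<le> exp (- c1 * ?s)"
      using s by (auto simp: c1_def intro!: mult_right_mono)
    have "1 / (exp (a * ?s) - 1) = exp (- (a * ?s)) / (1 - exp (- (a * ?s)))"
      by (simp add: exp_minus field_simps)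
    also have "\<dots> \<le> exp (- c1 * ?s) / (1 - exp (- a))"
    proof (rule frac_le)
      have "a * 1 \<le> a * ?s" using a s by (intro mult_left_mono) auto
      then show "1 - exp (- a) \<le> 1 - exp (- (a * ?s))" by simp
    qed (use ea c1le in auto)
    finally have "4 / \<beta> * (1 / (exp (a * ?s) - 1)) \<le> 4 / \<beta> * (exp (- c1 * ?s) / (1 - exp (- a)))"
      using assms by (intro mult_left_mono) auto
    moreover have "2 / \<beta> * exp (- (\<beta> * c0 * ?s)) \<le> 2 / \<beta> * exp (- c1 * ?s)"
      using assms by (intro mult_left_mono c1le) auto
    ultimately have "4 / \<beta> / (exp (a * ?s) - 1) + 2 / \<beta> * exp (- (\<beta> * c0 * ?s)) \<le> K * exp (- c1 * ?s)"
      by (simp add: K_def distrib_right)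
    then show "4 / \<beta> / (exp (2 * pi * d / (c0 / ?s)) - 1) + 2 / \<beta> * exp (- \<beta> * (real N * (c0 / ?s))) \<le> K * exp (- c1 * ?s)"
      by (simp only: 1 2 mult_minus_left)
  qed
qed

section \<open>The inner substitution\<close>

text \<open>The substitution \<open>s = T / (1 + exp (- 2 \<eta>)) = T/2 (1 + tanh \<eta>)\<close> maps the line onto \<open>(0, T)\<close> and a narrow strip into a
  narrow sector at each end point.\<close>

lemma tanh_logistic: "1 + tanh x = 2 / (1 + exp (- 2 * x))" "1 - tanh x = 2 / (1 + exp (2 * x))" for x :: real
proof -
  have "exp x > 0" by simp
  have p: "exp x + exp (- x) > 0" by (simp add: add_pos_pos)
  have e: "exp (- 2 * x) = exp (- x) / exp x" "exp (2 * x) = exp x / exp (- x)"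
    by (simp_all add: exp_diff[symmetric])
  have t: "tanh x = (exp x - exp (- x)) / (exp x + exp (- x))" by (simp add: tanh_altdef)
  show "1 + tanh x = 2 / (1 + exp (- 2 * x))" unfolding e t using p
    by (simp add: field_simps add_nonneg_eq_0_iff)
  show "1 - tanh x = 2 / (1 + exp (2 * x))" unfolding e t using p
    by (simp add: field_simps add_nonneg_eq_0_iff)
qed

lemma one_plus_exp_le_cosh: "1 + exp (2 * x) \<le> 4 * (cosh x)\<^sup>2" for x :: real
proof -
  have "exp (2 * x) = exp x * exp x" by (simp add: exp_add[symmetric])
  moreover have "exp x * exp (- x) = 1" by (simp add: exp_add[symmetric])
  moreover have "4 * (cosh x)\<^sup>2 = exp x * exp x + 2 * (exp x * exp (- x)) + exp (- x) * exp (- x)"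
    by (simp add: cosh_def power2_eq_square field_simps)
  ultimately show ?thesis by simp
qed

lemma exp_le_inverse_sqrt: "exp (- u) \<le> 1 / sqrt u" if "u > 0" for u :: real
proof -
  have "sqrt u \<le> 1 + u"
    using that by (intro real_le_lsqrt) (auto simp: power2_eq_square algebra_simps)
  also have "\<dots> \<le> exp u" by (rule exp_ge_add_one_self)
  finally show ?thesis using that by (simp add: exp_minus field_simps)
qed

lemma sectorI:
  assumes "Re w > 0" "\<bar>Im w\<bar> < tan \<phi> * Re w" "0 < \<phi>" "\<phi> < pi / 2"
  shows "w \<in> sector 0 \<phi> - {0}"
proof
  define x where "x = Im w / Re w"
  have x: "\<bar>x\<bar> < tan \<phi>" using assms by (simp add: x_def abs_divide field_simps)
  have "arctan x < arctan (tan \<phi>)" "arctan (- x) < arctan (tan \<phi>)" using x by (simp_all only: arctan_less_iff)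
  moreover have "arctan (tan \<phi>) = \<phi>" using assms by (intro arctan_tan) auto
  ultimately have a: "\<bar>arctan x\<bar> < \<phi>" by (simp add: arctan_minus abs_less_iff)
  have s: "sqrt (1 + x\<^sup>2) > 0" by (simp add: add_pos_nonneg)
  have "exp (\<i> * of_real (arctan x)) = Complex (cos (arctan x)) (sin (arctan x))"
    by (metis cis_conv_exp cis.ctr)
  then have "of_real 0 + of_real (Re w * sqrt (1 + x\<^sup>2)) * exp (\<i> * of_real (arctan x)) = w"
    using s assms(1) by (simp add: complex_eq_iff cos_arctan sin_arctan) (simp add: x_def)
  moreover have "0 \<le> Re w * sqrt (1 + x\<^sup>2)" using s assms by simp
  ultimately show "w \<in> sector 0 \<phi>" unfolding sector_def using a by (metis (mono_tags, lifting) mem_Collect_eq)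
  show "w \<notin> {0}" using assms by auto
qed

text \<open>Multiplication by \<open>1 / (1 + exp (2 \<zeta>))\<close> turns \<open>z\<close> by an angle of at most \<open>2 \<bar>Im \<zeta>\<bar>\<close>.  The condition on \<open>2 Im \<zeta>\<close>, with \<open>t\<close> the tangent of
the largest argument of \<open>z\<close>, keeps the product in the right half plane with a definite part of its size.\<close>

lemma logistic_rotation:
  fixes \<zeta> z :: complex and T t :: real
  assumes T: "T > 0" and y: "1/2 \<le> cos (2 * Im \<zeta>) - t * \<bar>sin (2 * Im \<zeta>)\<bar>" "t \<ge> 0"
    and z: "\<bar>Im z\<bar> \<le> t * Re z" "0 \<le> Re z"
  shows "Re z * (T / (2 * (1 + exp (2 * Re \<zeta>)))) \<le> Re (z * (of_real T / (1 + exp (2 * \<zeta>))))"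
    "1 + exp (2 * \<zeta>) \<noteq> 0"
proof -
  define e where "e = exp (2 * Re \<zeta>)"
  define w where "w = 1 + exp (2 * \<zeta>)"
  have e: "e > 0" by (simp add: e_def)
  have w: "Re w = 1 + e * cos (2 * Im \<zeta>)" "Im w = e * sin (2 * Im \<zeta>)"
    by (simp_all add: w_def e_def Re_exp Im_exp)
  have c: "cos (2 * Im \<zeta>) \<ge> 1/2" using y mult_nonneg_nonneg[OF y(2) abs_ge_zero[of "sin (2 * Im \<zeta>)"]] by linarith
  have "0 < e * cos (2 * Im \<zeta>)" using e c by (intro mult_pos_pos) linarith+
  then have "Re w > 0" using w by simp
  then show w0: "1 + exp (2 * \<zeta>) \<noteq> 0" unfolding w_def[symmetric] by auto
  have cw: "cmod w \<le> 1 + e" using norm_triangle_ineq[of 1 "exp (2 * \<zeta>)"] by (simp add: w_def e_def)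
  have cw0: "cmod w > 0" using w0 by (simp add: w_def)
  have "Re z * ((1 + e) / 2) \<le> Re z * (1 + e * (cos (2 * Im \<zeta>) - t * \<bar>sin (2 * Im \<zeta>)\<bar>))"
  proof (rule mult_left_mono[OF _ z(2)])
    have "e * (1/2) \<le> e * (cos (2 * Im \<zeta>) - t * \<bar>sin (2 * Im \<zeta>)\<bar>)" using e y by (intro mult_left_mono) auto
    then show "(1 + e) / 2 \<le> 1 + e * (cos (2 * Im \<zeta>) - t * \<bar>sin (2 * Im \<zeta>)\<bar>)" by simp
  qed
  also have "\<dots> = Re z * Re w - (t * Re z) * (e * \<bar>sin (2 * Im \<zeta>)\<bar>)" by (simp add: w algebra_simps)
  also have "\<dots> \<le> Re z * Re w - \<bar>Im z\<bar> * (e * \<bar>sin (2 * Im \<zeta>)\<bar>)"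
    using e z by (intro diff_left_mono mult_right_mono) auto
  also have "\<dots> = Re z * Re w - \<bar>Im z * Im w\<bar>" using e by (simp add: w abs_mult)
  also have "\<dots> \<le> Re z * Re w + Im z * Im w" by linarith
  finally have key: "Re z * ((1 + e) / 2) \<le> Re z * Re w + Im z * Im w" .
  have "Re z * (T / (2 * (1 + e))) = T * (Re z * ((1 + e) / 2)) / (1 + e)\<^sup>2"
  proof -
    have gen: "Re z * (T / (2 * u)) = T * (Re z * (u / 2)) / u\<^sup>2" if "u > 0" for u
      using that by (simp add: power2_eq_square)
    show ?thesis by (rule gen) (use e in simp)
  qed
  also have "\<dots> \<le> T * (Re z * ((1 + e) / 2)) / (cmod w)\<^sup>2"
    using T z e cw cw0 by (intro divide_left_mono power_mono mult_nonneg_nonneg) auto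
  also have "\<dots> \<le> T * (Re z * Re w + Im z * Im w) / (cmod w)\<^sup>2"
    using T key by (intro divide_right_mono mult_left_mono) auto
  also have "\<dots> = Re (z * (of_real T / w))"
    by (simp add: Re_divide Im_divide cmod_power2 add_divide_distrib[symmetric]) (simp add: algebra_simps)
  finally show "Re z * (T / (2 * (1 + exp (2 * Re \<zeta>)))) \<le> Re (z * (of_real T / (1 + exp (2 * \<zeta>))))"
    by (simp add: w_def e_def)
qed

text \<open>The argument of \<open>1 + exp (- 2 \<zeta>)\<close> is at most \<open>2 \<bar>Im \<zeta>\<bar>\<close> in absolute value.\<close>

lemma logistic_in_sector:
  fixes \<zeta> :: complex
  assumes T: "T > 0" and y: "2 * \<bar>Im \<zeta>\<bar> < \<phi>" and \<phi>: "0 < \<phi>" "\<phi> < pi / 2"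
  shows "of_real T / (1 + exp (- 2 * \<zeta>)) \<in> sector 0 \<phi> - {0}"
proof -
  define e where "e = exp (- 2 * Re \<zeta>)"
  define w where "w = 1 + exp (- 2 * \<zeta>)"
  have e: "e > 0" by (simp add: e_def)
  have w: "Re w = 1 + e * cos (2 * Im \<zeta>)" "Im w = - (e * sin (2 * Im \<zeta>))"
    by (simp_all add: w_def e_def Re_exp Im_exp)
  have c: "cos (2 * Im \<zeta>) > 0" using y \<phi> by (intro cos_gt_zero_pi) auto
  have ct: "cos \<phi> > 0" using \<phi> by (intro cos_gt_zero_pi) auto
  have sn: "\<bar>sin (2 * Im \<zeta>)\<bar> < tan \<phi> * cos (2 * Im \<zeta>)"
  proof -
    have "\<bar>sin (2 * Im \<zeta>)\<bar> = sin (2 * \<bar>Im \<zeta>\<bar>)"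
    proof -
      have "0 \<le> sin (2 * \<bar>Im \<zeta>\<bar>)" using y \<phi> by (intro sin_ge_zero) auto
      then show ?thesis by (cases "Im \<zeta> \<ge> 0") auto
    qed
    moreover have "cos (2 * Im \<zeta>) = cos (2 * \<bar>Im \<zeta>\<bar>)" by (cases "Im \<zeta> \<ge> 0") auto
    moreover have "0 < sin (\<phi> - 2 * \<bar>Im \<zeta>\<bar>)" using y \<phi> by (intro sin_gt_zero) auto
    ultimately show ?thesis using ct by (simp add: sin_diff tan_def field_simps)
  qed
  have Rw: "Re w > 0" unfolding w using e c by (simp add: add_pos_pos)
  have "\<bar>Im w\<bar> = e * \<bar>sin (2 * Im \<zeta>)\<bar>" using e by (simp add: w abs_mult)
  also have "\<dots> < e * (tan \<phi> * cos (2 * Im \<zeta>))" using e sn by (intro mult_strict_left_mono)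
  also have "\<dots> \<le> tan \<phi> * Re w" using tan_gt_zero[OF \<phi>] by (simp add: w algebra_simps)
  finally have Iw: "\<bar>Im w\<bar> < tan \<phi> * Re w" .
  have cw: "(cmod w)\<^sup>2 > 0" using Rw by (auto simp: zero_less_power)
  have R: "Re (of_real T / w) = T / (cmod w)\<^sup>2 * Re w" "Im (of_real T / w) = - (T / (cmod w)\<^sup>2 * Im w)"
    by (simp_all add: Re_divide Im_divide cmod_power2)
  have Tc: "T / (cmod w)\<^sup>2 > 0" using T cw by simp
  have "T / (cmod w)\<^sup>2 * \<bar>Im w\<bar> < T / (cmod w)\<^sup>2 * (tan \<phi> * Re w)"
    by (rule mult_strict_left_mono[OF Iw Tc])
  then have "\<bar>Im (of_real T / w)\<bar> < tan \<phi> * Re (of_real T / w)"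
    unfolding R using Tc by (simp only: abs_minus_cancel abs_mult abs_of_pos mult_ac)
  moreover have "Re (of_real T / w) > 0" unfolding R using Tc Rw by (rule mult_pos_pos)
  ultimately show ?thesis unfolding w_def[symmetric] using \<phi> by (intro sectorI)
qed

section \<open>The integrand of the double quadrature\<close>

lemma holomorphic_vec_on_functional:
  fixes F :: "complex \<Rightarrow> 'a::complex_banach" and L :: "'a \<Rightarrow> complex"
  assumes F: "F holomorphic_vec_on S" and L: "bounded_linear L" "\<And>c x. L (c *\<^sub>C x) = c * L x"
  shows "(\<lambda>w. L (F w)) holomorphic_on S"
  unfolding holomorphic_on_def field_differentiable_def
proof
  fix w assume "w \<in> S"
  then obtain F' where "((\<lambda>v. inverse (v - w) *\<^sub>C (F v - F w)) \<longlongrightarrow> F') (at w within S)"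
    using F unfolding holomorphic_vec_on_def by blast
  then have "((\<lambda>v. L (inverse (v - w) *\<^sub>C (F v - F w))) \<longlongrightarrow> L F') (at w within S)"
    by (rule bounded_linear.tendsto[OF L(1)])
  then show "\<exists>f'. ((\<lambda>w. L (F w)) has_field_derivative f') (at w within S)"
    by (auto simp: has_field_derivative_iff L(2) linear_diff[OF bounded_linear.linear[OF L(1)]] divide_inverse mult.commute)
qed

lemma holomorphic_vec_on_continuous:
  fixes F :: "complex \<Rightarrow> 'a::complex_banach"
  assumes F: "F holomorphic_vec_on S"
  shows "continuous_on S F"
  unfolding continuous_on_eq_continuous_within
proof
  fix w assume "w \<in> S"
  then obtain F' where "((\<lambda>v. inverse (v - w) *\<^sub>C (F v - F w)) \<longlongrightarrow> F') (at w within S)"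
    using F unfolding holomorphic_vec_on_def by blast
  then have "((\<lambda>v. (v - w) *\<^sub>C inverse (v - w) *\<^sub>C (F v - F w)) \<longlongrightarrow> (w - w) *\<^sub>C F') (at w within S)"
    by (intro tendsto_intros)
  then have lim: "((\<lambda>v. (v - w) *\<^sub>C inverse (v - w) *\<^sub>C (F v - F w)) \<longlongrightarrow> 0) (at w within S)" by simp
  have "((\<lambda>v. F v - F w) \<longlongrightarrow> 0) (at w within S)"
    by (rule Lim_transform_eventually[OF lim]) (auto simp: eventually_at_filter scaleC_scaleC)
  then show "continuous (at w within S) F"
    unfolding continuous_within by (rule Lim_null[THEN iffD2])
qed

text \<open>The integrand of the solution need not have limits at the end points.  Its primitive is Lipschitz continuous and so extends to the closed
interval, where the fundamental theorem of calculus gives integrability and the value of the integral.\<close>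

lemma bounded_continuous_interior_primitive:
  fixes v :: "real \<Rightarrow> 'a::banach"
  assumes ab: "a < b" and v: "continuous_on {a<..<b} v" "\<And>s. s \<in> {a<..<b} \<Longrightarrow> norm (v s) \<le> V"
  obtains P where "continuous_on {a..b} P" "\<And>s. s \<in> {a<..<b} \<Longrightarrow> (P has_vector_derivative v s) (at s)"
proof -
  define c where "c = (a + b) / 2"
  have c: "a < c" "c < b" using ab by (auto simp: c_def)
  define P0 where "P0 x = (if c \<le> x then integral {c..x} v else - integral {x..c} v)" for x
  have vi: "v integrable_on {x..y}" if "a < x" "y < b" for x y
    by (intro integrable_continuous_real continuous_on_subset[OF v(1)]) (use that in auto)
  have split: "P0 y - P0 x = integral {x..y} v" if "a < x" "x \<le> y" "y < b" for x y
  proof -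
    consider "c \<le> x" | "x < c" "c \<le> y" | "y < c" by linarith
    then show ?thesis
    proof cases
      case 1
      then show ?thesis using that c Henstock_Kurzweil_Integration.integral_combine[of c x y v] vi[of c y]
        by (simp add: P0_def algebra_simps)
    next
      case 2
      then show ?thesis using that c Henstock_Kurzweil_Integration.integral_combine[of x c y v] vi[of x y]
        by (simp add: P0_def algebra_simps)
    next
      case 3
      then show ?thesis using that c Henstock_Kurzweil_Integration.integral_combine[of x y c v] vi[of x c]
        by (simp add: P0_def algebra_simps)
    qed
  qed
  have V: "V \<ge> 0" using order_trans[OF norm_ge_zero v(2)[of c]] c by simp
  have lip1: "norm (P0 y - P0 x) \<le> V * (y - x)" if "a < x" "x \<le> y" "y < b" for x y
    unfolding split[OF that]
    by (rule integral_bound) (use that v(2) in \<open>auto intro: continuous_on_subset[OF v(1)]\<close>)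
  have lip: "dist (P0 x) (P0 y) \<le> V * dist x y" if "x \<in> {a<..<b}" "y \<in> {a<..<b}" for x y
    using lip1[of x y] lip1[of y x] that by (cases "x \<le> y") (auto simp: dist_norm norm_minus_commute)
  have "uniformly_continuous_on {a<..<b} P0"
    by (rule lipschitz_on_uniformly_continuous[of V]) (use lip V in \<open>auto simp: lipschitz_on_def\<close>)
  then obtain P where P: "uniformly_continuous_on (closure {a<..<b}) P" "\<And>x. x \<in> {a<..<b} \<Longrightarrow> P0 x = P x"
    using uniformly_continuous_on_extension_on_closure[of "{a<..<b}" P0] by metis
  have "(P has_vector_derivative v s) (at s)" if s: "s \<in> {a<..<b}" for s
  proof -
    have "open {a<..<b}" by simp
    then obtain e where e: "e > 0" "cball s e \<subseteq> {a<..<b}"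
      using s unfolding open_contains_cball by blast
    define x0 where "x0 = s - e"
    define x1 where "x1 = s + e"
    have x: "a < x0" "x0 < s" "s < x1" "x1 < b"
      using e by (auto simp: x0_def x1_def subset_iff dist_real_def)
    have "((\<lambda>x. integral {x0..x} v) has_vector_derivative v s) (at s within {x0..x1})"
      by (rule integral_has_vector_derivative) (use x in \<open>auto intro: continuous_on_subset[OF v(1)]\<close>)
    then have "((\<lambda>x. integral {x0..x} v) has_vector_derivative v s) (at s within {x0<..<x1})"
      by (rule has_vector_derivative_within_subset) auto
    then have "((\<lambda>x. integral {x0..x} v) has_vector_derivative v s) (at s)"
      using x by (simp add: at_within_open[of s "{x0<..<x1}"])
    then have "((\<lambda>x. P0 x0 + integral {x0..x} v) has_vector_derivative v s) (at s)"
      by (auto intro!: derivative_eq_intros)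
    then show ?thesis
    proof (rule has_vector_derivative_transform_within_open[of _ _ _ "{x0<..<x1}"])
      fix y assume "y \<in> {x0<..<x1}"
      then show "P0 x0 + integral {x0..y} v = P y"
        using split[of x0 y] P(2)[of y] x by (simp add: algebra_simps)
    qed (use x in auto)
  qed
  moreover have "continuous_on {a..b} P"
    using uniformly_continuous_imp_continuous[OF P(1)] ab by simp
  ultimately show thesis using that by blast
qed

context sectorial_nonlocal
begin

text \<open>Both strips have half-width \<open>d0\<close>.  The condition \<open>tilt\<close> keeps the hyperbolas that arise by shifting \<open>\<xi>\<close> between the line
\<open>Re z = r0\<close> and the sector; \<open>narrow\<close> keeps the substituted variable in the sector in which \<open>F\<close> is holomorphic, and the real part of
\<open>z (T - s)\<close> positive.\<close>

context
  fixes T V d0 :: real and F :: "complex \<Rightarrow> 'a"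
  assumes T: "T > 0"
    and F: "F holomorphic_vec_on (sector 0 \<phi> - {0})" "\<And>w. w \<in> sector 0 \<phi> - {0} \<Longrightarrow> norm (F w) \<le> V"
    and d0: "d0 > 0"
    and tilt: "\<And>y. \<bar>y\<bar> < d0 \<Longrightarrow> \<phi> \<le> \<psi> - y \<and> \<psi> - y < pi / 2 \<and> r0 < \<kappa> * cos (\<psi> - y) \<and> \<kappa> * cos (\<psi> - y) < \<rho>\<^sub>0"
    and narrow: "\<And>y. \<bar>y\<bar> < d0 \<Longrightarrow> 2 * \<bar>y\<bar> < \<phi> \<and> 1/2 \<le> cos (2 * y) - tan \<psi> * \<bar>sin (2 * y)\<bar>"
begin

text \<open>\<open>outer\<close> extends the parametrization of the hyperbola to complex parameters; \<open>node \<eta>\<close> is the substituted variable \<open>s\<close> and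
\<open>conode \<eta>\<close> is \<open>T - s\<close>.\<close>

definition outer :: "complex \<Rightarrow> complex" where
  "outer \<xi> = of_real \<kappa> * cos (of_real \<psi> + \<i> * \<xi>)"

definition outer' :: "complex \<Rightarrow> complex" where
  "outer' \<xi> = - \<i> * of_real \<kappa> * sin (of_real \<psi> + \<i> * \<xi>)"

definition node :: "complex \<Rightarrow> complex" where
  "node \<eta> = of_real T / (1 + exp (- 2 * \<eta>))"

definition conode :: "complex \<Rightarrow> complex" where
  "conode \<eta> = of_real T / (1 + exp (2 * \<eta>))"

definition Psi :: "('a \<Rightarrow> complex) \<Rightarrow> real \<Rightarrow> complex \<Rightarrow> complex \<Rightarrow> complex" where
  "Psi l t \<xi> \<eta> = exp (- outer \<xi> * (of_real t + conode \<eta>)) * outer' \<xi> * b (outer \<xi>) * (of_real (T / 2) / (cosh \<eta>)\<^sup>2) *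
     (l (R (outer \<xi>) (F (node \<eta>))) - l (F (node \<eta>)) * inverse (outer \<xi>))"

lemma V_nonneg: "V \<ge> 0"
proof -
  have "node 0 \<in> sector 0 \<phi> - {0}" unfolding node_def using angle by (intro logistic_in_sector[OF T]) auto
  from order_trans[OF norm_ge_zero F(2)[OF this]] show ?thesis .
qed

lemma outer_hyperbola:
  "outer \<xi> = hyperbola 0 \<kappa> (\<psi> - Im \<xi>) (Re \<xi>)" "outer' \<xi> = hyperbola' \<kappa> (\<psi> - Im \<xi>) (Re \<xi>)"
proof -
  have eq: "of_real \<psi> + \<i> * \<xi> = of_real (\<psi> - Im \<xi>) + \<i> * of_real (Re \<xi>)" by (simp add: complex_eq_iff)
  show "outer \<xi> = hyperbola 0 \<kappa> (\<psi> - Im \<xi>) (Re \<xi>)" "outer' \<xi> = hyperbola' \<kappa> (\<psi> - Im \<xi>) (Re \<xi>)"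
    unfolding outer_def outer'_def hyperbola_def hyperbola'_def eq by simp_all
qed

lemma outer_props:
  assumes "\<bar>Im \<xi>\<bar> < d0"
  shows "outer \<xi> \<in> \<Omega>" "r0 * cosh (Re \<xi>) \<le> Re (outer \<xi>)" "r0 < Re (outer \<xi>)" "outer \<xi> \<noteq> 0"
    "cmod (outer' \<xi>) \<le> \<kappa> * cosh (Re \<xi>)"
proof -
  note t = tilt[OF assms]
  show "outer \<xi> \<in> \<Omega>" unfolding outer_hyperbola using t kappa by (intro hyperbola_in_\<Omega>) auto
  have ge: "r0 * cosh (Re \<xi>) < Re (outer \<xi>)"
    unfolding outer_hyperbola hyperbola_Re_Im using t by (simp add: mult_strict_right_mono)
  then show "r0 * cosh (Re \<xi>) \<le> Re (outer \<xi>)" by simp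
  have "r0 * 1 \<le> r0 * cosh (Re \<xi>)" using r0 cosh_real_ge_1[of "Re \<xi>"] by (intro mult_left_mono) auto
  with ge show "r0 < Re (outer \<xi>)" by linarith
  then show "outer \<xi> \<noteq> 0" using r0 by auto
  show "cmod (outer' \<xi>) \<le> \<kappa> * cosh (Re \<xi>)"
    unfolding outer_hyperbola using kappa by (intro hyperbola_bounds) auto
qed

lemma node_props:
  assumes "\<bar>Im \<eta>\<bar> < d0"
  shows "node \<eta> \<in> sector 0 \<phi> - {0}" "1 + exp (2 * \<eta>) \<noteq> 0" "1 + exp (- 2 * \<eta>) \<noteq> 0"
    "(cosh (Re \<eta>))\<^sup>2 / 4 \<le> (cmod (cosh \<eta>))\<^sup>2" "cosh \<eta> \<noteq> 0"
proof -
  note n = narrow[OF assms]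
  have tan: "tan \<psi> \<ge> 0" using psi_pos psi by (intro less_imp_le tan_gt_zero) auto
  show "node \<eta> \<in> sector 0 \<phi> - {0}" unfolding node_def using n angle by (intro logistic_in_sector[OF T]) auto
  show "1 + exp (2 * \<eta>) \<noteq> 0"
    using logistic_rotation(2)[of 1 \<eta> "tan \<psi>" 1] n tan by simp
  show "1 + exp (- 2 * \<eta>) \<noteq> 0"
    using logistic_rotation(2)[of 1 "- \<eta>" "tan \<psi>" 1] n tan by simp
  have "cosh \<eta> = cos (\<i> * \<eta>)" by (rule cosh_conv_cos)
  also have "\<i> * \<eta> = of_real (- Im \<eta>) + \<i> * of_real (Re \<eta>)" by (simp add: complex_eq_iff)
  finally have "Re (cosh \<eta>) = cos (Im \<eta>) * cosh (Re \<eta>)" unfolding cos_complex by simp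
  then have "(cos (Im \<eta>))\<^sup>2 * (cosh (Re \<eta>))\<^sup>2 \<le> (cmod (cosh \<eta>))\<^sup>2"
    unfolding cmod_power2 by (simp add: power_mult_distrib)
  moreover have "1/4 \<le> (cos (Im \<eta>))\<^sup>2"
  proof -
    have "1/2 \<le> cos (2 * Im \<eta>)" using n mult_nonneg_nonneg[OF tan abs_ge_zero[of "sin (2 * Im \<eta>)"]] by linarith
    then show ?thesis using cos_double_cos[of "Im \<eta>"] by simp
  qed
  then have "1/4 * (cosh (Re \<eta>))\<^sup>2 \<le> (cos (Im \<eta>))\<^sup>2 * (cosh (Re \<eta>))\<^sup>2" by (rule mult_right_mono) simp
  ultimately show c: "(cosh (Re \<eta>))\<^sup>2 / 4 \<le> (cmod (cosh \<eta>))\<^sup>2" by linarith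
  have "0 < (cosh (Re \<eta>))\<^sup>2 / 4" by simp
  with c show "cosh \<eta> \<noteq> 0" by auto
qed

lemma Psi_holomorphic_outer:
  assumes l: "contractive_functional l" and \<eta>: "\<bar>Im \<eta>\<bar> < d0"
  shows "(\<lambda>\<xi>. Psi l t \<xi> \<eta>) holomorphic_on {w. \<bar>Im w\<bar> < d0}"
proof -
  have o: "outer holomorphic_on {w. \<bar>Im w\<bar> < d0}" "outer' holomorphic_on {w. \<bar>Im w\<bar> < d0}"
    unfolding outer_def outer'_def by (intro holomorphic_intros)+
  have "(b \<circ> outer) holomorphic_on {w. \<bar>Im w\<bar> < d0}"
    by (rule holomorphic_on_compose_gen[OF o(1) nonlocal_symbol_holomorphic]) (use outer_props(3) in force)
  moreover have "((\<lambda>z. l (R z (F (node \<eta>)))) \<circ> outer) holomorphic_on {w. \<bar>Im w\<bar> < d0}"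
    by (rule holomorphic_on_compose_gen[OF o(1) R_holomorphic[OF l]]) (use outer_props(1) in force)
  ultimately show ?thesis
    unfolding Psi_def o_def using outer_props(4) by (intro holomorphic_intros o) auto
qed

lemma Psi_holomorphic_inner:
  assumes l: "contractive_functional l" and \<xi>: "\<bar>Im \<xi>\<bar> < d0"
  shows "(\<lambda>\<eta>. Psi l t \<xi> \<eta>) holomorphic_on {w. \<bar>Im w\<bar> < d0}"
proof -
  note lD = contractive_functionalD[OF l]
  have nh: "node holomorphic_on {w. \<bar>Im w\<bar> < d0}" "conode holomorphic_on {w. \<bar>Im w\<bar> < d0}"
    unfolding node_def conode_def using node_props by (auto intro!: holomorphic_intros)
  have ch: "(cosh :: complex \<Rightarrow> complex) holomorphic_on {w. \<bar>Im w\<bar> < d0}"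
    unfolding cosh_def by (intro holomorphic_intros)
  have "bounded_linear (\<lambda>x. l (R (outer \<xi>) x))"
    using bounded_linear_compose[OF lD(4) R_linear[OF outer_props(1)[OF \<xi>]]] .
  then have "(\<lambda>w. l (R (outer \<xi>) (F w))) holomorphic_on (sector 0 \<phi> - {0})"
    by (rule holomorphic_vec_on_functional[OF F(1)]) (simp add: R_scaleC[OF outer_props(1)[OF \<xi>]] lD)
  then have "((\<lambda>w. l (R (outer \<xi>) (F w))) \<circ> node) holomorphic_on {w. \<bar>Im w\<bar> < d0}"
    by (rule holomorphic_on_compose_gen[OF nh(1)]) (use node_props(1) in force)
  moreover have "(\<lambda>w. l (F w)) holomorphic_on (sector 0 \<phi> - {0})"
    by (rule holomorphic_vec_on_functional[OF F(1) lD(4,2)])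
  then have "((\<lambda>w. l (F w)) \<circ> node) holomorphic_on {w. \<bar>Im w\<bar> < d0}"
    by (rule holomorphic_on_compose_gen[OF nh(1)]) (use node_props(1) in force)
  ultimately show ?thesis
    unfolding Psi_def o_def using node_props(5) by (intro holomorphic_intros nh ch) auto
qed

definition Psi_const :: real where
  "Psi_const = (\<kappa> * (1 / (1 - q0)) * (T / 2) * 4 * ((M + 1) * V / r0)) * (2 / sqrt (r0 * T / 2)) * 4"

text \<open>The exponential is estimated by \<open>exp (- u) \<le> 1 / sqrt u\<close>: this trades part of the decay in the inner variable, where
  \<open>1 / cosh\<^sup>2\<close> is available, for decay in the outer one, where the remaining factors are only bounded.\<close>

lemma Psi_bound:
  assumes l: "contractive_functional l" and t: "t \<ge> 0" and \<xi>: "\<bar>Im \<xi>\<bar> < d0" and \<eta>: "\<bar>Im \<eta>\<bar> < d0"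
    and low: "r0 * cosh (Re \<xi>) * (T / (2 * (1 + exp (2 * Re \<eta>)))) \<le> Re (outer \<xi> * conode \<eta>)"
  shows "cmod (Psi l t \<xi> \<eta>) \<le> Psi_const * exp (- (1/2) * \<bar>Re \<xi>\<bar>) * exp (- (1/2) * \<bar>Re \<eta>\<bar>)"
proof -
  note lD = contractive_functionalD[OF l]
  define a where "a = cosh (Re \<xi>)"
  define c where "c = cosh (Re \<eta>)"
  define s where "s = sqrt (r0 * T / 2)"
  define u where "u = r0 * a * (T / (2 * (1 + exp (2 * Re \<eta>))))"
  have a: "a > 0" and c: "c > 0" by (auto simp: a_def c_def)
  have s: "s > 0" using r0 T by (simp add: s_def)
  have u: "u > 0" using r0 T a by (simp add: u_def add_pos_pos)
  have ea: "1 / sqrt a \<le> 2 * exp (- (1/2) * \<bar>Re \<xi>\<bar>)"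
  proof -
    have "exp \<bar>Re \<xi>\<bar> \<le> 4 * a" by (cases "Re \<xi> \<ge> 0") (auto simp: a_def cosh_def intro: order_trans[of _ "2 * exp _"])
    from real_sqrt_le_mono[OF this] have "sqrt (exp \<bar>Re \<xi>\<bar>) \<le> 2 * sqrt a" by (simp add: real_sqrt_mult)
    moreover have "sqrt (exp \<bar>Re \<xi>\<bar>) = exp ((1/2) * \<bar>Re \<xi>\<bar>)"
      by (rule real_sqrt_unique) (auto simp: power2_eq_square exp_add[symmetric])
    ultimately have "exp ((1/2) * \<bar>Re \<xi>\<bar>) \<le> 2 * sqrt a" by simp
    then show ?thesis using a by (simp add: exp_minus field_simps)
  qed
  have ec: "1 / c \<le> 2 * exp (- (1/2) * \<bar>Re \<eta>\<bar>)"
  proof -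
    have "exp ((1/2) * \<bar>Re \<eta>\<bar>) \<le> exp \<bar>Re \<eta>\<bar>" by simp
    also have "\<dots> \<le> 2 * c" by (cases "Re \<eta> \<ge> 0") (auto simp: c_def cosh_def)
    finally show ?thesis using c by (simp add: exp_minus field_simps)
  qed
  have "exp (- u) \<le> 1 / sqrt u" by (rule exp_le_inverse_sqrt[OF u])
  also have "\<dots> \<le> 1 / (s * sqrt a / (2 * c))"
  proof (rule divide_left_mono)
    have "sqrt (1 + exp (2 * Re \<eta>)) \<le> 2 * c"
      using real_sqrt_le_mono[OF one_plus_exp_le_cosh[of "Re \<eta>"]] c by (simp add: c_def real_sqrt_mult)
    moreover have su: "sqrt u = s * sqrt a / sqrt (1 + exp (2 * Re \<eta>))"
      unfolding u_def s_def by (simp add: real_sqrt_mult[symmetric] real_sqrt_divide[symmetric] field_simps)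
    ultimately show "s * sqrt a / (2 * c) \<le> sqrt u"
      unfolding su using s a c by (intro divide_left_mono mult_pos_pos) (auto intro: add_pos_pos)
  qed (use s a c u in auto)
  finally have eu: "exp (- u) \<le> (2 / s) * c * (1 / sqrt a)" by simp
  have e1: "cmod (exp (- outer \<xi> * (of_real t + conode \<eta>))) \<le> exp (- u)"
  proof -
    have "Re (outer \<xi>) * t \<ge> 0" using outer_props(3)[OF \<xi>] r0 t by simp
    then show ?thesis using low by (simp add: u_def a_def algebra_simps)
  qed
  have e2: "cmod (b (outer \<xi>)) \<le> 1 / (1 - q0)" using outer_props(3)[OF \<xi>] by (intro nonlocal_symbol_bound) simp
  have e3: "cmod (of_real (T / 2) / (cosh \<eta>)\<^sup>2) \<le> (T / 2) * 4 * (1 / c\<^sup>2)"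
  proof -
    have "cmod (of_real (T / 2) / (cosh \<eta>)\<^sup>2) = (T / 2) / (cmod (cosh \<eta>))\<^sup>2"
      using T by (simp add: norm_divide norm_power)
    also have "\<dots> \<le> (T / 2) / (c\<^sup>2 / 4)"
      using node_props(4,5)[OF \<eta>] T c by (intro divide_left_mono) (auto simp: c_def)
    finally show ?thesis by simp
  qed
  have e4: "cmod (l (R (outer \<xi>) (F (node \<eta>))) - l (F (node \<eta>)) * inverse (outer \<xi>)) \<le> ((M + 1) * V / r0) * (1 / a)"
  proof -
    have V: "norm (F (node \<eta>)) \<le> V" by (rule F(2)[OF node_props(1)[OF \<eta>]])
    have i: "inverse (cmod (outer \<xi>)) \<le> 1 / (r0 * a)"
      using outer_props(2)[OF \<xi>] complex_Re_le_cmod[of "outer \<xi>"] r0 a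
      by (simp add: inverse_eq_divide a_def frac_le)
    have "cmod (l (R (outer \<xi>) (F (node \<eta>))) - l (F (node \<eta>)) * inverse (outer \<xi>)) \<le>
        norm (R (outer \<xi>) (F (node \<eta>))) + norm (F (node \<eta>)) * inverse (cmod (outer \<xi>))"
      by (rule order_trans[OF norm_triangle_ineq4 add_mono]) (auto simp: norm_mult norm_inverse lD intro!: mult_right_mono)
    also have "\<dots> \<le> M * inverse (cmod (outer \<xi>)) * norm (F (node \<eta>)) + norm (F (node \<eta>)) * inverse (cmod (outer \<xi>))"
      by (intro add_right_mono R_bound_inverse outer_props \<xi>)
    also have "\<dots> = (M + 1) * norm (F (node \<eta>)) * inverse (cmod (outer \<xi>))" by (simp add: algebra_simps)
    also have "\<dots> \<le> (M + 1) * V * (1 / (r0 * a))"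
      using M_pos V i V_nonneg by (intro mult_mono mult_left_mono) auto
    finally show ?thesis by simp
  qed
  let ?K = "\<kappa> * (1 / (1 - q0)) * (T / 2) * 4 * ((M + 1) * V / r0)"
  have K: "?K \<ge> 0" using kappa q0 T M_pos V_nonneg r0 by simp
  have "cmod (Psi l t \<xi> \<eta>) \<le> exp (- u) * (\<kappa> * a) * (1 / (1 - q0)) * ((T / 2) * 4 * (1 / c\<^sup>2)) * (((M + 1) * V / r0) * (1 / a))"
    unfolding Psi_def norm_mult
    using e1 e2 e3 e4 outer_props(5)[OF \<xi>, folded a_def] kappa a q0 T c
    by (intro mult_mono mult_nonneg_nonneg) auto
  also have "\<dots> = exp (- u) * (?K * (1 / c\<^sup>2))"
  proof -
    have gen: "e * (k * a) * q * ((t * 4) * s) * (v * (1 / a)) = e * ((k * q * t * 4 * v) * s)" for e k q t s v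
      using a by simp
    show ?thesis by (rule gen)
  qed
  also have "\<dots> \<le> ((2 / s) * c * (1 / sqrt a)) * (?K * (1 / c\<^sup>2))"
    by (rule mult_right_mono[OF eu mult_nonneg_nonneg[OF K]]) simp
  also have "\<dots> = (?K * (2 / s)) * ((1 / sqrt a) * (1 / c))" using c by (simp add: power2_eq_square)
  also have "\<dots> \<le> (?K * (2 / s)) * ((2 * exp (- (1/2) * \<bar>Re \<xi>\<bar>)) * (2 * exp (- (1/2) * \<bar>Re \<eta>\<bar>)))"
  proof (rule mult_left_mono[OF mult_mono[OF ea ec]])
    show "0 \<le> ?K * (2 / s)" by (rule mult_nonneg_nonneg[OF K]) (use s in simp)
  qed (use a c in auto)
  finally show ?thesis unfolding Psi_const_def s_def by (simp only: mult_ac)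
qed

lemma cosh_complex_of_real: "cosh (of_real x :: complex) = of_real (cosh x)"
  by (simp add: cosh_def exp_of_real[symmetric] scaleR_conv_of_real)

lemma conode_real: "conode (of_real \<eta>) = of_real (T / (1 + exp (2 * \<eta>)))"
  by (simp add: conode_def exp_of_real[symmetric])

lemma Psi_bound_outer:
  assumes l: "contractive_functional l" and t: "t \<ge> 0" and \<xi>: "\<bar>Im \<xi>\<bar> < d0"
  shows "cmod (Psi l t \<xi> (of_real \<eta>)) \<le> Psi_const * exp (- (1/2) * \<bar>\<eta>\<bar>) * exp (- (1/2) * \<bar>Re \<xi>\<bar>)"
proof -
  have p: "0 < 1 + exp (2 * \<eta>)" by (simp add: add_pos_pos)
  have "r0 * cosh (Re \<xi>) * (T / (2 * (1 + exp (2 * \<eta>)))) \<le> Re (outer \<xi>) * (T / (1 + exp (2 * \<eta>)))"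
    using outer_props(2,3)[OF \<xi>] T p r0 by (intro mult_mono) (auto simp: frac_le)
  then have "cmod (Psi l t \<xi> (of_real \<eta>)) \<le> Psi_const * exp (- (1/2) * \<bar>Re \<xi>\<bar>) * exp (- (1/2) * \<bar>Re (of_real \<eta> :: complex)\<bar>)"
    using d0 by (intro Psi_bound[OF l t \<xi>]) (simp_all add: conode_real del: of_real_divide)
  then show ?thesis by (simp add: mult_ac)
qed

lemma Psi_bound_inner:
  assumes l: "contractive_functional l" and t: "t \<ge> 0" and \<eta>: "\<bar>Im \<eta>\<bar> < d0"
  shows "cmod (Psi l t (of_real \<xi>) \<eta>) \<le> Psi_const * exp (- (1/2) * \<bar>\<xi>\<bar>) * exp (- (1/2) * \<bar>Re \<eta>\<bar>)"
proof -
  have tan: "tan \<psi> \<ge> 0" using psi_pos psi by (intro less_imp_le tan_gt_zero) auto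
  have x: "\<bar>Im (of_real \<xi> :: complex)\<bar> < d0" using d0 by simp
  have im: "\<bar>Im (outer (of_real \<xi>))\<bar> \<le> tan \<psi> * Re (outer (of_real \<xi>))"
  proof -
    have "\<bar>sinh \<xi>\<bar> \<le> cosh \<xi>" using sinh_less_cosh_real[of \<xi>] sinh_less_cosh_real[of "- \<xi>"] by simp
    then have "\<kappa> * sin \<psi> * \<bar>sinh \<xi>\<bar> \<le> \<kappa> * sin \<psi> * cosh \<xi>" using kappa psi_pos by (intro mult_left_mono) auto
    then show ?thesis using kappa psi_pos by (simp add: outer_hyperbola hyperbola_Re_Im abs_mult tan_def)
  qed
  have "r0 * cosh \<xi> * (T / (2 * (1 + exp (2 * Re \<eta>)))) \<le> Re (outer (of_real \<xi>)) * (T / (2 * (1 + exp (2 * Re \<eta>))))"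
    using outer_props(2)[OF x] T by (intro mult_right_mono) (auto intro!: divide_nonneg_pos add_pos_pos)
  also have "\<dots> \<le> Re (outer (of_real \<xi>) * conode \<eta>)"
    unfolding conode_def using logistic_rotation(1)[OF T _ tan im] narrow[OF \<eta>] outer_props(3)[OF x] r0 by simp
  finally show ?thesis
    using Psi_bound[OF l t x \<eta>] by simp
qed

definition snode :: "real \<Rightarrow> real" where "snode \<eta> = T / 2 * (1 + tanh \<eta>)"

lemma snode_props:
  "0 < snode \<eta>" "snode \<eta> < T" "node (of_real \<eta>) = of_real (snode \<eta>)" "conode (of_real \<eta>) = of_real (T - snode \<eta>)"
  "(snode has_vector_derivative (T / 2) / (cosh \<eta>)\<^sup>2) (at \<eta>)"
proof -
  have t: "- 1 < tanh \<eta>" "tanh \<eta> < 1" by (rule tanh_real_gt_neg1, rule tanh_real_lt_1)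
  show "0 < snode \<eta>" using t T by (simp add: snode_def)
  have "T / 2 * (1 + tanh \<eta>) < T / 2 * 2" using t T by (intro mult_strict_left_mono) auto
  then show "snode \<eta> < T" by (simp add: snode_def)
  have "of_real T / (1 + exp (- 2 * of_real \<eta>)) = (of_real (T / 2 * (2 / (1 + exp (- 2 * \<eta>)))) :: complex)"
    by (simp add: exp_of_real[symmetric])
  then show "node (of_real \<eta>) = of_real (snode \<eta>)" by (simp only: node_def snode_def tanh_logistic)
  have "T - snode \<eta> = T / 2 * (1 - tanh \<eta>)" by (simp add: snode_def field_simps)
  also have "\<dots> = T / (1 + exp (2 * \<eta>))" unfolding tanh_logistic by simp
  finally show "conode (of_real \<eta>) = of_real (T - snode \<eta>)" by (simp only: conode_real)
  have "1 - (tanh \<eta>)\<^sup>2 = 1 / (cosh \<eta>)\<^sup>2"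
    by (simp add: tanh_def power_divide sinh_square_eq field_simps)
  moreover have "(snode has_real_derivative T / 2 * (1 - (tanh \<eta>)\<^sup>2)) (at \<eta>)"
    unfolding snode_def[abs_def] by (auto intro!: derivative_eq_intros)
  ultimately show "(snode has_vector_derivative (T / 2) / (cosh \<eta>)\<^sup>2) (at \<eta>)"
    unfolding has_real_derivative_iff_has_vector_derivative[symmetric] by simp
qed

definition solution_integrand :: "real \<Rightarrow> real \<Rightarrow> 'a" where
  "solution_integrand t s = contour_op b (t + T - s) (F (of_real s))"

lemma real_in_sector: "s > 0 \<Longrightarrow> of_real s \<in> sector 0 \<phi> - {0}"
  using angle by (intro sectorI) auto

lemma solution_integrand_continuous:
  assumes t: "t \<ge> 0"
  shows "continuous_on {0<..<T} (solution_integrand t)"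
  unfolding continuous_on_eq_continuous_within
proof
  fix s assume s: "s \<in> {0<..<T}"
  obtain C where C: "C \<ge> 0" "\<And>t x. t > 0 \<Longrightarrow> norm (contour_op b t x) \<le> C * norm x"
    by (rule nonlocal_contour_bound) (rule that)
  let ?F = "at s within {0<..<T}"
  have "continuous_on {0<..<T} (\<lambda>s::real. F (of_real s))"
    by (rule continuous_on_compose2[OF holomorphic_vec_on_continuous[OF F(1)]])
       (use real_in_sector in \<open>auto intro!: continuous_intros\<close>)
  then have Fl: "((\<lambda>y. F (of_real y)) \<longlongrightarrow> F (of_real s)) ?F" using s by (auto simp: continuous_on_def)
  have r: "t + T - s > 0" using s t by auto
  have "isCont (\<lambda>r. contour_op b r (F (of_real s))) (t + T - s)"
    using has_vector_derivative_continuous[OF contour_op_derivative[OF nonlocal_symbol r]] .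
  moreover have "((\<lambda>y. t + T - y) \<longlongrightarrow> t + T - s) ?F" by (intro tendsto_intros)
  ultimately have 1: "((\<lambda>y. contour_op b (t + T - y) (F (of_real s))) \<longlongrightarrow> solution_integrand t s) ?F"
    unfolding solution_integrand_def by (rule isCont_tendsto_compose)
  have "((\<lambda>y. solution_integrand t y - contour_op b (t + T - y) (F (of_real s))) \<longlongrightarrow> 0) ?F"
  proof (rule Lim_null_comparison)
    show "((\<lambda>y. C * norm (F (of_real y) - F (of_real s))) \<longlongrightarrow> 0) ?F"
      using Fl by (auto intro!: tendsto_eq_intros)
    show "\<forall>\<^sub>F y in ?F. norm (solution_integrand t y - contour_op b (t + T - y) (F (of_real s))) \<le> C * norm (F (of_real y) - F (of_real s))"
      unfolding eventually_at_filter
    proof (rule always_eventually, intro allI impI)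
      fix y assume "y \<noteq> s" "y \<in> {0<..<T}"
      then have r: "t + T - y > 0" using t by auto
      show "norm (solution_integrand t y - contour_op b (t + T - y) (F (of_real s))) \<le> C * norm (F (of_real y) - F (of_real s))"
        unfolding solution_integrand_def linear_diff[OF contour_op_linear(1)[OF nonlocal_symbol r], symmetric] by (rule C(2)[OF r])
    qed
  qed
  from tendsto_add[OF this 1] show "continuous (at s within {0<..<T}) (solution_integrand t)"
    by (simp add: continuous_within)
qed

lemma solution_primitive:
  assumes t: "t \<ge> 0"
  obtains P where "continuous_on {0..T} P" "\<And>s. s \<in> {0<..<T} \<Longrightarrow> (P has_vector_derivative solution_integrand t s) (at s)"
    "integral {0..T} (\<lambda>s. inv B (semigroup_neg D A (t + T - s) (F (of_real s)))) = P T - P 0"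
proof -
  obtain C where C: "C \<ge> 0" "\<And>t x. t > 0 \<Longrightarrow> norm (contour_op b t x) \<le> C * norm x"
    by (rule nonlocal_contour_bound) (rule that)
  have bd: "norm (solution_integrand t s) \<le> C * V" if "s \<in> {0<..<T}" for s
  proof -
    have "norm (solution_integrand t s) \<le> C * norm (F (of_real s))"
      unfolding solution_integrand_def using that t by (intro C(2)) auto
    also have "\<dots> \<le> C * V" using F(2)[OF real_in_sector, of s] that C(1) by (intro mult_left_mono) auto
    finally show ?thesis .
  qed
  obtain P where P: "continuous_on {0..T} P" "\<And>s. s \<in> {0<..<T} \<Longrightarrow> (P has_vector_derivative solution_integrand t s) (at s)"
    using bounded_continuous_interior_primitive[OF T solution_integrand_continuous[OF t] bd] by blast
  have "((\<lambda>s. inv B (semigroup_neg D A (t + T - s) (F (of_real s)))) has_integral P T - P 0) {0..T}"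
  proof (rule fundamental_theorem_of_calculus_interior[OF _ P(1)])
    fix s assume s: "s \<in> {0<..<T}"
    then have "t + T - s > 0" using t by auto
    then have "inv B (semigroup_neg D A (t + T - s) (F (of_real s))) = solution_integrand t s"
      by (simp add: semigroup_neg_eq inv_nonlocal_op_sg solution_integrand_def)
    then show "(P has_vector_derivative inv B (semigroup_neg D A (t + T - s) (F (of_real s)))) (at s)"
      using P(2)[OF s] by simp
  qed (use T in simp)
  then show thesis using that[OF P] by (simp add: integral_unique)
qed

text \<open>The term \<open>x / z\<close> drops out, being the integral of a symbol that is holomorphic to the right of the contour.\<close>

lemma outer_integral:
  assumes l: "contractive_functional l" and t: "t \<ge> 0"
  shows "integral UNIV (\<lambda>\<xi>::real. Psi l t (of_real \<xi>) (of_real \<eta>)) =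
     2 * of_real pi * \<i> * (of_real ((T / 2) / (cosh \<eta>)\<^sup>2) * l (solution_integrand t (snode \<eta>)))"
proof -
  note lD = contractive_functionalD[OF l]
  define x where "x = F (of_real (snode \<eta>))"
  define r where "r = t + T - snode \<eta>"
  define c :: complex where "c = of_real ((T / 2) / (cosh \<eta>)\<^sup>2)"
  have r: "r > 0" using snode_props(2)[of \<eta>] t by (simp add: r_def)
  have lC: "l (c *\<^sub>C y) = c *\<^sub>C l y" for c y by (simp add: lD scaleC_complex_def)
  have sym: "symbol (\<lambda>w. b w * inverse w) (1 / (1 - q0) * (1 / r0))"
    unfolding symbol_def
  proof (intro conjI allI impI)
    show "(\<lambda>w. b w * inverse w) holomorphic_on {z. r0 < Re z}"
      using nonlocal_symbol r0 by (auto simp: symbol_def intro!: holomorphic_intros)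
    fix w assume w: "r0 < Re w"
    then have "r0 \<le> cmod w" using complex_Re_le_cmod[of w] by linarith
    then have "inverse (cmod w) \<le> 1 / r0" using r0 by (simp add: inverse_eq_divide frac_le)
    then show "cmod (b w * inverse w) \<le> 1 / (1 - q0) * (1 / r0)"
      unfolding norm_mult norm_inverse using nonlocal_symbol_bound[of w] w q0 by (intro mult_mono) auto
  qed
  have k: "hyp_kernel 0 \<kappa> \<psi> r \<xi> *\<^sub>C y = hyp_kernel 0 \<kappa> \<psi> r \<xi> * y" for \<xi> and y :: complex by (simp add: scaleC_complex_def)
  have int1: "(\<lambda>\<xi>. hyp_kernel 0 \<kappa> \<psi> r \<xi> * (b (z \<xi>) * l (R (z \<xi>) x))) integrable_on UNIV"
    using integrable_linear[OF contour_integrable[OF nonlocal_symbol r, of x] lD(4)] by (simp add: o_def lD)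
  have I1: "integral UNIV (\<lambda>\<xi>. hyp_kernel 0 \<kappa> \<psi> r \<xi> * (b (z \<xi>) * l (R (z \<xi>) x))) = 2 * of_real pi * \<i> * l (contour_op b r x)"
  proof -
    have gen: "I = c * y" if "y = inverse c * I" "c \<noteq> 0" for c y I :: complex using that by simp
    show ?thesis
      by (rule gen) (use contour_op_apply[OF nonlocal_symbol r lD(4) lC, of x] in \<open>simp_all only: hyp_integral_def scaleC_complex_def\<close>, simp)
  qed
  note zero = hyp_integral_right_zero[OF hyp_pos r, of "\<lambda>w. b w * inverse w" r0 "1 / (1 - q0) * (1 / r0)" 0]
  have int2: "(\<lambda>\<xi>. hyp_kernel 0 \<kappa> \<psi> r \<xi> * (b (z \<xi>) * inverse (z \<xi>))) integrable_on UNIV"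
    using zero(1) sym r0 unfolding symbol_def k by simp
  have I2: "integral UNIV (\<lambda>\<xi>. hyp_kernel 0 \<kappa> \<psi> r \<xi> * (b (z \<xi>) * inverse (z \<xi>))) = 0"
    using zero(2) sym r0 unfolding symbol_def hyp_integral_def k by simp
  have Pe: "Psi l t (of_real \<xi>) (of_real \<eta>) = c * (hyp_kernel 0 \<kappa> \<psi> r \<xi> * (b (z \<xi>) * l (R (z \<xi>) x)) -
      hyp_kernel 0 \<kappa> \<psi> r \<xi> * (b (z \<xi>) * inverse (z \<xi>)) * l x)" for \<xi>
  proof -
    have o: "outer (of_real \<xi>) = z \<xi>" "outer' (of_real \<xi>) = hyperbola' \<kappa> \<psi> \<xi>" by (simp_all add: outer_hyperbola)
    have cc: "of_real (T / 2) / (cosh (of_real \<eta>))\<^sup>2 = c" by (simp add: c_def cosh_complex_of_real)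
    have r': "of_real t + conode (of_real \<eta>) = of_real r" by (simp add: snode_props(4) r_def)
    show ?thesis
      unfolding Psi_def o cc r' snode_props(3) x_def[symmetric] hyp_kernel_def by (simp add: algebra_simps)
  qed
  have "integral UNIV (\<lambda>\<xi>::real. Psi l t (of_real \<xi>) (of_real \<eta>)) = c * (2 * of_real pi * \<i> * l (contour_op b r x) - 0 * l x)"
    unfolding Pe I1[symmetric] I2[symmetric]
    by (simp only: integral_mult_right integral_mult_left Henstock_Kurzweil_Integration.integral_diff[OF int1 integrable_on_mult_left[OF int2]])
  then show ?thesis by (simp add: c_def x_def r_def solution_integrand_def mult_ac)
qed

lemma outer_integral_continuous:
  assumes l: "contractive_functional l" and t: "t \<ge> 0"
  shows "continuous_on UNIV (\<lambda>\<eta>::real. integral UNIV (\<lambda>\<xi>::real. Psi l t (of_real \<xi>) (of_real \<eta>)))"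
proof -
  have sn: "continuous_on UNIV snode"
    using has_vector_derivative_continuous[OF snode_props(5)] by (simp add: continuous_on_eq_continuous_at)
  have "continuous_on UNIV (\<lambda>\<eta>. solution_integrand t (snode \<eta>))"
    by (rule continuous_on_compose2[OF solution_integrand_continuous[OF t] sn]) (use snode_props(1,2) in auto)
  then have "continuous_on UNIV (\<lambda>\<eta>. l (solution_integrand t (snode \<eta>)))"
    by (rule bounded_linear.continuous_on[OF contractive_functionalD(4)[OF l]])
  then show ?thesis
    unfolding outer_integral[OF l t] by (intro continuous_intros) auto
qed

text \<open>The substitution is made in the primitive \<open>P\<close> of the solution integrand: a multiple of \<open>l (P (snode \<eta>))\<close> is a primitive of the outer integral, and \<open>l (P (snode \<eta>))\<close> has the
limits \<open>l (P 0)\<close> and \<open>l (P T)\<close> at the two ends of the line.\<close>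

lemma double_integral:
  assumes l: "contractive_functional l" and t: "t \<ge> 0"
  shows "integral UNIV (\<lambda>\<eta>::real. integral UNIV (\<lambda>\<xi>::real. Psi l t (of_real \<xi>) (of_real \<eta>))) =
     2 * of_real pi * \<i> * l (integral {0..T} (\<lambda>s. inv B (semigroup_neg D A (t + T - s) (F (of_real s)))))"
    (is "integral UNIV ?J = ?I")
proof (rule integral_UNIV_eqI)
  note lD = contractive_functionalD[OF l]
  have contx: "continuous_on UNIV (\<lambda>\<xi>::real. Psi l t (of_real \<xi>) (of_real \<eta>))" for \<eta>
  proof (rule continuous_on_compose2[OF holomorphic_on_imp_continuous_on[OF Psi_holomorphic_outer[OF l]]])
    show "\<bar>Im (of_real \<eta> :: complex)\<bar> < d0" using d0 by simp
  qed (use d0 in \<open>auto intro!: continuous_intros\<close>)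
  have Jb: "cmod (?J \<eta>) \<le> (Psi_const * (2 / (1/2))) * exp (- (1/2) * \<bar>\<eta>\<bar>)" for \<eta>
  proof -
    have "cmod (?J \<eta>) \<le> (Psi_const * exp (- (1/2) * \<bar>\<eta>\<bar>)) * (2 / (1/2))"
      by (rule integrable_UNIV_exp_bound(2)[OF contx]) (use Psi_bound_outer[OF l t, of "of_real _" \<eta>] d0 in auto)
    then show ?thesis by (simp add: mult_ac)
  qed
  show "?J integrable_on UNIV"
    by (rule integrable_UNIV_exp_bound(1)[OF outer_integral_continuous[OF l t] _ Jb]) simp
  obtain P where P: "continuous_on {0..T} P" "\<And>s. s \<in> {0<..<T} \<Longrightarrow> (P has_vector_derivative solution_integrand t s) (at s)"
    "integral {0..T} (\<lambda>s. inv B (semigroup_neg D A (t + T - s) (F (of_real s)))) = P T - P 0"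
    using solution_primitive[OF t] by blast
  let ?G = "\<lambda>\<eta>. 2 * of_real pi * \<i> * l (P (snode \<eta>))"
  have der: "(?G has_vector_derivative ?J \<eta>) (at \<eta>)" for \<eta>
  proof -
    have "(P has_vector_derivative solution_integrand t (snode \<eta>)) (at (snode \<eta>))"
      using snode_props(1,2) by (intro P(2)) auto
    from vector_diff_chain_at[OF snode_props(5) this]
    have "((\<lambda>\<eta>. P (snode \<eta>)) has_vector_derivative ((T / 2) / (cosh \<eta>)\<^sup>2) *\<^sub>R solution_integrand t (snode \<eta>)) (at \<eta>)"
      by (simp add: o_def)
    from bounded_linear.has_vector_derivative[OF lD(4) this]
    have "((\<lambda>\<eta>. l (P (snode \<eta>))) has_vector_derivative of_real ((T / 2) / (cosh \<eta>)\<^sup>2) * l (solution_integrand t (snode \<eta>))) (at \<eta>)"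
      by (simp only: lD(7))
    from bounded_linear.has_vector_derivative[OF bounded_linear_mult_right this]
    show ?thesis unfolding outer_integral[OF l t] .
  qed
  have eq: "integral {-n..n} ?J = ?G n - ?G (- n)" if "n \<ge> 0" for n
    by (rule integral_unique[OF fundamental_theorem_of_calculus])
       (use that der in \<open>auto intro: has_vector_derivative_at_within\<close>)
  have Pl: "((\<lambda>n. P (u n)) \<longlongrightarrow> P u0) at_top" if "(u \<longlongrightarrow> u0) at_top" "u0 \<in> {0..T}" "\<And>n. u n \<in> {0..T}" for u :: "real \<Rightarrow> real" and u0
    by (rule continuous_on_tendsto_compose[OF P(1) that(1,2)]) (use that(3) in simp)
  have "(snode \<longlongrightarrow> T / 2 * (1 + 1)) at_top" unfolding snode_def by (intro tendsto_intros tanh_real_at_top)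
  then have l1: "((\<lambda>n. P (snode n)) \<longlongrightarrow> P T) at_top"
    using snode_props(1,2) T by (intro Pl) (auto intro: less_imp_le)
  have "((\<lambda>n. snode (- n)) \<longlongrightarrow> T / 2 * (1 + - 1)) at_top"
    unfolding snode_def by (intro tendsto_intros filterlim_compose[OF tanh_real_at_bot filterlim_uminus_at_bot_at_top])
  then have l2: "((\<lambda>n. P (snode (- n))) \<longlongrightarrow> P 0) at_top"
    using snode_props(1,2) T by (intro Pl) (auto intro: less_imp_le)
  have "((\<lambda>n. ?G n - ?G (- n)) \<longlongrightarrow> 2 * of_real pi * \<i> * l (P T) - 2 * of_real pi * \<i> * l (P 0)) at_top"
    by (intro tendsto_intros bounded_linear.tendsto[OF lD(4)] l1 l2)
  also have "2 * of_real pi * \<i> * l (P T) - 2 * of_real pi * \<i> * l (P 0) = ?I"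
    unfolding P(3) lD(5) by (simp add: algebra_simps)
  finally show "((\<lambda>n. integral {-n..n} ?J) \<longlongrightarrow> ?I) at_top"
    by (rule Lim_transform_eventually, use eventually_ge_at_top[of 0] in eventually_elim) (simp add: eq)
qed

definition inner_sum :: "nat \<Rightarrow> real \<Rightarrow> complex \<Rightarrow> 'a" where
  "inner_sum N h w = h *\<^sub>R (\<Sum>p=-int N..int N.
     (of_real (T / 2) * exp (- of_real (T / 2) * w * of_real (1 - tanh (of_int p * h))) / of_real ((cosh (of_int p * h))\<^sup>2)) *\<^sub>C
       F (of_real (T / 2 * (1 + tanh (of_int p * h)))))"

definition double_sum :: "nat \<Rightarrow> real \<Rightarrow> real \<Rightarrow> 'a" where
  "double_sum N h t = (of_real h / (2 * of_real pi * \<i>)) *\<^sub>C (\<Sum>k=-int N..int N.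
     (exp (- z (of_int k * h) * of_real t) * hyperbola' \<kappa> \<psi> (of_int k * h) * b (z (of_int k * h))) *\<^sub>C
       (R (z (of_int k * h)) (inner_sum N h (z (of_int k * h))) - inverse (z (of_int k * h)) *\<^sub>C inner_sum N h (z (of_int k * h))))"

lemma functional_double_sum:
  assumes l: "contractive_functional l"
  shows "2 * of_real pi * \<i> * l (double_sum N h t) =
     of_real h * (of_real h * (\<Sum>k=-int N..int N. \<Sum>p=-int N..int N. Psi l t (of_real (real_of_int k * h)) (of_real (real_of_int p * h))))"
proof -
  note lD = contractive_functionalD[OF l]
  have linl: "linear l" using lD(4) by (rule bounded_linear.linear)
  have term_eq: "(exp (- z x * of_real t) * hyperbola' \<kappa> \<psi> x * b (z x)) * l (R (z x) (inner_sum N h (z x)) - inverse (z x) *\<^sub>C inner_sum N h (z x)) =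
     of_real h * (\<Sum>p=-int N..int N. Psi l t (of_real x) (of_real (real_of_int p * h)))" for x :: real
  proof -
    define L where "L y = l (R (z x) y) - l y * inverse (z x)" for y
    define e where "e = exp (- z x * of_real t) * hyperbola' \<kappa> \<psi> x * b (z x)"
    define \<mu> where "\<mu> p = of_real (T / 2) * exp (- of_real (T / 2) * z x * of_real (1 - tanh (of_int p * h))) / of_real ((cosh (of_int p * h))\<^sup>2)" for p :: int
    have linR: "linear (R (z x))" by (rule bounded_linear.linear[OF R_linear[OF z_in_\<Omega>]])
    have linL: "linear L"
      by (rule linearI) (simp_all add: L_def linear_add[OF linR] linear_scale[OF linR] lD algebra_simps scaleR_conv_of_real)
    have LC: "L (c *\<^sub>C y) = c * L y" for c y
      by (simp add: L_def R_scaleC[OF z_in_\<Omega>] lD algebra_simps)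
    have LS: "L (inner_sum N h (z x)) = of_real h * (\<Sum>p=-int N..int N. \<mu> p * L (F (of_real (snode (of_int p * h)))))"
      unfolding inner_sum_def \<mu>_def[symmetric] snode_def[symmetric]
      by (simp only: linear_scale[OF linL] linear_sum[OF linL] LC scaleR_conv_of_real)
    have P: "Psi l t (of_real x) (of_real \<eta>) = e * (of_real (T / 2) * exp (- of_real (T / 2) * z x * of_real (1 - tanh \<eta>)) / of_real ((cosh \<eta>)\<^sup>2) * L (F (of_real (snode \<eta>))))" for \<eta>
    proof -
      have o: "outer (of_real x) = z x" "outer' (of_real x) = hyperbola' \<kappa> \<psi> x" by (simp_all add: outer_hyperbola)
      have "T - snode \<eta> = T / 2 * (1 - tanh \<eta>)" by (simp add: snode_def field_simps)
      then have "- z x * (of_real t + conode (of_real \<eta>)) = - z x * of_real t + - of_real (T / 2) * z x * of_real (1 - tanh \<eta>)"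
        unfolding snode_props(4) by (simp only: of_real_mult distrib_left mult_ac) simp
      then show ?thesis
        unfolding Psi_def o e_def snode_props(3) L_def[symmetric] by (simp only: exp_add cosh_complex_of_real of_real_power) (simp add: mult_ac)
    qed
    have "e * l (R (z x) (inner_sum N h (z x)) - inverse (z x) *\<^sub>C inner_sum N h (z x)) = e * L (inner_sum N h (z x))"
      by (simp add: lD L_def)
    also have "\<dots> = of_real h * (\<Sum>p=-int N..int N. e * (\<mu> p * L (F (of_real (snode (of_int p * h))))))"
      unfolding LS sum_distrib_left[symmetric] by (simp only: mult_ac)
    finally show ?thesis unfolding P \<mu>_def e_def by simp
  qed
  have "l (double_sum N h t) = of_real h / (2 * of_real pi * \<i>) * (\<Sum>k=-int N..int N. of_real h * (\<Sum>p=-int N..int N. Psi l t (of_real (real_of_int k * h)) (of_real (real_of_int p * h))))"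
    unfolding double_sum_def lD(2) linear_sum[OF linl] term_eq ..
  then show ?thesis by (simp add: sum_distrib_left)
qed

lemma quadrature_convergence:
  assumes c0: "c0 > 0"
  shows "\<exists>c>0. \<exists>c1>0. \<forall>N\<ge>1. \<forall>t\<ge>0.
     norm (integral {0..T} (\<lambda>s. inv B (semigroup_neg D A (t + T - s) (F (of_real s)))) - double_sum N (c0 / sqrt (real N)) t)
       \<le> c * exp (- c1 * sqrt (real N))"
proof -
  have d: "0 < d0 / 2" "d0 / 2 < d0" using d0 by auto
  obtain K c1 where K: "K > 0" "c1 > 0" "\<And>N. N \<ge> 1 \<Longrightarrow>
     4 / (1/2) / (exp (2 * pi * (d0 / 2) / (c0 / sqrt (real N))) - 1) + 2 / (1/2) * exp (- (1/2) * (real N * (c0 / sqrt (real N)))) \<le> K * exp (- c1 * sqrt (real N))"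
    using balanced_step_error[OF d(1) _ c0, of "1/2"] by auto
  define c where "c = 1 / (2 * pi) * (Psi_const * K * (4 / (1/2) + c0)) + 1"
  have Pc: "Psi_const \<ge> 0" unfolding Psi_const_def using kappa q0 T M_pos V_nonneg r0 by simp
  have c: "c > 0" using Pc K c0 by (simp add: c_def add_nonneg_pos)
  have "norm (integral {0..T} (\<lambda>s. inv B (semigroup_neg D A (t + T - s) (F (of_real s)))) - double_sum N (c0 / sqrt (real N)) t)
       \<le> c * exp (- c1 * sqrt (real N))" if N: "N \<ge> 1" and t: "t \<ge> 0" for N t
  proof (rule norm_le_functionals)
    fix l :: "'a \<Rightarrow> complex" assume l: "contractive_functional l"
    note lD = contractive_functionalD[OF l]
    define h where "h = c0 / sqrt (real N)"
    have h: "h > 0" "h \<le> c0" using c0 N by (auto simp: h_def divide_le_eq intro!: mult_right_mono[of 1, simplified] order_trans[of c0 "c0 * 1"] mult_left_mono)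
    let ?I = "integral {0..T} (\<lambda>s. inv B (semigroup_neg D A (t + T - s) (F (of_real s))))"
    let ?JJ = "integral UNIV (\<lambda>\<eta>::real. integral UNIV (\<lambda>\<xi>::real. Psi l t (of_real \<xi>) (of_real \<eta>)))"
    let ?SS = "of_real h * (of_real h * (\<Sum>k=-int N..int N. \<Sum>p=-int N..int N. Psi l t (of_real (real_of_int k * h)) (of_real (real_of_int p * h))))"
    have real_strip: "\<bar>Im (of_real x :: complex)\<bar> < d0" for x using d0 by simp
    have "cmod (?SS - ?JJ) \<le> Psi_const * (4 / (1/2) / (exp (2 * pi * (d0 / 2) / h) - 1) + 2 / (1/2) * exp (- (1/2) * (real N * h))) * (4 / (1/2) + h)"
    proof (rule trapezoidal_error_double[OF d _ h(1) Psi_holomorphic_outer[OF l real_strip] _ Psi_holomorphic_inner[OF l real_strip] _ outer_integral_continuous[OF l t]])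
      show "cmod (Psi l t \<xi> (of_real \<eta>)) \<le> Psi_const * exp (- (1/2) * \<bar>\<eta>\<bar>) * exp (- (1/2) * \<bar>Re \<xi>\<bar>)" if "\<bar>Im \<xi>\<bar> \<le> d0 / 2" for \<xi> \<eta>
        using that d by (intro Psi_bound_outer[OF l t]) simp
      show "cmod (Psi l t (of_real \<xi>) \<eta>) \<le> Psi_const * exp (- (1/2) * \<bar>\<xi>\<bar>) * exp (- (1/2) * \<bar>Re \<eta>\<bar>)" if "\<bar>Im \<eta>\<bar> \<le> d0 / 2" for \<xi> \<eta>
        using that d by (intro Psi_bound_inner[OF l t]) simp
    qed simp
    also have "\<dots> \<le> Psi_const * (K * exp (- c1 * sqrt (real N))) * (4 / (1/2) + c0)"
      using K(3)[OF N, folded h_def] h Pc K(1) by (intro mult_mono mult_left_mono) auto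
    finally have "cmod (2 * of_real pi * \<i> * l (double_sum N h t) - 2 * of_real pi * \<i> * l ?I) \<le> (Psi_const * K * (4 / (1/2) + c0)) * exp (- c1 * sqrt (real N))"
      unfolding functional_double_sum[OF l] double_integral[OF l t] by (simp add: mult_ac)
    moreover have "2 * of_real pi * \<i> * l (double_sum N h t) - 2 * of_real pi * \<i> * l ?I = - (2 * of_real pi * \<i>) * l (?I - double_sum N h t)"
      by (simp add: lD algebra_simps)
    ultimately have "2 * pi * cmod (l (?I - double_sum N h t)) \<le> (Psi_const * K * (4 / (1/2) + c0)) * exp (- c1 * sqrt (real N))"
      by (simp add: norm_mult)
    then have "cmod (l (?I - double_sum N h t)) \<le> 1 / (2 * pi) * ((Psi_const * K * (4 / (1/2) + c0)) * exp (- c1 * sqrt (real N)))"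
      by (simp add: field_simps)
    also have "\<dots> \<le> c * exp (- c1 * sqrt (real N))" by (simp add: c_def distrib_right)
    finally show "cmod (l (?I - double_sum N (c0 / sqrt (real N)) t)) \<le> c * exp (- c1 * sqrt (real N))" by (simp only: h_def)
  qed
  then show ?thesis using c K(2) by blast
qed

end

end

section \<open>Convergence\<close>

lemma (in sectorial_contour) frac_power_neg_bounded:
  assumes \<alpha>: "\<alpha> > 0"
  obtains C where "C \<ge> 0" "\<And>x. norm (frac_power_neg D A \<alpha> x) \<le> C * norm x"
proof -
  obtain K where K: "K \<ge> 1" "\<And>t x. t \<ge> 0 \<Longrightarrow> norm (sg t x) \<le> K * exp (- r0 * t) * norm x"
    using sg_exponential_bound by blast
  let ?g = "\<lambda>t. t powr (\<alpha> - 1) * exp (- r0 * t)"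
  have "(\<lambda>t. norm (complex_of_real t powr (of_real \<alpha> - 1) / of_real (exp (r0 * t)))) absolutely_integrable_on {0<..}"
    using absolutely_integrable_Gamma_integral[of "of_real \<alpha>" r0] \<alpha> r0 by (intro absolutely_integrable_norm[unfolded o_def]) auto
  then have "(\<lambda>t. norm (complex_of_real t powr (of_real \<alpha> - 1) / of_real (exp (r0 * t)))) integrable_on {0<..}"
    by (rule set_lebesgue_integral_eq_integral(1))
  then have "?g integrable_on {0<..}"
  proof (rule integrable_eq)
    fix t :: real assume "t \<in> {0<..}"
    then show "norm (complex_of_real t powr (of_real \<alpha> - 1) / of_real (exp (r0 * t))) = ?g t"
      by (simp add: norm_divide norm_powr_real_powr) (simp add: exp_minus divide_inverse)
  qed
  then have g: "?g integrable_on {0..}"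
  proof (rule integrable_spike_set)
    have "{t \<in> {0<..} - {0..}. ?g t \<noteq> 0} = {}" "{t \<in> {0..} - {0<..}. ?g t \<noteq> 0} = {}" by auto
    then show "negligible {t \<in> {0<..} - {0..}. ?g t \<noteq> 0}" "negligible {t \<in> {0..} - {0<..}. ?g t \<noteq> 0}"
      by (simp_all only: negligible_empty)
  qed
  have g0: "integral {0..} ?g \<ge> 0" by (intro integral_nonneg g) simp
  show thesis
  proof (rule that[of "K * integral {0..} ?g * inverse \<bar>Gamma \<alpha>\<bar>"])
    show "0 \<le> K * integral {0..} ?g * inverse \<bar>Gamma \<alpha>\<bar>" using K g0 by simp
    fix x :: 'a
    let ?f = "\<lambda>t. t powr (\<alpha> - 1) *\<^sub>R semigroup_neg D A t x"
    have "norm (integral {0..} ?f) \<le> (K * norm x) * integral {0..} ?g"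
    \<comment> \<open>an integral that does not exist has the value \<open>0\<close>, which satisfies the same bound\<close>
    proof (cases "?f integrable_on {0..}")
      case True
      have "norm (integral {0..} ?f) \<le> integral {0..} (\<lambda>t. (K * norm x) * ?g t)"
      proof (rule Henstock_Kurzweil_Integration.integral_norm_bound_integral[OF True integrable_on_mult_right[OF g]])
        fix t :: real assume "t \<in> {0..}"
        then have t: "t \<ge> 0" by simp
        have "norm (?f t) \<le> t powr (\<alpha> - 1) * (K * exp (- r0 * t) * norm x)"
          unfolding semigroup_neg_eq[OF t] norm_scaleR using K(2)[OF t] by (intro mult_mono) auto
        then show "norm (?f t) \<le> (K * norm x) * ?g t" by (simp add: mult_ac)
      qed
      then show ?thesis by (simp only: integral_mult_right)
    next
      case False
      then show ?thesis using K g0 by (simp add: not_integrable_integral)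
    qed
    then have "norm (frac_power_neg D A \<alpha> x) \<le> ((K * norm x) * integral {0..} ?g) * inverse \<bar>Gamma \<alpha>\<bar>"
      unfolding frac_power_neg_def norm_scaleR abs_inverse by (subst mult.commute) (rule mult_right_mono, auto)
    then show "norm (frac_power_neg D A \<alpha> x) \<le> K * integral {0..} ?g * inverse \<bar>Gamma \<alpha>\<bar> * norm x"
      by (simp add: mult_ac)
  qed
qed

text \<open>The angle \<open>d / 2 + \<phi>\<close> lies half-way between \<open>\<phi>\<close>, for which the vertex is \<open>\<rho>\<^sub>0\<close>, and \<open>arccos (\<rho>\<^sub>1 / \<kappa>)\<close>, for which it
is \<open>\<rho>\<^sub>1\<close>.\<close>

lemma hyperbola_parameters:
  assumes \<rho>: "0 < \<rho>\<^sub>1" "\<rho>\<^sub>1 < \<rho>\<^sub>0" and \<phi>: "0 < \<phi>" "\<phi> < pi / 2"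
  defines "\<kappa> \<equiv> sqrt (\<rho>\<^sub>0\<^sup>2 + (hyp_b0 \<rho>\<^sub>0 \<phi>)\<^sup>2)"
  defines "d \<equiv> hyp_d1 \<rho>\<^sub>0 \<phi> \<rho>\<^sub>1"
  shows "\<kappa> > 0" "d > 0" "\<And>y. \<bar>y\<bar> < d / 2 \<Longrightarrow> \<phi> < d / 2 + \<phi> - y \<and> d / 2 + \<phi> - y < pi / 2 \<and>
      \<rho>\<^sub>1 < \<kappa> * cos (d / 2 + \<phi> - y) \<and> \<kappa> * cos (d / 2 + \<phi> - y) < \<rho>\<^sub>0"
proof -
  have c: "cos \<phi> > 0" using \<phi> by (intro cos_gt_zero_pi) auto
  have "\<rho>\<^sub>0\<^sup>2 + (hyp_b0 \<rho>\<^sub>0 \<phi>)\<^sup>2 = (\<rho>\<^sub>0 / cos \<phi>)\<^sup>2"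
  proof -
    have "\<rho>\<^sub>0\<^sup>2 + (hyp_b0 \<rho>\<^sub>0 \<phi>)\<^sup>2 = \<rho>\<^sub>0\<^sup>2 * (1 + (tan \<phi>)\<^sup>2)"
      by (simp add: hyp_b0_def power_mult_distrib algebra_simps)
    also have "\<dots> = \<rho>\<^sub>0\<^sup>2 * (inverse (cos \<phi>))\<^sup>2" using tan_sec[of \<phi>] c by simp
    finally show ?thesis by (simp add: power_mult_distrib divide_inverse)
  qed
  then have \<kappa>: "\<kappa> = \<rho>\<^sub>0 / cos \<phi>" using \<rho> c unfolding \<kappa>_def by (simp only: real_sqrt_abs) simp
  then show \<kappa>0: "\<kappa> > 0" using \<rho> c by simp
  define \<theta> where "\<theta> = arccos (\<rho>\<^sub>1 / \<kappa>)"
  have q: "0 < \<rho>\<^sub>1 / \<kappa>" "\<rho>\<^sub>1 / \<kappa> < cos \<phi>" using \<rho> c by (auto simp: \<kappa> field_simps)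
  then have q1: "\<rho>\<^sub>1 / \<kappa> < 1" using cos_le_one[of \<phi>] by linarith
  have "arccos (\<rho>\<^sub>1 / \<kappa>) < arccos 0" using q q1 by (intro arccos_less_arccos) auto
  then have t1: "\<theta> < pi / 2" by (simp add: \<theta>_def)
  have "arccos (cos \<phi>) < arccos (\<rho>\<^sub>1 / \<kappa>)" using q by (intro arccos_less_arccos) auto
  then have t2: "\<phi> < \<theta>" using \<phi> by (simp add: \<theta>_def arccos_cos)
  have ct: "\<kappa> * cos \<theta> = \<rho>\<^sub>1" using q q1 \<kappa>0 by (simp add: \<theta>_def cos_arccos)
  have cf: "\<kappa> * cos \<phi> = \<rho>\<^sub>0" using c by (simp add: \<kappa>)
  have d: "d = \<theta> - \<phi>" by (simp add: d_def \<theta>_def hyp_d1_def \<kappa>_def)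
  show "d > 0" using d t2 by simp
  show "\<phi> < d / 2 + \<phi> - y \<and> d / 2 + \<phi> - y < pi / 2 \<and>
      \<rho>\<^sub>1 < \<kappa> * cos (d / 2 + \<phi> - y) \<and> \<kappa> * cos (d / 2 + \<phi> - y) < \<rho>\<^sub>0" if "\<bar>y\<bar> < d / 2" for y
  proof -
    have y: "\<phi> < d / 2 + \<phi> - y" "d / 2 + \<phi> - y < \<theta>" using that by (auto simp: d abs_less_iff field_simps)
    have "cos \<theta> < cos (d / 2 + \<phi> - y)" using y t1 \<phi> by (intro cos_monotone_0_pi) auto
    moreover have "cos (d / 2 + \<phi> - y) < cos \<phi>" using y t1 \<phi> by (intro cos_monotone_0_pi) auto
    ultimately show ?thesis using y t1 \<kappa>0 mult_strict_left_mono[of _ _ \<kappa>] unfolding ct[symmetric] cf[symmetric] by force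
  qed
qed

theorem theorem5:
  fixes D :: "'a::complex_banach set" and A :: "'a \<Rightarrow> 'a"
    and \<rho>\<^sub>0 \<phi> \<rho>\<^sub>1 \<alpha> c\<^sub>\<alpha> \<delta>\<^sub>\<alpha> T c\<^sub>0 :: real
    and m j :: nat and a \<tau> :: "nat \<Rightarrow> real"
    and f :: "real \<Rightarrow> 'a"
  assumes A: "strongly_positive D A \<rho>\<^sub>0 \<phi>"
    and m: "1 \<le> m"
    and \<tau>: "0 < \<tau> 1" "strict_mono_on {1..m} \<tau>" "\<tau> m \<le> T"
    and nonlocal: "(\<Sum>i=1..m. \<bar>a i\<bar>) < 1 \<or> (\<Sum>i=1..m. \<bar>a i\<bar> * exp (- \<rho>\<^sub>0 * \<tau> i)) < 1"
    and \<rho>\<^sub>1: "0 < \<rho>\<^sub>1" "\<rho>\<^sub>1 < \<rho>\<^sub>0" "(\<Sum>i=1..m. \<bar>a i\<bar> * exp (- \<rho>\<^sub>1 * \<tau> i)) < 1"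
    and \<alpha>: "0 < \<alpha>"
    and c\<^sub>\<alpha>: "0 < c\<^sub>\<alpha>"
    and \<delta>\<^sub>\<alpha>: "0 < \<delta>\<^sub>\<alpha>" "\<delta>\<^sub>\<alpha> \<le> sqrt 2 * \<rho>\<^sub>0"
    and f_dom: "\<forall>t\<ge>0. f t \<in> frac_power_dom D A \<alpha>"
    and f_ext: "\<exists>F. (\<forall>t\<ge>0. F (complex_of_real t) = f t) \<and>
                  F holomorphic_vec_on (sector 0 \<phi> - {0}) \<and>
                  (\<forall>w\<in>sector 0 \<phi>. F w \<in> frac_power_dom D A \<alpha> \<and>
                     norm (frac_power D A \<alpha> (F w)) \<le> c\<^sub>\<alpha> * exp (- \<delta>\<^sub>\<alpha> * \<bar>Re w\<bar>))"
    and j: "j \<in> {1..m}"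
    and c\<^sub>0: "0 < c\<^sub>0"
  shows "uniform_limit {0..}
           (\<lambda>N. u2_approx D A \<rho>\<^sub>0 \<phi> \<rho>\<^sub>1 m a \<tau> f j c\<^sub>0 N) (u2_ih D A m a \<tau> f j) sequentially \<and>
         (\<exists>c>0. \<exists>c\<^sub>1>0. \<forall>N\<ge>1. \<forall>t\<ge>0.
            norm (u2_ih D A m a \<tau> f j t - u2_approx D A \<rho>\<^sub>0 \<phi> \<rho>\<^sub>1 m a \<tau> f j c\<^sub>0 N t)
              \<le> c * exp (- c\<^sub>1 * sqrt (real N)))"
proof -
  obtain F where F: "\<And>t. t \<ge> 0 \<Longrightarrow> F (complex_of_real t) = f t" "F holomorphic_vec_on (sector 0 \<phi> - {0})"
    "\<And>w. w \<in> sector 0 \<phi> \<Longrightarrow> F w \<in> frac_power_dom D A \<alpha>"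
    "\<And>w. w \<in> sector 0 \<phi> \<Longrightarrow> norm (frac_power D A \<alpha> (F w)) \<le> c\<^sub>\<alpha> * exp (- \<delta>\<^sub>\<alpha> * \<bar>Re w\<bar>)"
    using f_ext by blast
  have \<phi>: "0 < \<phi>" "\<phi> < pi / 2" "0 < \<rho>\<^sub>0" using A by (auto simp: strongly_positive_def)
  obtain M where M: "M > 0" "\<And>z. z \<in> - sector \<rho>\<^sub>0 \<phi> \<Longrightarrow> z \<in> resolvent_set D A \<and> onorm (resolvent D A z) \<le> M / (1 + cmod z)"
    using A unfolding strongly_positive_def by blast
  define \<kappa> where "\<kappa> = sqrt (\<rho>\<^sub>0\<^sup>2 + (hyp_b0 \<rho>\<^sub>0 \<phi>)\<^sup>2)"
  define d where "d = hyp_d1 \<rho>\<^sub>0 \<phi> \<rho>\<^sub>1"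
  define \<psi> where "\<psi> = d / 2 + \<phi>"
  note hp = hyperbola_parameters[OF \<rho>\<^sub>1(1,2) \<phi>(1,2), folded \<kappa>_def d_def]
  have psi: "\<phi> < \<psi>" "\<psi> < pi / 2" "\<rho>\<^sub>1 < \<kappa> * cos \<psi>" "\<kappa> * cos \<psi> < \<rho>\<^sub>0"
    using hp(3)[of 0] hp(2) by (simp_all add: \<psi>_def)
  have \<tau>_pos: "\<tau> i > 0" if "i \<in> {1..m}" for i
  proof -
    have "\<tau> 1 \<le> \<tau> i" using that m strict_mono_on_leD[OF \<tau>(2), of 1 i] by auto
    then show ?thesis using \<tau>(1) by linarith
  qed
  interpret S: sectorial_nonlocal D A \<rho>\<^sub>0 \<phi> M \<kappa> \<psi> \<rho>\<^sub>1 m a \<tau>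
    by unfold_locales (use A M psi hp(1) \<rho>\<^sub>1 \<tau>_pos in auto)
  obtain C where C: "C \<ge> 0" "\<And>x. norm (frac_power_neg D A \<alpha> x) \<le> C * norm x"
    using S.frac_power_neg_bounded[OF \<alpha>] by blast
  have V: "norm (F w) \<le> C * c\<^sub>\<alpha>" if w: "w \<in> sector 0 \<phi> - {0}" for w
  proof -
    have ws: "w \<in> sector 0 \<phi>" using w by simp
    have "F w = frac_power_neg D A \<alpha> (frac_power D A \<alpha> (F w))"
      using F(3)[OF ws] unfolding frac_power_def frac_power_dom_def by (simp add: f_inv_into_f)
    then have "norm (F w) \<le> C * norm (frac_power D A \<alpha> (F w))" using C(2) by metis
    also have "\<dots> \<le> C * (c\<^sub>\<alpha> * 1)"
    proof (rule mult_left_mono[OF order_trans[OF F(4)[OF ws] mult_left_mono] C(1)])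
      show "exp (- \<delta>\<^sub>\<alpha> * \<bar>Re w\<bar>) \<le> 1" using \<delta>\<^sub>\<alpha> by simp
    qed (use c\<^sub>\<alpha> in simp)
    finally show ?thesis by simp
  qed
  \<comment> \<open>the second condition on the width of the strip holds with the value \<open>1\<close> at \<open>y = 0\<close>\<close>
  have "isCont (\<lambda>y. cos (2 * y) - tan \<psi> * \<bar>sin (2 * y)\<bar>) 0" by (intro continuous_intros)
  then have "((\<lambda>y. cos (2 * y) - tan \<psi> * \<bar>sin (2 * y)\<bar>) \<longlongrightarrow> 1) (at 0)" by (simp add: isCont_def)
  then have "\<forall>\<^sub>F y in at 0. 1/2 < cos (2 * y) - tan \<psi> * \<bar>sin (2 * y)\<bar>" by (rule order_tendstoD) simp
  then obtain \<delta> where \<delta>: "\<delta> > 0" "\<And>y. y \<noteq> 0 \<Longrightarrow> \<bar>y\<bar> < \<delta> \<Longrightarrow> 1/2 < cos (2 * y) - tan \<psi> * \<bar>sin (2 * y)\<bar>"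
    unfolding eventually_at by (auto simp: dist_real_def)
  define d0 where "d0 = min (d / 2) (min (\<phi> / 2) \<delta>)"
  have d0: "d0 > 0" using hp(2) \<phi> \<delta> by (simp add: d0_def)
  have tilt: "\<phi> \<le> \<psi> - y \<and> \<psi> - y < pi / 2 \<and> \<rho>\<^sub>1 < \<kappa> * cos (\<psi> - y) \<and> \<kappa> * cos (\<psi> - y) < \<rho>\<^sub>0" if "\<bar>y\<bar> < d0" for y
    using hp(3)[of y] that by (simp add: d0_def \<psi>_def)
  have narrow: "2 * \<bar>y\<bar> < \<phi> \<and> 1/2 \<le> cos (2 * y) - tan \<psi> * \<bar>sin (2 * y)\<bar>" if "\<bar>y\<bar> < d0" for y
    using \<delta>(2)[of y] that by (cases "y = 0") (auto simp: d0_def)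
  have T: "\<tau> j > 0" by (rule \<tau>_pos[OF j])
  have z: "hyp_z \<rho>\<^sub>0 \<phi> \<rho>\<^sub>1 \<xi> = hyperbola 0 \<kappa> \<psi> \<xi>" "hyp_z' \<rho>\<^sub>0 \<phi> \<rho>\<^sub>1 \<xi> = hyperbola' \<kappa> \<psi> \<xi>" for \<xi>
    unfolding hyp_z_def hyp_z'_def hyp_aI_def hyp_bI_def \<kappa>_def[symmetric] d_def[symmetric] \<psi>_def[symmetric]
      hyperbola_def hyperbola'_def cos_complex sin_complex
    by (simp_all add: complex_eq_iff)
  have approx: "u2_approx D A \<rho>\<^sub>0 \<phi> \<rho>\<^sub>1 m a \<tau> f j c\<^sub>0 N t = S.double_sum (\<tau> j) F N (c\<^sub>0 / sqrt (real N)) t" for N t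
  proof -
    have fq: "f (quad_node (\<tau> j) h p) = F (of_real (\<tau> j / 2 * (1 + tanh (of_int p * h))))" for h p
    proof -
      have "- 1 < tanh (of_int p * h)" by (rule tanh_real_gt_neg1)
      then have "0 \<le> \<tau> j / 2 * (1 + tanh (of_int p * h))" using T by (intro mult_nonneg_nonneg) auto
      then show ?thesis unfolding quad_node_def by (rule F(1)[symmetric])
    qed
    show ?thesis
      by (simp only: u2_approx_def Let_def quad_weight_def z fq
          S.double_sum_def[OF T F(2) V d0 tilt narrow] S.inner_sum_def[OF T F(2) V d0 tilt narrow])
  qed
  have exact: "u2_ih D A m a \<tau> f j t = integral {0..\<tau> j} (\<lambda>s. inv (nonlocal_op D A m a \<tau>) (semigroup_neg D A (t + \<tau> j - s) (F (of_real s))))" for t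
    unfolding u2_ih_def by (rule integral_cong) (simp add: F(1))
  have "\<exists>c>0. \<exists>c\<^sub>1>0. \<forall>N\<ge>1. \<forall>t\<ge>0.
            norm (u2_ih D A m a \<tau> f j t - u2_approx D A \<rho>\<^sub>0 \<phi> \<rho>\<^sub>1 m a \<tau> f j c\<^sub>0 N t)
              \<le> c * exp (- c\<^sub>1 * sqrt (real N))"
    unfolding exact approx by (rule S.quadrature_convergence[OF T F(2) V d0 tilt narrow c\<^sub>0])
  then obtain c c\<^sub>1 where c: "c > 0" "c\<^sub>1 > 0"
    "\<And>N t. N \<ge> 1 \<Longrightarrow> t \<ge> 0 \<Longrightarrow> norm (u2_ih D A m a \<tau> f j t - u2_approx D A \<rho>\<^sub>0 \<phi> \<rho>\<^sub>1 m a \<tau> f j c\<^sub>0 N t) \<le> c * exp (- c\<^sub>1 * sqrt (real N))"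
    by blast
  have "(\<lambda>N. c * exp (- (c\<^sub>1 * sqrt (real N)))) \<longlonglongrightarrow> c * 0"
    by (intro tendsto_mult tendsto_const filterlim_compose[OF exp_at_bot] filterlim_compose[OF filterlim_uminus_at_bot_at_top]
        filterlim_tendsto_pos_mult_at_top[OF tendsto_const c(2)] filterlim_compose[OF sqrt_at_top filterlim_real_sequentially])
  then have lim: "(\<lambda>N. c * exp (- c\<^sub>1 * sqrt (real N))) \<longlonglongrightarrow> 0" by simp
  have "uniform_limit {0..} (\<lambda>N. u2_approx D A \<rho>\<^sub>0 \<phi> \<rho>\<^sub>1 m a \<tau> f j c\<^sub>0 N) (u2_ih D A m a \<tau> f j) sequentially"
  proof (rule uniform_limitI)
    fix e :: real assume "e > 0"
    then have "\<forall>\<^sub>F N in sequentially. c * exp (- c\<^sub>1 * sqrt (real N)) < e" by (rule order_tendstoD[OF lim])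
    then show "\<forall>\<^sub>F N in sequentially. \<forall>t\<in>{0..}. dist (u2_approx D A \<rho>\<^sub>0 \<phi> \<rho>\<^sub>1 m a \<tau> f j c\<^sub>0 N t) (u2_ih D A m a \<tau> f j t) < e"
      using eventually_ge_at_top[of 1]
    proof eventually_elim
      case (elim N)
      show ?case
      proof
        fix t :: real assume "t \<in> {0..}"
        then show "dist (u2_approx D A \<rho>\<^sub>0 \<phi> \<rho>\<^sub>1 m a \<tau> f j c\<^sub>0 N t) (u2_ih D A m a \<tau> f j t) < e"
          using c(3)[of N t] elim by (simp add: dist_norm norm_minus_commute)
      qed
    qed
  qed
  then show ?thesis using c by blast
qed

end
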